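(* Let $n,r$ be positive integers and $\phi=(\phi_1,\dots,\phi_r)$ integers with $0<\phi_1<\phi_2<\dots<\phi_r\le n$; set $\phi_{r+1}=0$ and let $\ell^+(\phi)$ be $r$ if $r$ is even and $r+1$ if $r$ is odd. Then $\hat{\mathfrak S}[\phi_1,\dots,\phi_r;n]=\operatorname{pf}\left[\hat{\mathfrak S}[\phi_i,\phi_j;n]\right]_{1\le i<j\le\ell^+(\phi)}$.
   Context: For $w\in S_m$, the Schubert polynomial is $\mathfrak S_w=\partial_{w^{-1}w_m}(x_1^{m-1}x_2^{m-2}\cdots x_{m-1})$, where $w_m=m\cdots21$, $\partial_i f=(f-s_if)/(x_i-x_{i+1})$ with $s_i$ swapping $x_i,x_{i+1}$, and $\partial_w=\partial_{i_1}\cdots\partial_{i_k}$ for any reduced word $s_{i_1}\cdots s_{i_k}$ of $w$ (independent of $m$). For an involution $y$ of the positive integers with finite support, $\hat{\mathfrak S}_y=\sum_{w\in\mathcal A(y)}\mathfrak S_w$, where $\mathcal A(y)$ is the set of minimal-length permutations $w$ with $w^{-1}\circ w=y$ for the Demazure product $\circ$ (associative, $u\circ v=uv$ when lengths add, $s_i\circ s_i=s_i$). For $0<\psi_1<\dots<\psi_k\le n$, $\hat{\mathfrak S}[\psi_1,\dots,\psi_k;n]=\hat{\mathfrak S}_y$ with $y=(\psi_1,n+1)(\psi_2,n+2)\cdots(\psi_k,n+k)$; when $k$ is odd, also $\hat{\mathfrak S}[\psi_1,\dots,\psi_k,0;n]=\hat{\mathfrak S}[\psi_1,\dots,\psi_k;n]$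 (in particular $\hat{\mathfrak S}[\phi_i,0;n]=\hat{\mathfrak S}[\phi_i;n]$). $[a_{ij}]_{1\le i<j\le m}$ denotes the $m\times m$ skew-symmetric matrix with entry $a_{ij}$ in position $(i,j)$ for $i<j$, and $\operatorname{pf}$ is the Pfaffian (normalized so that $\operatorname{pf}$ of a $2\times2$ matrix $[a_{12}]$ is $a_{12}$). *)

theory Defs
  imports "HOL-Library.Poly_Mapping" "HOL-Combinatorics.Permutations" "Jordan_Normal_Form.Matrix"
begin

text \<open>
  Permutations of the positive integers are functions on \<^typ>\<open>nat\<close> fixing 0; the product is
  function composition, and S_m consists of the \<open>w\<close> with \<open>w permutes {1..m}\<close>.
  Polynomials in x_1, x_2, ... over the integers are finitely supported maps from exponent
  vectors to coefficients.
\<close>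

definition Sinf :: "(nat \<Rightarrow> nat) set" where
  "Sinf = {w. \<exists>m. w permutes {1..m}}"

abbreviation simple_refl :: "nat \<Rightarrow> nat \<Rightarrow> nat" where
  "simple_refl i \<equiv> transpose i (Suc i)"

definition word_prod :: "nat list \<Rightarrow> nat \<Rightarrow> nat" where
  "word_prod a = foldr (\<lambda>i u. simple_refl i \<circ> u) a id"

definition is_word :: "nat list \<Rightarrow> (nat \<Rightarrow> nat) \<Rightarrow> bool" where
  "is_word a w \<longleftrightarrow> (\<forall>i\<in>set a. 1 \<le> i) \<and> word_prod a = w"

definition perm_length :: "(nat \<Rightarrow> nat) \<Rightarrow> nat" where
  "perm_length w = (LEAST k. \<exists>a. is_word a w \<and> length a = k)"

definition reduced_word :: "nat list \<Rightarrow> (nat \<Rightarrow> nat) \<Rightarrow> bool" where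
  "reduced_word a w \<longleftrightarrow> is_word a w \<and> length a = perm_length w"

definition longest_perm :: "nat \<Rightarrow> nat \<Rightarrow> nat" where
  "longest_perm m i = (if i \<in> {1..m} then m + 1 - i else i)"

definition is_demazure_product :: "((nat \<Rightarrow> nat) \<Rightarrow> (nat \<Rightarrow> nat) \<Rightarrow> (nat \<Rightarrow> nat)) \<Rightarrow> bool" where
  "is_demazure_product D \<longleftrightarrow>
     (\<forall>u\<in>Sinf. \<forall>v\<in>Sinf. D u v \<in> Sinf) \<and>
     (\<forall>u\<in>Sinf. \<forall>v\<in>Sinf. \<forall>w\<in>Sinf. D (D u v) w = D u (D v w)) \<and>
     (\<forall>u\<in>Sinf. \<forall>v\<in>Sinf. perm_length (u \<circ> v) = perm_length u + perm_length v \<longrightarrow> D u v = u \<circ> v) \<and>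
     (\<forall>i\<ge>1. D (simple_refl i) (simple_refl i) = simple_refl i)"

text \<open>
  The conditions determine the operation on \<^const>\<open>Sinf\<close> uniquely; its values outside
  \<^const>\<open>Sinf\<close> are unspecified and never used.
\<close>
definition demazure :: "(nat \<Rightarrow> nat) \<Rightarrow> (nat \<Rightarrow> nat) \<Rightarrow> (nat \<Rightarrow> nat)" where
  "demazure = (SOME D. is_demazure_product D)"

definition atoms :: "(nat \<Rightarrow> nat) \<Rightarrow> (nat \<Rightarrow> nat) set" where
  "atoms y = {w \<in> Sinf. demazure (inv_into UNIV w) w = y \<and>
     (\<forall>v\<in>Sinf. demazure (inv_into UNIV v) v = y \<longrightarrow> perm_length w \<le> perm_length v)}"

type_synonym ipoly = "(nat \<Rightarrow>\<^sub>0 nat) \<Rightarrow>\<^sub>0 int"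

definition X :: "nat \<Rightarrow> ipoly" where
  "X i = Poly_Mapping.single (Poly_Mapping.single i 1) 1"

text \<open>The inner \<open>map_key\<close> permutes an exponent vector, the outer one acts on the polynomial.\<close>
definition swap_vars :: "nat \<Rightarrow> ipoly \<Rightarrow> ipoly" where
  "swap_vars i f = Poly_Mapping.map_key (Poly_Mapping.map_key (simple_refl i)) f"

text \<open>The quotient of \<open>f - s_i f\<close> by \<open>x_i - x_(i+1)\<close>, which is exact, and unique as the ring
  is an integral domain.\<close>
definition divdiff :: "nat \<Rightarrow> ipoly \<Rightarrow> ipoly" where
  "divdiff i f = (THE g. (X i - X (Suc i)) * g = f - swap_vars i f)"

text \<open>The result does not depend on the reduced word.\<close>
definition divdiff_perm :: "(nat \<Rightarrow> nat) \<Rightarrow> ipoly \<Rightarrow> ipoly" where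
  "divdiff_perm w f = foldr divdiff (SOME a. reduced_word a w) f"

definition schubert_in :: "nat \<Rightarrow> (nat \<Rightarrow> nat) \<Rightarrow> ipoly" where
  "schubert_in m w = divdiff_perm (inv_into UNIV w \<circ> longest_perm m) (\<Prod>i = 1..<m. X i ^ (m - i))"

text \<open>\<^term>\<open>schubert_in m w\<close> is the same for all \<open>m\<close> with \<open>w\<close> in S_m; we fix the least one.\<close>
definition schubert :: "(nat \<Rightarrow> nat) \<Rightarrow> ipoly" where
  "schubert w = schubert_in (LEAST m. w permutes {1..m}) w"

definition inv_schubert :: "(nat \<Rightarrow> nat) \<Rightarrow> ipoly" where
  "inv_schubert y = (\<Sum>w\<in>atoms y. schubert w)"

text \<open>\<open>(\<psi>_1, n+1)(\<psi>_2, n+2)\<cdots>(\<psi>_k, n+k)\<close>; list positions start at 0.\<close>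
definition grass_inv :: "nat list \<Rightarrow> nat \<Rightarrow> nat \<Rightarrow> nat" where
  "grass_inv \<psi> n = foldr (\<lambda>j u. transpose (\<psi> ! j) (n + j + 1) \<circ> u) [0..<length \<psi>] id"

text \<open>A final 0 padding a list to even length is dropped.\<close>
definition inv_schubert_grass :: "nat list \<Rightarrow> nat \<Rightarrow> ipoly" where
  "inv_schubert_grass \<psi> n =
     inv_schubert (grass_inv
       (if \<psi> \<noteq> [] \<and> even (length \<psi>) \<and> last \<psi> = 0 then butlast \<psi> else \<psi>) n)"

text \<open>Matrices of the library are indexed from 0, the entries \<open>a i j\<close> from 1.\<close>
definition skew_mat :: "nat \<Rightarrow> (nat \<Rightarrow> nat \<Rightarrow> 'a::comm_ring_1) \<Rightarrow> 'a mat" where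
  "skew_mat m a = mat m m (\<lambda>(i, j).
     if i < j then a (i + 1) (j + 1) else if j < i then - a (j + 1) (i + 1) else 0)"

text \<open>Perfect matchings of \<open>{0..<2k}\<close> are encoded as the permutations listing the pairs
  \<open>{\<pi> (2 i), \<pi> (2 i + 1)}\<close>, each in increasing order and sorted by smaller element.\<close>
definition matching_perms :: "nat \<Rightarrow> (nat \<Rightarrow> nat) set" where
  "matching_perms k = {\<pi>. \<pi> permutes {0..<2 * k} \<and>
     (\<forall>i<k. \<pi> (2 * i) < \<pi> (2 * i + 1)) \<and>
     (\<forall>i j. i < j \<and> j < k \<longrightarrow> \<pi> (2 * i) < \<pi> (2 * j))}"

definition pfaffian :: "'a::comm_ring_1 mat \<Rightarrow> 'a" where
  "pfaffian A =
     (if odd (dim_row A) then 0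
      else let k = dim_row A div 2 in
        \<Sum>\<pi>\<in>matching_perms k. of_int (sign \<pi>) * (\<Prod>i<k. A $$ (\<pi> (2 * i), \<pi> (2 * i + 1))))"

definition ell_plus :: "nat \<Rightarrow> nat" where
  "ell_plus r = (if even r then r else r + 1)"

end

theory Submission
  imports Defs "HOL-Computational_Algebra.Fraction_Field" "HOL-Computational_Algebra.Polynomial"
begin

text \<open>
  The involution Schubert polynomials are the coefficients of a product of factors \<open>1 + z u_k\<close>,
  with \<open>z\<close> running over the \<open>x_i\<close> and \<open>x_i + x_j\<close>, in the nilCoxeter action on involutions: by
  the Yang-Baxter equation and a boundary relation at the identity this product satisfies the
  divided difference recursion that determines them. For \<open>\<phi> = (1, \<dots>, r)\<close> only one term
  contributes, which gives \<open>\<Prod>i\<le>r. x_i \<Prod>i<j\<le>n. (x_i + x_j)\<close>.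

  Raising an entry of \<open>\<phi>\<close> by one is a divided difference. By induction the polynomial of \<open>\<phi>\<close> is
  the sum, over all \<open>i_1 \<le> \<phi>_1, \<dots>, i_r \<le> \<phi>_r\<close>, of one-variable coefficients \<open>c(\<phi>_k, i_k)\<close>
  times the product of \<open>(x_(i_l) - x_(i_k)) / (x_(i_l) + x_(i_k))\<close> over \<open>k < l\<close>. Schur's Pfaffian
  evaluates that product, and the Pfaffian is linear in each index, so it can be taken out of the sum.
\<close>

text \<open>Column c of the product carries the variable x_(c+1), with the factor of x_(c+1) + x_i
  at the generator u_(i+c). Exchanging x_i and x_(i+1) produces one extra outermost factor 1 +
  (x_(i+1) - x_i) u_i; its coefficient at y is the divided difference recursion. Where both
  variables are entries of a column, Yang-Baxter carries the extra factor through. Where x_i is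
  itself the label of a column, neighbouring columns trade places, and this needs relations that
  hold only when the action starts at the identity involution.

  The sum formula has denominators x_i + x_j and x_i - x_j, so it is proved in a field, for all
  admissible points at once: a divided difference also evaluates at the point with two coordinates
  swapped. Admissibility of the generic point of the fraction field then gives back polynomials.

  The indices i_1, ..., i_r range independently, so the expansion of the Pfaffian is needed for
  index lists with repetitions too, where the product vanishes. For odd r the padding index 0
  contributes quotients equal to 1.\<close>

hide_const (open) Polynomial.degree

section \<open>Divided differences\<close>

lemma single_zero_eq_of_int: "Poly_Mapping.single 0 c = (of_int c :: ipoly)"
  by (metis single_of_int of_int_eq_id id_apply)

lemma ipoly_single_induct [case_names single add]:
  assumes single: "\<And>a c. P (Poly_Mapping.single a c)"
    and add: "\<And>f g. P f \<Longrightarrow> P g \<Longrightarrow> P (f + g)"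
  shows "P (f :: ipoly)"
proof (induction f rule: Poly_Mapping.update_induct)
  case const
  show ?case using single[of 0 0] by simp
next
  case (update f a c)
  have "Poly_Mapping.update a c f = Poly_Mapping.single a c + f"
    using update(1) by (intro poly_mapping_eqI)
      (auto simp: lookup_update lookup_add lookup_single when_def in_keys_iff)
  then show ?case using add[OF single update.IH] by simp
qed

text \<open>Integers and variables generate the ring, so identities between additive and
  multiplicative maps such as \<open>swap_vars\<close> and \<open>ev\<close> need checking only on
  these.\<close>

lemma ipoly_induct [case_names const add mult]:
  assumes const: "\<And>c. P (of_int c)" and add: "\<And>f g. P f \<Longrightarrow> P g \<Longrightarrow> P (f + g)"
    and mult: "\<And>k f. P f \<Longrightarrow> P (X k * f)"
  shows "P (f :: ipoly)"
proof (induction f rule: ipoly_single_induct)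
  case (single a c)
  show ?case
  proof (induction a rule: Poly_Mapping.update_induct)
    case const
    show ?case using assms(1)[of c] single_zero_eq_of_int[of c] by metis
  next
    case (update a k e)
    have "Poly_Mapping.update k e a = Poly_Mapping.single k e + a"
      using update(1) by (intro poly_mapping_eqI)
        (auto simp: lookup_update lookup_add lookup_single when_def in_keys_iff)
    moreover have "P (Poly_Mapping.single (Poly_Mapping.single k e + a) c)"
    proof (induction e)
      case 0
      then show ?case using update.IH by simp
    next
      case (Suc e)
      have "Poly_Mapping.single (Poly_Mapping.single k (Suc e) + a) c
        = X k * Poly_Mapping.single (Poly_Mapping.single k e + a) c"
        by (simp add: X_def mult_single add.assoc [symmetric] single_add [symmetric])
      then show ?case using mult[OF Suc] by simp
    qed
    ultimately show ?case by simp
  qed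
qed (rule add)

lemma map_key_simple_refl_involution:
  "Poly_Mapping.map_key (simple_refl i) (Poly_Mapping.map_key (simple_refl i) \<alpha>) = \<alpha>"
proof -
  have "inj (simple_refl i)" by simp
  then have "Poly_Mapping.map_key (simple_refl i) (Poly_Mapping.map_key (simple_refl i) \<alpha>)
      = Poly_Mapping.map_key (simple_refl i \<circ> simple_refl i) \<alpha>"
    by (simp add: map_key_compose)
  then show ?thesis by (simp add: map_key_id id_def)
qed

lemma inj_map_key_simple_refl: "inj (Poly_Mapping.map_key (simple_refl i) :: (nat \<Rightarrow>\<^sub>0 nat) \<Rightarrow> _)"
  by (rule inj_on_inverseI) (rule map_key_simple_refl_involution)

lemma lookup_map_key_simple_refl:
  "Poly_Mapping.lookup (Poly_Mapping.map_key (simple_refl i) \<alpha>) k = Poly_Mapping.lookup \<alpha> (simple_refl i k)"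
  by (simp add: map_key.rep_eq)

lemma lookup_swap_vars:
  "Poly_Mapping.lookup (swap_vars i f) \<alpha> = Poly_Mapping.lookup f (Poly_Mapping.map_key (simple_refl i) \<alpha>)"
  by (simp add: swap_vars_def map_key.rep_eq inj_map_key_simple_refl)

lemma swap_vars_add [simp]: "swap_vars i (f + g) = swap_vars i f + swap_vars i g"
  by (intro poly_mapping_eqI) (simp add: lookup_swap_vars lookup_add)

lemma swap_vars_diff [simp]: "swap_vars i (f - g) = swap_vars i f - swap_vars i g"
  by (intro poly_mapping_eqI) (simp add: lookup_swap_vars lookup_minus)

lemma swap_vars_swap_vars [simp]: "swap_vars i (swap_vars i f) = f"
  by (intro poly_mapping_eqI) (simp add: lookup_swap_vars map_key_simple_refl_involution)

lemma swap_vars_single: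
  "swap_vars i (Poly_Mapping.single \<alpha> c) = Poly_Mapping.single (Poly_Mapping.map_key (simple_refl i) \<alpha>) c"
  by (intro poly_mapping_eqI)
    (auto simp: lookup_swap_vars lookup_single when_def map_key_simple_refl_involution)

lemma swap_vars_of_int [simp]: "swap_vars i (of_int c) = of_int c"
  using swap_vars_single[of i 0 c] by (simp add: single_zero_eq_of_int)

lemma swap_vars_0 [simp]: "swap_vars i 0 = 0"
  using swap_vars_of_int[of i 0] by simp

lemma swap_vars_1 [simp]: "swap_vars i 1 = 1"
  using swap_vars_of_int[of i 1] by simp

lemma swap_vars_X [simp]: "swap_vars i (X k) = X (simple_refl i k)"
proof -
  have "Poly_Mapping.map_key (simple_refl i) (Poly_Mapping.single k (1::nat))
    = Poly_Mapping.single (simple_refl i k) 1"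
    by (intro poly_mapping_eqI)
      (auto simp: lookup_map_key_simple_refl lookup_single when_def)
  then show ?thesis by (simp add: X_def swap_vars_single)
qed

lemma map_key_simple_refl_add:
  "Poly_Mapping.map_key (simple_refl i) (\<alpha> + \<beta>)
    = Poly_Mapping.map_key (simple_refl i) \<alpha> + Poly_Mapping.map_key (simple_refl i) \<beta>"
  by (intro poly_mapping_eqI) (simp add: lookup_map_key_simple_refl lookup_add)

lemma swap_vars_mult [simp]: "swap_vars i (f * g) = swap_vars i f * swap_vars i g"
proof (induction f rule: ipoly_single_induct)
  case (single a c)
  show ?case
    by (induction g rule: ipoly_single_induct)
      (simp_all add: mult_single swap_vars_single map_key_simple_refl_add distrib_left)
qed (simp add: distrib_right)

lemma swap_vars_commute:
  assumes "Suc i < j \<or> Suc j < i"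
  shows "swap_vars i (swap_vars j f) = swap_vars j (swap_vars i f)"
  by (induction f rule: ipoly_induct)
    (use assms in \<open>auto simp: transpose_def\<close>)

lemma swap_vars_braid:
  "swap_vars i (swap_vars (Suc i) (swap_vars i f)) = swap_vars (Suc i) (swap_vars i (swap_vars (Suc i) f))"
  by (induction f rule: ipoly_induct) (auto simp: transpose_def)

lemma X_inject: "X i = X j \<longleftrightarrow> i = j"
  unfolding X_def by (metis inj_single injD lookup_single_eq lookup_single_not_eq one_neq_zero)

lemma X_Suc_neq: "X i - X (Suc i) \<noteq> 0"
  by (simp add: X_inject)

lemma divdiffI:
  assumes "(X i - X (Suc i)) * g = f - swap_vars i f"
  shows "divdiff i f = g"
  unfolding divdiff_def
proof (rule the_equality)
  show "(X i - X (Suc i)) * g = f - swap_vars i f" by (rule assms)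
next
  fix g' assume "(X i - X (Suc i)) * g' = f - swap_vars i f"
  with assms have "(X i - X (Suc i)) * g' = (X i - X (Suc i)) * g" by simp
  then show "g' = g" using X_Suc_neq by simp
qed

text \<open>Homogeneous polynomials in x_1, x_2, ... only; 0 has every degree. The inductive form
  makes closure under \<open>swap_vars\<close> and \<open>divdiff\<close> a rule induction.\<close>

inductive homog :: "nat \<Rightarrow> ipoly \<Rightarrow> bool" where
  of_int: "homog 0 (of_int c)"
| zero: "homog d 0"
| add: "homog d f \<Longrightarrow> homog d g \<Longrightarrow> homog d (f + g)"
| X_mult: "homog d f \<Longrightarrow> 1 \<le> k \<Longrightarrow> homog (Suc d) (X k * f)"

lemma homog_uminus: "homog d f \<Longrightarrow> homog d (- f)"
proof (induction rule: homog.induct)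
  case (of_int c)
  show ?case using homog.of_int[of "- c"] by simp
next
  case (X_mult d f k)
  show ?case using homog.X_mult[OF X_mult.IH X_mult.hyps(2)] by simp
next
  case (add d f g)
  show ?case using homog.add[OF add.IH] by simp
qed (simp add: homog.zero)

lemma homog_swap_vars: "homog d f \<Longrightarrow> 1 \<le> i \<Longrightarrow> homog d (swap_vars i f)"
  by (induction rule: homog.induct) (auto intro!: homog.intros simp: transpose_def)

text \<open>Product rule: x_k f - s_i (x_k f) = x_k (f - s_i f) + (x_k - s_i x_k) s_i f, where x_k -
  s_i x_k is 0 or plus or minus x_i - x_(i+1).\<close>

lemma swap_vars_exact:
  "\<exists>g. (X i - X (Suc i)) * g = f - swap_vars i f"
proof (induction f rule: ipoly_induct)
  case (const c)
  show ?case by (intro exI[of _ 0]) simp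
next
  case (add f f')
  then obtain g g' where "(X i - X (Suc i)) * g = f - swap_vars i f"
    "(X i - X (Suc i)) * g' = f' - swap_vars i f'" by blast
  then show ?case by (intro exI[of _ "g + g'"]) (simp add: algebra_simps)
next
  case (mult k f)
  then obtain g where g: "(X i - X (Suc i)) * g = f - swap_vars i f" by blast
  define e :: ipoly where "e = (if k = i then 1 else if k = Suc i then -1 else 0)"
  have e: "X k - X (simple_refl i k) = (X i - X (Suc i)) * e"
    by (auto simp: e_def transpose_def)
  have "(X i - X (Suc i)) * (X k * g + e * swap_vars i f)
      = X k * ((X i - X (Suc i)) * g) + ((X i - X (Suc i)) * e) * swap_vars i f"
    by (simp add: algebra_simps)
  also have "\<dots> = X k * f - swap_vars i (X k * f)"
    unfolding g e[symmetric] by (simp add: algebra_simps)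
  finally show ?case by blast
qed

lemma divdiff_eq: "(X i - X (Suc i)) * divdiff i f = f - swap_vars i f"
  using swap_vars_exact divdiffI by metis

lemma divdiff_0 [simp]: "divdiff i 0 = 0"
  by (rule divdiffI) simp

lemma divdiff_of_int [simp]: "divdiff i (of_int c) = 0"
  by (rule divdiffI) simp

lemma divdiff_add: "divdiff i (f + g) = divdiff i f + divdiff i g"
  by (rule divdiffI) (simp add: distrib_left divdiff_eq)

lemma divdiff_sum: "divdiff i (sum f A) = (\<Sum>x\<in>A. divdiff i (f x))"
  by (induction A rule: infinite_finite_induct) (simp_all add: divdiff_add)

lemma divdiff_eq_0_iff: "divdiff i f = 0 \<longleftrightarrow> swap_vars i f = f"
  using divdiff_eq[of i f] X_Suc_neq[of i] by auto

lemma swap_vars_divdiff [simp]: "swap_vars i (divdiff i f) = divdiff i f"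
proof -
  have "swap_vars i ((X i - X (Suc i)) * divdiff i f) = swap_vars i (f - swap_vars i f)"
    by (simp only: divdiff_eq)
  then have "(X i - X (Suc i)) * swap_vars i (divdiff i f) = f - swap_vars i f"
    by (simp add: algebra_simps)
  then show ?thesis by (metis divdiffI)
qed

lemma divdiff_divdiff [simp]: "divdiff i (divdiff i f) = 0"
  by (simp add: divdiff_eq_0_iff)

lemma divdiff_symmetric_mult:
  assumes "swap_vars i g = g"
  shows "divdiff i (g * f) = g * divdiff i f"
  by (rule divdiffI) (simp add: assms mult.left_commute divdiff_eq right_diff_distrib)

lemma divdiff_X_mult:
  "divdiff i (X k * f) = X k * divdiff i f
    + (if k = i then 1 else if k = Suc i then -1 else 0) * swap_vars i f"
proof (rule divdiffI)
  show "(X i - X (Suc i)) * (X k * divdiff i f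
      + (if k = i then 1 else if k = Suc i then -1 else 0) * swap_vars i f)
    = X k * f - swap_vars i (X k * f)"
    unfolding distrib_left mult.left_commute[of _ "X k"] divdiff_eq
    by (auto simp: transpose_def algebra_simps)
qed

text \<open>Subtraction truncates at 0, so d = 0 needs its own clause. That clause later shows that
  a polynomial with a nonzero divided difference has positive degree.\<close>

lemma homog_divdiff:
  assumes "homog d f" "1 \<le> i"
  shows "homog (d - 1) (divdiff i f) \<and> (d = 0 \<longrightarrow> divdiff i f = 0)"
  using assms
proof (induction rule: homog.induct)
  case (X_mult d f k)
  have "homog d (X k * divdiff i f)"
    using X_mult homog.X_mult[of "d - 1" "divdiff i f" k] by (cases d) (auto intro: homog.zero)
  moreover have "homog d ((if k = i then 1 else if k = Suc i then -1 else 0) * swap_vars i f)"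
    using homog_swap_vars[OF X_mult.hyps(1) X_mult.prems] homog_uminus by (auto intro: homog.zero)
  ultimately show ?case
    using homog.add by (simp only: divdiff_X_mult) simp
qed (auto intro: homog.intros simp: divdiff_add)

lemma homog_lookup:
  assumes "homog d f" "Poly_Mapping.lookup f \<alpha> \<noteq> 0"
  shows "Poly_Mapping.lookup \<alpha> 0 = 0 \<and> (0 < d \<longrightarrow> \<alpha> \<noteq> 0)"
  using assms
proof (induction arbitrary: \<alpha> rule: homog.induct)
  case (of_int c)
  then show ?case
    by (auto simp: lookup_single when_def simp flip: single_zero_eq_of_int split: if_splits)
next
  case (X_mult d f k)
  have "\<alpha> \<in> Poly_Mapping.keys (X k * f)" using X_mult.prems by (simp add: in_keys_iff)
  then obtain \<beta> where "\<alpha> = Poly_Mapping.single k 1 + \<beta>" "\<beta> \<in> Poly_Mapping.keys f"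
    using keys_mult[of "X k" f] by (auto simp: X_def)
  then show ?case using X_mult.IH[of \<beta>] X_mult.hyps
    by (auto simp: lookup_add lookup_single in_keys_iff poly_mapping_eq_iff fun_eq_iff when_def)
next
  case (add d f g)
  then show ?case by (auto simp: lookup_add) (metis add_0)+
qed auto

text \<open>The variable \<open>x_0\<close> is excluded because no \<open>s_i\<close> with \<open>i \<ge> 1\<close> moves it.\<close>
definition no_const :: "ipoly \<Rightarrow> bool" where
  "no_const f \<longleftrightarrow> (\<forall>\<alpha>. Poly_Mapping.lookup f \<alpha> \<noteq> 0 \<longrightarrow> Poly_Mapping.lookup \<alpha> 0 = 0 \<and> \<alpha> \<noteq> 0)"

lemma homog_no_const: "homog d f \<Longrightarrow> 0 < d \<Longrightarrow> no_const f"
  using homog_lookup by (auto simp: no_const_def)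

lemma no_const_0 [simp]: "no_const 0"
  by (simp add: no_const_def)

lemma no_const_add: "no_const f \<Longrightarrow> no_const g \<Longrightarrow> no_const (f + g)"
  unfolding no_const_def lookup_add by (metis add_0)

lemma no_const_diff: "no_const f \<Longrightarrow> no_const g \<Longrightarrow> no_const (f - g)"
  unfolding no_const_def lookup_minus by (metis diff_0_right)

lemma no_const_sum: "(\<And>x. x \<in> A \<Longrightarrow> no_const (f x)) \<Longrightarrow> no_const (sum f A)"
  by (induction A rule: infinite_finite_induct) (auto intro: no_const_add)

text \<open>Let m be the largest index of a variable in f. Symmetry under s_m moves x_m to x_(m+1),
  against maximality. This is the uniqueness principle for the divided difference recursion.\<close>

lemma symmetric_eq_0:
  assumes pos: "no_const f" and sym: "\<And>i. 1 \<le> i \<Longrightarrow> swap_vars i f = f"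
  shows "f = 0"
proof (rule ccontr)
  assume "f \<noteq> 0"
  then obtain \<alpha> where \<alpha>: "Poly_Mapping.lookup f \<alpha> \<noteq> 0"
    by (metis lookup_zero poly_mapping_eqI)
  define S where "S = (\<Union>\<alpha>\<in>Poly_Mapping.keys f. Poly_Mapping.keys \<alpha>)"
  have "finite S" by (simp add: S_def)
  have "\<alpha> \<noteq> 0" using pos \<alpha> by (auto simp: no_const_def)
  then obtain k where "Poly_Mapping.lookup \<alpha> k \<noteq> 0" by (metis lookup_zero poly_mapping_eqI)
  then have "k \<in> S" using \<alpha> by (auto simp: S_def in_keys_iff)
  define m where "m = Max S"
  have "m \<in> S" using \<open>finite S\<close> \<open>k \<in> S\<close> unfolding m_def by (intro Max_in) auto
  then obtain \<beta> where \<beta>: "Poly_Mapping.lookup f \<beta> \<noteq> 0" "Poly_Mapping.lookup \<beta> m \<noteq> 0"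
    by (auto simp: S_def in_keys_iff)
  then have "1 \<le> m" using pos by (cases m) (auto simp: no_const_def)
  let ?\<gamma> = "Poly_Mapping.map_key (simple_refl m) \<beta>"
  have "Poly_Mapping.lookup f ?\<gamma> \<noteq> 0"
    using \<beta>(1) sym[OF \<open>1 \<le> m\<close>] lookup_swap_vars[of m f \<beta>] by simp
  moreover have "Poly_Mapping.lookup ?\<gamma> (Suc m) \<noteq> 0"
    using \<beta>(2) by (simp add: lookup_map_key_simple_refl)
  ultimately have "Suc m \<in> S" by (auto simp: S_def in_keys_iff)
  then show False using Max_ge[OF \<open>finite S\<close>, of "Suc m"] by (simp add: m_def)
qed

text \<open>Cleared of both denominators, either side is f - s_i f - s_j f + s_i s_j f.\<close>

lemma divdiff_commute:
  assumes "Suc i < j \<or> Suc j < i"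
  shows "divdiff i (divdiff j f) = divdiff j (divdiff i f)"
proof (rule divdiffI)
  have X: "swap_vars i (X j) = X j" "swap_vars i (X (Suc j)) = X (Suc j)"
    "swap_vars j (X i) = X i" "swap_vars j (X (Suc i)) = X (Suc i)"
    using assms by (auto simp: transpose_def)
  let ?D = "(X i - X (Suc i))" and ?E = "(X j - X (Suc j))"
  have E: "?E * swap_vars i (divdiff j f) = swap_vars i f - swap_vars i (swap_vars j f)"
    using arg_cong[OF divdiff_eq[of j f], of "swap_vars i"] X by simp
  have D: "?D * swap_vars j (divdiff i f) = swap_vars j f - swap_vars i (swap_vars j f)"
    using arg_cong[OF divdiff_eq[of i f], of "swap_vars j"] X swap_vars_commute[OF assms] by simp
  have "?E * (?D * divdiff j (divdiff i f)) = ?D * (divdiff i f - swap_vars j (divdiff i f))"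
    by (simp only: mult.left_commute[of ?E] divdiff_eq)
  also have "\<dots> = f - swap_vars i f - (swap_vars j f - swap_vars i (swap_vars j f))"
    by (simp only: right_diff_distrib[of ?D "divdiff i f"] divdiff_eq D)
  also have "\<dots> = ?E * (divdiff j f - swap_vars i (divdiff j f))"
    by (simp only: right_diff_distrib[of ?E "divdiff j f"] divdiff_eq E) (simp add: algebra_simps)
  finally show "?D * divdiff j (divdiff i f) = divdiff j f - swap_vars i (divdiff j f)"
    using X_Suc_neq[of j] by simp
qed

text \<open>Three nested divided differences times the Vandermonde product give the
  antisymmetrisation over S_3. A suffix lists the swaps applied, the leftmost one last. Stating it
  for abstract ring elements lets one computation serve both sides of the braid relation.\<close>

lemma divdiff_braid_aux:
  fixes a b c f1 f12 f2 f21 f121 g g2 g12 k k1 l :: "'a::comm_ring_1"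
  assumes "(a - b) * g = f - f1" "(b - c) * k = g - g2" "(a - b) * l = k - k1"
    "(a - c) * g2 = f2 - f21" "(a - c) * k1 = g - g12" "(b - c) * g12 = f12 - f121"
  shows "(a - b) * (a - c) * (b - c) * l = f - f1 - f2 + f21 + f12 - f121"
proof -
  have "(a - b) * (a - c) * (b - c) * l = (a - c) * (b - c) * ((a - b) * l)" by (simp add: algebra_simps)
  also have "\<dots> = (a - c) * ((b - c) * k) - (b - c) * ((a - c) * k1)"
    unfolding assms(3) by (simp add: algebra_simps)
  also have "\<dots> = (a - b) * g - (a - c) * g2 + (b - c) * g12"
    unfolding assms(2,5) by (simp add: algebra_simps)
  also have "\<dots> = f - f1 - f2 + f21 + f12 - f121"
    unfolding assms(1,4,6) by (simp add: algebra_simps)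
  finally show ?thesis .
qed

lemma divdiff_braid:
  "divdiff i (divdiff (Suc i) (divdiff i f)) = divdiff (Suc i) (divdiff i (divdiff (Suc i) f))"
proof -
  let ?s = "swap_vars i" and ?t = "swap_vars (Suc i)"
  let ?a = "X i" and ?b = "X (Suc i)" and ?c = "X (Suc (Suc i))"
  let ?A = "f - ?s f - ?t f + ?t (?s f) + ?s (?t f) - ?s (?t (?s f))"
  have X: "?s ?a = ?b" "?s ?b = ?a" "?s ?c = ?c" "?t ?a = ?a" "?t ?b = ?c" "?t ?c = ?b"
    by (auto simp: transpose_def)
  have 1: "(?a - ?b) * (?a - ?c) * (?b - ?c) * divdiff i (divdiff (Suc i) (divdiff i f)) = ?A"
  proof (rule divdiff_braid_aux)
    let ?g = "divdiff i f"
    show "(?a - ?b) * ?g = f - ?s f" by (rule divdiff_eq)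
    show "(?b - ?c) * divdiff (Suc i) ?g = ?g - ?t ?g" by (rule divdiff_eq)
    show "(?a - ?b) * divdiff i (divdiff (Suc i) ?g)
      = divdiff (Suc i) ?g - ?s (divdiff (Suc i) ?g)" by (rule divdiff_eq)
    show "(?a - ?c) * ?t ?g = ?t f - ?t (?s f)"
      using arg_cong[OF divdiff_eq[of i f], of ?t] by (simp only: swap_vars_mult swap_vars_diff X)
    show "(?a - ?c) * ?s (divdiff (Suc i) ?g) = ?g - ?s (?t ?g)"
      using arg_cong[OF divdiff_eq[of "Suc i" ?g], of ?s]
      by (simp only: swap_vars_mult swap_vars_diff X swap_vars_divdiff)
    show "(?b - ?c) * ?s (?t ?g) = ?s (?t f) - ?s (?t (?s f))"
      using arg_cong[OF arg_cong[OF divdiff_eq[of i f], of ?t], of ?s]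
      by (simp only: swap_vars_mult swap_vars_diff X)
  qed
  have "(?b - ?c) * (?a - ?c) * (?a - ?b)
      * divdiff (Suc i) (divdiff i (divdiff (Suc i) f))
     = f - ?t f - ?s f + ?s (?t f) + ?t (?s f) - ?t (?s (?t f))"
  proof -
    let ?g = "divdiff (Suc i) f"
    \<comment> \<open>The other word is the same pattern with x_i and x_(i+2) interchanged. Each
      divided difference then changes sign, which explains the signs of the instances: one for g,
      two for k, three for the result.\<close>
    have "(?c - ?b) * (?c - ?a) * (?b - ?a) * - divdiff (Suc i) (divdiff i ?g)
     = f - ?t f - ?s f + ?s (?t f) + ?t (?s f) - ?t (?s (?t f))"
    proof (rule divdiff_braid_aux[where g = "- ?g" and k = "divdiff i ?g"])
      show "(?c - ?b) * - ?g = f - ?t f"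
        using divdiff_eq[of "Suc i" f] by (simp add: algebra_simps)
      show "(?b - ?a) * divdiff i ?g = - ?g - - ?s ?g"
        using divdiff_eq[of i ?g] by (simp add: algebra_simps)
      show "(?c - ?b) * - divdiff (Suc i) (divdiff i ?g) = divdiff i ?g - ?t (divdiff i ?g)"
        using divdiff_eq[of "Suc i" "divdiff i ?g"] by (simp add: algebra_simps)
      show "(?c - ?a) * - ?s ?g = ?s f - ?s (?t f)"
        using arg_cong[OF divdiff_eq[of "Suc i" f], of ?s]
        by (simp only: swap_vars_mult swap_vars_diff X) (simp add: algebra_simps)
      show "(?c - ?a) * ?t (divdiff i ?g) = - ?g - - ?t (?s ?g)"
        using arg_cong[OF divdiff_eq[of i ?g], of ?t]
        by (simp only: swap_vars_mult swap_vars_diff X swap_vars_divdiff) (simp add: algebra_simps)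
      show "(?b - ?a) * - ?t (?s ?g) = ?t (?s f) - ?t (?s (?t f))"
        using arg_cong[OF arg_cong[OF divdiff_eq[of "Suc i" f], of ?s], of ?t]
        by (simp only: swap_vars_mult swap_vars_diff X) (simp add: algebra_simps)
    qed
    then show ?thesis by (simp add: algebra_simps)
  qed
  then have 2: "(?a - ?b) * (?a - ?c) * (?b - ?c)
      * divdiff (Suc i) (divdiff i (divdiff (Suc i) f)) = ?A"
    by (simp add: mult_ac swap_vars_braid[symmetric])
  have "(?a - ?b) * (?a - ?c) * (?b - ?c) \<noteq> 0" by (simp add: X_inject)
  with 1 2 show ?thesis by (metis mult_left_cancel)
qed

section \<open>Evaluation\<close>

definition monom_at :: "(nat \<Rightarrow> 'k::field) \<Rightarrow> (nat \<Rightarrow>\<^sub>0 nat) \<Rightarrow> 'k" where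
  "monom_at p \<alpha> = (\<Prod>k\<in>Poly_Mapping.keys \<alpha>. p k ^ Poly_Mapping.lookup \<alpha> k)"

definition ev :: "(nat \<Rightarrow> 'k::field) \<Rightarrow> ipoly \<Rightarrow> 'k" where
  "ev p f = (\<Sum>\<alpha>\<in>Poly_Mapping.keys f. of_int (Poly_Mapping.lookup f \<alpha>) * monom_at p \<alpha>)"

lemma monom_at_superset:
  assumes "finite S" "Poly_Mapping.keys \<alpha> \<subseteq> S"
  shows "monom_at p \<alpha> = (\<Prod>k\<in>S. p k ^ Poly_Mapping.lookup \<alpha> k)"
  unfolding monom_at_def using assms by (intro prod.mono_neutral_left) (auto simp: in_keys_iff)

lemma monom_at_add: "monom_at p (\<alpha> + \<beta>) = monom_at p \<alpha> * monom_at p \<beta>"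
proof -
  let ?S = "Poly_Mapping.keys \<alpha> \<union> Poly_Mapping.keys \<beta>"
  have "Poly_Mapping.keys (\<alpha> + \<beta>) \<subseteq> ?S" by (rule keys_add)
  then show ?thesis
    by (simp add: monom_at_superset[of ?S] lookup_add power_add prod.distrib)
qed

lemma ev_superset:
  assumes "finite S" "Poly_Mapping.keys f \<subseteq> S"
  shows "ev p f = (\<Sum>\<alpha>\<in>S. of_int (Poly_Mapping.lookup f \<alpha>) * monom_at p \<alpha>)"
  unfolding ev_def using assms by (intro sum.mono_neutral_left) (auto simp: in_keys_iff)

lemma ev_add [simp]: "ev p (f + g) = ev p f + ev p g"
proof -
  let ?S = "Poly_Mapping.keys f \<union> Poly_Mapping.keys g"
  have "Poly_Mapping.keys (f + g) \<subseteq> ?S" by (rule keys_add)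
  then show ?thesis
    by (simp add: ev_superset[of ?S] lookup_add distrib_right sum.distrib)
qed

lemma ev_single: "ev p (Poly_Mapping.single \<alpha> c) = of_int c * monom_at p \<alpha>"
  by (simp add: ev_superset[of "{\<alpha>}"])

lemma ev_mult [simp]: "ev p (f * g) = ev p f * ev p g"
proof (induction f rule: ipoly_single_induct)
  case (single a c)
  show ?case
    by (induction g rule: ipoly_single_induct)
      (simp_all add: mult_single ev_single monom_at_add distrib_left)
qed (simp add: distrib_right)

lemma ev_of_int [simp]: "ev p (of_int c) = of_int c"
  using ev_single[of p 0 c] by (simp add: single_zero_eq_of_int monom_at_def)

lemma ev_0 [simp]: "ev p 0 = 0"
  using ev_of_int[of p 0] by simp

lemma ev_1 [simp]: "ev p 1 = 1"
  using ev_of_int[of p 1] by simp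

lemma ev_diff [simp]: "ev p (f - g) = ev p f - ev p g"
  using ev_add[of p "f - g" g] by simp

lemma ev_X [simp]: "ev p (X k) = p k"
  by (simp add: X_def ev_single monom_at_def)

lemma ev_sum: "ev p (sum f A) = (\<Sum>x\<in>A. ev p (f x))"
  by (induction A rule: infinite_finite_induct) simp_all

lemma ev_prod: "ev p (prod f A) = (\<Prod>x\<in>A. ev p (f x))"
  by (induction A rule: infinite_finite_induct) simp_all

lemma ev_swap_vars: "ev p (swap_vars i f) = ev (p \<circ> simple_refl i) f"
  by (induction f rule: ipoly_induct) simp_all

lemma ev_divdiff:
  assumes "p i \<noteq> p (Suc i)"
  shows "ev p (divdiff i f) = (ev p f - ev (p \<circ> simple_refl i) f) / (p i - p (Suc i))"
proof -
  have "ev p ((X i - X (Suc i)) * divdiff i f) = ev p (f - swap_vars i f)"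
    by (simp only: divdiff_eq)
  then show ?thesis using assms by (simp add: ev_swap_vars field_simps)
qed

section \<open>The generic point of the fraction field\<close>

definition gen_pt :: "nat \<Rightarrow> ipoly fract" where
  "gen_pt i = Fract (X i) 1"

lemma of_int_Fract: "(of_int c :: ipoly fract) = Fract (of_int c) 1"
proof (cases c)
  case (nonneg n)
  then show ?thesis by (simp add: of_nat_fract)
next
  case (neg n)
  have "(of_nat (Suc n) :: ipoly fract) = Fract (of_nat (Suc n)) 1" by (rule of_nat_fract)
  then show ?thesis using neg by (simp del: of_nat_Suc)
qed

text \<open>Evaluation at the generic point is the embedding into the fraction field, hence
  injective: identities proved with denominators come back to polynomials.\<close>

lemma ev_gen_pt: "ev gen_pt f = Fract f 1"
  by (induction f rule: ipoly_induct) (simp_all add: gen_pt_def of_int_Fract)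

lemma ev_gen_pt_eqD: "ev gen_pt f = ev gen_pt g \<Longrightarrow> f = g"
  by (simp add: ev_gen_pt eq_fract)

lemma inj_gen_pt: "inj gen_pt"
  by (auto intro: injI simp: gen_pt_def eq_fract X_inject)

text \<open>The coefficient of x_i is 1 or 2, so i = j is covered as well.\<close>

lemma gen_pt_add_neq_0: "gen_pt i + gen_pt j \<noteq> 0"
proof -
  have "Poly_Mapping.lookup (X i + X j) (Poly_Mapping.single i 1) > 0"
    by (simp add: X_def lookup_add lookup_single when_def)
  then have "X i + X j \<noteq> 0" by auto
  then show ?thesis by (simp add: gen_pt_def Zero_fract_def eq_fract)
qed

section \<open>Length and reduced words\<close>

abbreviation pinv :: "(nat \<Rightarrow> nat) \<Rightarrow> nat \<Rightarrow> nat" where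
  "pinv \<equiv> inv_into UNIV"

lemma SinfI: "w permutes {1..m} \<Longrightarrow> w \<in> Sinf"
  by (auto simp: Sinf_def)

lemma Sinf_id [simp]: "id \<in> Sinf"
  by (rule SinfI[of _ 0]) simp

lemma simple_refl_permutes: "1 \<le> i \<Longrightarrow> Suc i \<le> m \<Longrightarrow> simple_refl i permutes {1..m}"
  by (intro permutes_swap_id) auto

lemma Sinf_simple_refl [simp]: "1 \<le> i \<Longrightarrow> simple_refl i \<in> Sinf"
  by (rule SinfI[OF simple_refl_permutes[of i "Suc i"]]) auto

lemma permutes_atMost_mono: "w permutes {1..m} \<Longrightarrow> m \<le> m' \<Longrightarrow> w permutes {1..m'}" for m m' :: nat
  by (erule permutes_subset) auto

lemma Sinf_common:
  assumes "u \<in> Sinf" "v \<in> Sinf"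
  obtains m where "u permutes {1..m}" "v permutes {1..m}"
proof -
  obtain a b where ab: "u permutes {1..a}" "v permutes {1..b}" using assms by (auto simp: Sinf_def)
  show ?thesis
    using permutes_atMost_mono[OF ab(1), of "max a b"] permutes_atMost_mono[OF ab(2), of "max a b"]
    by (intro that[of "max a b"]) simp_all
qed

lemma Sinf_comp [simp]:
  assumes "u \<in> Sinf" "v \<in> Sinf" shows "u \<circ> v \<in> Sinf"
proof -
  obtain m where "u permutes {1..m}" "v permutes {1..m}" using assms by (rule Sinf_common)
  then have "u \<circ> v permutes {1..m}" by (intro permutes_compose)
  then show ?thesis by (rule SinfI)
qed

lemma Sinf_inv [simp]: "u \<in> Sinf \<Longrightarrow> pinv u \<in> Sinf"
  by (auto simp: Sinf_def intro: permutes_inv)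

lemma Sinf_bij: "u \<in> Sinf \<Longrightarrow> bij u"
  by (auto simp: Sinf_def permutes_bij)

lemma Sinf_inj: "u \<in> Sinf \<Longrightarrow> inj u"
  by (simp add: Sinf_bij bij_is_inj)

lemma Sinf_eq_iff: "u \<in> Sinf \<Longrightarrow> u a = u b \<longleftrightarrow> a = b"
  by (simp add: Sinf_inj inj_eq)

lemma Sinf_0 [simp]: "u \<in> Sinf \<Longrightarrow> u 0 = 0"
  by (auto simp: Sinf_def permutes_not_in)

lemma Sinf_inv_f [simp]: "u \<in> Sinf \<Longrightarrow> pinv u (u a) = a"
  by (simp add: Sinf_inj)

lemma Sinf_f_inv [simp]: "u \<in> Sinf \<Longrightarrow> u (pinv u a) = a"
  by (simp add: Sinf_bij bij_is_surj surj_f_inv_f)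

lemma Sinf_inv_eq_iff: "u \<in> Sinf \<Longrightarrow> pinv u x = a \<longleftrightarrow> u a = x"
  by auto

lemma Sinf_inv_inv [simp]: "u \<in> Sinf \<Longrightarrow> pinv (pinv u) = u"
  by (simp add: Sinf_bij inv_inv_eq)

lemma Sinf_inv_comp: "u \<in> Sinf \<Longrightarrow> v \<in> Sinf \<Longrightarrow> pinv (u \<circ> v) = pinv v \<circ> pinv u"
  by (simp add: Sinf_bij o_inv_distrib)

lemma inv_simple_refl [simp]: "pinv (simple_refl i) = simple_refl i"
  by (simp add: inv_equality)

lemma Sinf_inv_comp_refl: "u \<in> Sinf \<Longrightarrow> 1 \<le> i \<Longrightarrow> pinv (u \<circ> simple_refl i) = simple_refl i \<circ> pinv u"
  by (simp add: Sinf_inv_comp)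

lemma Sinf_inv_refl_comp: "u \<in> Sinf \<Longrightarrow> 1 \<le> i \<Longrightarrow> pinv (simple_refl i \<circ> u) = pinv u \<circ> simple_refl i"
  by (simp add: Sinf_inv_comp)

lemma comp_refl_refl [simp]: "u \<circ> simple_refl i \<circ> simple_refl i = u"
  by (simp add: comp_assoc)

lemma refl_refl_comp [simp]: "simple_refl i \<circ> (simple_refl i \<circ> u) = u"
  by (simp add: fun_eq_iff)

lemma simple_refl_less_iff:
  "(a, b) \<noteq> (i, Suc i) \<Longrightarrow> (a, b) \<noteq> (Suc i, i) \<Longrightarrow> simple_refl i a < simple_refl i b \<longleftrightarrow> a < b"
  by (auto simp: transpose_def)

section \<open>Inversions\<close>

definition inversions :: "(nat \<Rightarrow> nat) \<Rightarrow> (nat \<times> nat) set" where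
  "inversions w = {(i, j). i < j \<and> w j < w i}"

definition inv_count :: "(nat \<Rightarrow> nat) \<Rightarrow> nat" where
  "inv_count w = card (inversions w)"

lemma inv_count_id [simp]: "inv_count id = 0"
proof -
  have "inversions id = {}" by (auto simp: inversions_def)
  then show ?thesis unfolding inv_count_def by (simp only: card.empty)
qed

lemma finite_inversions [simp]:
  assumes "w \<in> Sinf" shows "finite (inversions w)"
proof -
  obtain m where m: "w permutes {1..m}" using assms unfolding Sinf_def by blast
  have "inversions w \<subseteq> {0..m} \<times> {0..m}"
  proof (clarsimp simp: inversions_def)
    fix i j assume ij: "i < j" "w j < w i"
    have "j \<le> m"
    proof (rule ccontr)
      assume "\<not> j \<le> m"
      then have "w j = j" by (intro permutes_not_in[OF m]) simp
      moreover have "w i \<le> max m i"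
      proof (cases "i \<in> {1..m}")
        case True
        then have "w i \<in> {1..m}" using permutes_in_image[OF m] by blast
        then show ?thesis by (simp add: le_max_iff_disj)
      qed (simp add: permutes_not_in[OF m])
      ultimately show False using ij \<open>\<not> j \<le> m\<close> by simp
    qed
    then show "i \<le> m \<and> j \<le> m" using ij by simp
  qed
  then show ?thesis by (rule finite_subset) (intro finite_cartesian_product finite_atLeastAtMost)
qed

text \<open>Relabelling positions by s_i preserves the order of every pair of positions except i, i
  + 1, and this one pair becomes the new inversion.\<close>

lemma inversions_comp_refl:
  assumes "w i < w (Suc i)"
  shows "inversions (w \<circ> simple_refl i)
    = insert (i, Suc i) (map_prod (simple_refl i) (simple_refl i) ` inversions w)"
  unfolding set_eq_iff split_paired_All
proof (intro allI)
  fix a b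
  show "(a, b) \<in> inversions (w \<circ> simple_refl i) \<longleftrightarrow>
    (a, b) \<in> insert (i, Suc i) (map_prod (simple_refl i) (simple_refl i) ` inversions w)"
  proof (cases "(a, b) = (i, Suc i) \<or> (a, b) = (Suc i, i)")
    case True
    then show ?thesis using assms by (auto simp: inversions_def transpose_def split: if_splits)
  next
    case False
    have "(a, b) \<in> map_prod (simple_refl i) (simple_refl i) ` inversions w
      \<longleftrightarrow> (simple_refl i a, simple_refl i b) \<in> inversions w"
      by (auto intro!: image_eqI[of _ _ "(simple_refl i a, simple_refl i b)"])
    then show ?thesis using False simple_refl_less_iff[of a b i]
      by (auto simp: inversions_def)
  qed
qed

lemma inv_count_ascent:
  assumes "w \<in> Sinf" "w i < w (Suc i)"
  shows "inv_count (w \<circ> simple_refl i) = Suc (inv_count w)"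
proof -
  have "inj (map_prod (simple_refl i) (simple_refl i))" by (intro prod.inj_map) auto
  then have "card (map_prod (simple_refl i) (simple_refl i) ` inversions w) = card (inversions w)"
    by (intro card_image) (rule inj_on_subset, auto)
  moreover have "(i, Suc i) \<notin> map_prod (simple_refl i) (simple_refl i) ` inversions w"
    by (auto simp: inversions_def transpose_def split: if_splits)
  ultimately show ?thesis using assms
    by (simp add: inv_count_def inversions_comp_refl)
qed

lemma Sinf_ascent_or_descent:
  "w \<in> Sinf \<Longrightarrow> \<not> w i < w (Suc i) \<longleftrightarrow> w (Suc i) < w i"
  using Sinf_eq_iff[of w i "Suc i"] by auto

lemma inv_count_descent:
  assumes "w \<in> Sinf" "1 \<le> i" "w (Suc i) < w i"
  shows "inv_count w = Suc (inv_count (w \<circ> simple_refl i))"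
  using inv_count_ascent[of "w \<circ> simple_refl i" i] assms by (simp add: transpose_def)

lemma inv_count_inv:
  assumes "w \<in> Sinf"
  shows "inv_count (pinv w) = inv_count w"
proof -
  have "inversions (pinv w) = (\<lambda>(i, j). (w j, w i)) ` inversions w"
    unfolding set_eq_iff split_paired_All
  proof (intro allI)
    fix a b
    have "(a, b) \<in> inversions (pinv w) \<longleftrightarrow> (pinv w b, pinv w a) \<in> inversions w"
      using assms by (auto simp: inversions_def)
    also have "\<dots> \<longleftrightarrow> (a, b) \<in> (\<lambda>(i, j). (w j, w i)) ` inversions w"
      using assms by (force simp: image_iff)
    finally show "(a, b) \<in> inversions (pinv w) \<longleftrightarrow> (a, b) \<in> (\<lambda>(i, j). (w j, w i)) ` inversions w" .
  qed
  moreover have "inj_on (\<lambda>(i, j). (w j, w i)) (inversions w)"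
    using assms by (auto simp: inj_on_def Sinf_eq_iff)
  ultimately show ?thesis by (simp add: inv_count_def card_image)
qed

lemma inv_count_left_ascent:
  assumes "w \<in> Sinf" "1 \<le> i" "pinv w i < pinv w (Suc i)"
  shows "inv_count (simple_refl i \<circ> w) = Suc (inv_count w)"
  using inv_count_ascent[of "pinv w" i] assms inv_count_inv[of w] inv_count_inv[of "simple_refl i \<circ> w"]
  by (simp add: Sinf_inv_refl_comp)

lemma inv_count_left_descent:
  assumes "w \<in> Sinf" "1 \<le> i" "pinv w (Suc i) < pinv w i"
  shows "inv_count w = Suc (inv_count (simple_refl i \<circ> w))"
  using inv_count_left_ascent[of "simple_refl i \<circ> w" i] assms
  by (simp add: Sinf_inv_refl_comp transpose_def)

text \<open>Both w and its inverse are strictly increasing, hence neither lowers any point.\<close>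

lemma increasing_imp_id:
  assumes "w \<in> Sinf" "\<And>i. 1 \<le> i \<Longrightarrow> w i < w (Suc i)"
  shows "w = id"
proof
  fix k
  have "w i < w (Suc i)" for i
  proof (cases i)
    case 0
    have "w (Suc 0) \<noteq> w 0" using assms(1) by (simp only: Sinf_eq_iff)
    then show ?thesis using assms(1) 0 by simp
  qed (use assms(2) in auto)
  then have mono: "strict_mono w" by (simp add: strict_mono_Suc_iff)
  have mono': "strict_mono (pinv w)"
  proof (rule strict_monoI)
    fix a b :: nat assume "a < b"
    show "pinv w a < pinv w b"
    proof (rule ccontr)
      assume "\<not> pinv w a < pinv w b"
      then have "w (pinv w b) \<le> w (pinv w a)" using mono by (simp add: strict_mono_less_eq)
      then show False using assms(1) \<open>a < b\<close> by simp
    qed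
  qed
  have "k \<le> w k" "k \<le> pinv w k" using mono mono' by (simp_all add: strict_mono_imp_increasing)
  moreover have "w k \<le> w (pinv w k)" using mono \<open>k \<le> pinv w k\<close> by (simp add: strict_mono_less_eq)
  ultimately show "w k = id k" using assms(1) by simp
qed

section \<open>Words, and length as the number of inversions\<close>

lemma word_prod_Nil [simp]: "word_prod [] = id"
  by (simp add: word_prod_def)

lemma word_prod_Cons [simp]: "word_prod (i # a) = simple_refl i \<circ> word_prod a"
  by (simp add: word_prod_def)

lemma word_prod_append: "word_prod (a @ b) = word_prod a \<circ> word_prod b"
  by (induction a) (simp_all add: comp_assoc)

lemma word_prod_Sinf: "\<forall>i\<in>set a. 1 \<le> i \<Longrightarrow> word_prod a \<in> Sinf"
  by (induction a) simp_all

lemma is_word_Sinf: "is_word a w \<Longrightarrow> w \<in> Sinf"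
  using word_prod_Sinf by (auto simp: is_word_def)

lemma is_word_inv_count_le: "is_word a w \<Longrightarrow> inv_count w \<le> length a"
proof (induction a arbitrary: w)
  case Nil
  then have "w = id" by (simp add: is_word_def)
  then show ?case using inv_count_id by (simp only:)
next
  case (Cons i a)
  let ?v = "word_prod a"
  have a: "is_word a ?v" "1 \<le> i" and w: "w = simple_refl i \<circ> ?v" using Cons.prems by (auto simp: is_word_def)
  have "inv_count w \<le> Suc (inv_count ?v)"
  proof (cases "pinv ?v i < pinv ?v (Suc i)")
    case True
    then show ?thesis using inv_count_left_ascent[OF is_word_Sinf[OF a(1)] a(2)] w by simp
  next
    case False
    then have "pinv ?v (Suc i) < pinv ?v i"
      using Sinf_ascent_or_descent[OF Sinf_inv[OF is_word_Sinf[OF a(1)]]] by blast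
    then show ?thesis using inv_count_left_descent[OF is_word_Sinf[OF a(1)] a(2)] w by simp
  qed
  then show ?case using Cons.IH[OF a(1)] by simp
qed

lemma ex_descent:
  assumes "w \<in> Sinf" "w \<noteq> id"
  obtains i where "1 \<le> i" "w (Suc i) < w i"
proof -
  obtain i where "1 \<le> i" "\<not> w i < w (Suc i)" using increasing_imp_id assms by blast
  then show ?thesis using Sinf_ascent_or_descent[OF assms(1)] that by blast
qed

lemma ex_left_descent:
  assumes "w \<in> Sinf" "w \<noteq> id"
  obtains i where "1 \<le> i" "pinv w (Suc i) < pinv w i"
proof -
  have "pinv w \<noteq> id"
  proof
    assume "pinv w = id"
    then have "pinv (pinv w) = id" by simp
    then show False using assms by simp
  qed
  then show ?thesis using ex_descent[of "pinv w"] assms(1) that by auto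
qed

text \<open>Removing left descents one at a time loses one inversion each; together with
  \<open>is_word_inv_count_le\<close> this identifies the length.\<close>

lemma ex_word_inv_count: "w \<in> Sinf \<Longrightarrow> \<exists>a. is_word a w \<and> length a = inv_count w"
proof (induction "inv_count w" arbitrary: w)
  case 0
  have "w = id"
  proof (rule ccontr)
    assume "w \<noteq> id"
    then obtain i where "1 \<le> i" "pinv w (Suc i) < pinv w i" using ex_left_descent 0(2) by blast
    then show False using inv_count_left_descent[OF 0(2)] 0(1) by auto
  qed
  then have "is_word [] w \<and> length ([] :: nat list) = inv_count w"
    using inv_count_id by (simp only: is_word_def) simp
  then show ?case ..
next
  case (Suc n)
  have "w \<noteq> id"
  proof
    assume "w = id"
    then show False using Suc(2) inv_count_id by (simp only:)
  qed
  then obtain i where i: "1 \<le> i" "pinv w (Suc i) < pinv w i" using ex_left_descent Suc.prems by blast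
  have "n = inv_count (simple_refl i \<circ> w)" using inv_count_left_descent[OF Suc.prems i] Suc(2) by simp
  then obtain a where "is_word a (simple_refl i \<circ> w)" "length a = n"
    using Suc(1)[of "simple_refl i \<circ> w"] Suc.prems i by auto
  then show ?case using i Suc(2) by (intro exI[of _ "i # a"]) (auto simp: is_word_def)
qed

lemma perm_length_eq: "w \<in> Sinf \<Longrightarrow> perm_length w = inv_count w"
  unfolding perm_length_def
  using ex_word_inv_count is_word_inv_count_le by (intro Least_equality) auto

lemma reduced_word_iff: "reduced_word a w \<longleftrightarrow> is_word a w \<and> length a = inv_count w"
  using is_word_Sinf perm_length_eq by (auto simp: reduced_word_def)

lemma ex_reduced_word: "w \<in> Sinf \<Longrightarrow> \<exists>a. reduced_word a w"
  using ex_word_inv_count by (auto simp: reduced_word_iff)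

lemma reduced_word_some: "w \<in> Sinf \<Longrightarrow> reduced_word (SOME a. reduced_word a w) w"
  using ex_reduced_word by (rule someI_ex)

lemma reduced_word_Sinf: "reduced_word a w \<Longrightarrow> w \<in> Sinf"
  by (auto simp: reduced_word_iff is_word_Sinf)

lemma reduced_word_Nil [simp]: "reduced_word [] w \<longleftrightarrow> w = id"
  by (auto simp: reduced_word_iff is_word_def)

lemma reduced_word_ConsD:
  assumes "reduced_word (i # a) w"
  shows "1 \<le> i" "reduced_word a (simple_refl i \<circ> w)" "pinv w (Suc i) < pinv w i"
proof -
  let ?v = "word_prod a"
  have a: "is_word a ?v" "1 \<le> i" and w: "w = simple_refl i \<circ> ?v" and l: "inv_count w = Suc (length a)"
    using assms by (auto simp: reduced_word_iff is_word_def)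
  have wS: "w \<in> Sinf" using assms by (rule reduced_word_Sinf)
  have v: "simple_refl i \<circ> w = ?v" by (simp add: w)
  have le: "inv_count ?v \<le> length a" using is_word_inv_count_le a by blast
  show "1 \<le> i" by fact
  show *: "pinv w (Suc i) < pinv w i"
  proof (rule ccontr)
    assume "\<not> pinv w (Suc i) < pinv w i"
    then have "pinv w i < pinv w (Suc i)" using Sinf_ascent_or_descent[OF Sinf_inv[OF wS]] by blast
    then show False using inv_count_left_ascent[OF wS a(2)] le l v by simp
  qed
  have "inv_count w = Suc (inv_count (simple_refl i \<circ> w))"
    using inv_count_left_descent[OF wS a(2) *] .
  then show "reduced_word a (simple_refl i \<circ> w)" using a l by (simp add: reduced_word_iff v)
qed

lemma reduced_word_ConsI:
  assumes "reduced_word a v" "1 \<le> i" "pinv v i < pinv v (Suc i)"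
  shows "reduced_word (i # a) (simple_refl i \<circ> v)"
  using assms inv_count_left_ascent[OF reduced_word_Sinf[OF assms(1)]]
  by (auto simp: reduced_word_iff is_word_def)

lemma reduced_word_ConsI':
  assumes "reduced_word a (simple_refl i \<circ> w)" "w \<in> Sinf" "1 \<le> i" "pinv w (Suc i) < pinv w i"
  shows "reduced_word (i # a) w"
  using reduced_word_ConsI[OF assms(1,3)] assms
  by (simp add: Sinf_inv_refl_comp)

lemma reduced_word_append:
  assumes "reduced_word a u" "reduced_word b v" "inv_count (u \<circ> v) = inv_count u + inv_count v"
  shows "reduced_word (a @ b) (u \<circ> v)"
  using assms by (auto simp: reduced_word_iff is_word_def word_prod_append)

lemma word_prod_rev: "\<forall>i\<in>set a. 1 \<le> i \<Longrightarrow> word_prod (rev a) = pinv (word_prod a)"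
  by (induction a) (simp_all add: word_prod_append Sinf_inv_refl_comp word_prod_Sinf)

lemma reduced_word_rev: "reduced_word a w \<Longrightarrow> reduced_word (rev a) (pinv w)"
  using word_prod_rev[of a] reduced_word_Sinf[of a w] inv_count_inv[of w]
  by (auto simp: reduced_word_iff is_word_def)

text \<open>Both words start with left descents of \<open>w\<close>; comparing them with reduced words
  that start with the two sides of a commutation or braid relation gives Matsumoto's theorem.\<close>
lemma foldr_divdiff_reduced_word:
  assumes "reduced_word a w" "reduced_word b w"
  shows "foldr divdiff a f = foldr divdiff b f"
  using assms
proof (induction "length a" arbitrary: a b w)
  case 0
  then have "w = id" by simp
  then show ?case using 0 by (simp add: reduced_word_iff)
next
  case (Suc n)
  have len: "length b = length a" using Suc.prems by (simp add: reduced_word_iff)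
  obtain i a' where a: "a = i # a'" "length a' = n" using Suc(2) by (metis length_Suc_conv)
  obtain j b' where b: "b = j # b'" "length b' = n" using Suc(2) len by (metis length_Suc_conv)
  have w: "w \<in> Sinf" using Suc.prems reduced_word_Sinf by blast
  note A = reduced_word_ConsD[OF Suc.prems(1)[unfolded a]]
  note B = reduced_word_ConsD[OF Suc.prems(2)[unfolded b]]
  have main: "foldr divdiff (i # a') f = foldr divdiff (j # b') f"
    if ij: "i < j" "1 \<le> i" and A: "reduced_word a' (simple_refl i \<circ> w)" "pinv w (Suc i) < pinv w i"
      and B: "reduced_word b' (simple_refl j \<circ> w)" "pinv w (Suc j) < pinv w j"
      and lens: "length a' = n" "length b' = n"
    for i j a' b'
  proof (cases "j = Suc i")
    case False
    define u where "u = simple_refl j \<circ> (simple_refl i \<circ> w)"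
    have u': "u = simple_refl i \<circ> (simple_refl j \<circ> w)"
      unfolding u_def using ij False by (auto simp: fun_eq_iff transpose_def)
    obtain c where c: "reduced_word c u" using ex_reduced_word[of u] w ij by (auto simp: u_def)
    have "reduced_word (j # c) (simple_refl i \<circ> w)"
      using c A B ij w False
      by (intro reduced_word_ConsI') (auto simp: u_def Sinf_inv_refl_comp transpose_def)
    moreover have "reduced_word (i # c) (simple_refl j \<circ> w)"
      using c A B ij w False
      by (intro reduced_word_ConsI') (auto simp: u' Sinf_inv_refl_comp transpose_def)
    ultimately have "foldr divdiff a' f = foldr divdiff (j # c) f"
      "foldr divdiff b' f = foldr divdiff (i # c) f"
      using Suc(1)[of a' "simple_refl i \<circ> w" "j # c"] Suc(1)[of b' "simple_refl j \<circ> w" "i # c"]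
        A B lens by auto
    then show ?thesis using divdiff_commute[of i j] ij False by simp
  next
    case True
    define u where "u = simple_refl i \<circ> (simple_refl j \<circ> (simple_refl i \<circ> w))"
    have u': "u = simple_refl j \<circ> (simple_refl i \<circ> (simple_refl j \<circ> w))"
      unfolding u_def True by (auto simp: fun_eq_iff transpose_def)
    obtain c where c: "reduced_word c u" using ex_reduced_word[of u] w ij by (auto simp: u_def)
    have "reduced_word (i # c) (simple_refl j \<circ> (simple_refl i \<circ> w))"
      using c A B ij w True
      by (intro reduced_word_ConsI') (auto simp: u_def Sinf_inv_refl_comp transpose_def)
    then have "reduced_word (j # i # c) (simple_refl i \<circ> w)"
      using A B ij w True
      by (intro reduced_word_ConsI'[of "i # c"]) (auto simp: Sinf_inv_refl_comp transpose_def)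
    moreover have "reduced_word (j # c) (simple_refl i \<circ> (simple_refl j \<circ> w))"
      using c A B ij w True
      by (intro reduced_word_ConsI') (auto simp: u' Sinf_inv_refl_comp transpose_def)
    then have "reduced_word (i # j # c) (simple_refl j \<circ> w)"
      using A B ij w True
      by (intro reduced_word_ConsI'[of "j # c"]) (auto simp: Sinf_inv_refl_comp transpose_def)
    ultimately have "foldr divdiff a' f = foldr divdiff (j # i # c) f"
      "foldr divdiff b' f = foldr divdiff (i # j # c) f"
      using Suc(1)[of a' "simple_refl i \<circ> w" "j # i # c"] Suc(1)[of b' "simple_refl j \<circ> w" "i # j # c"]
        A B lens by auto
    then show ?thesis using divdiff_braid[of i] True by simp
  qed
  consider "i < j" | "i = j" | "j < i" by linarith
  then show ?case
  proof cases
    case 1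
    then show ?thesis using main[of i j a' b'] A B a b by simp
  next
    case 2
    then show ?thesis using Suc(1)[of a' _ b'] A B a b by simp
  next
    case 3
    then show ?thesis using main[of j i b' a'] A B a b by simp
  qed
qed

section \<open>The Demazure product\<close>

text \<open>Right and left Demazure multiplication by \<open>s_i\<close>.\<close>
definition rt :: "nat \<Rightarrow> (nat \<Rightarrow> nat) \<Rightarrow> nat \<Rightarrow> nat" where
  "rt i u = (if u i < u (Suc i) then u \<circ> simple_refl i else u)"

definition lt :: "nat \<Rightarrow> (nat \<Rightarrow> nat) \<Rightarrow> nat \<Rightarrow> nat" where
  "lt i u = (if pinv u i < pinv u (Suc i) then simple_refl i \<circ> u else u)"

lemma rt_Sinf [simp]: "u \<in> Sinf \<Longrightarrow> 1 \<le> i \<Longrightarrow> rt i u \<in> Sinf"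
  by (simp add: rt_def)

lemma lt_Sinf [simp]: "u \<in> Sinf \<Longrightarrow> 1 \<le> i \<Longrightarrow> lt i u \<in> Sinf"
  by (simp add: lt_def)

lemma inv_rt: "u \<in> Sinf \<Longrightarrow> 1 \<le> i \<Longrightarrow> pinv (rt i u) = lt i (pinv u)"
  by (simp add: rt_def lt_def Sinf_inv_comp_refl)

text \<open>The two multiplications interfere only if u maps {i, i+1} onto {j, j+1}. Then s_j u = u
  s_i: at an ascent either order performs this product exactly once, at a descent nothing happens.
  Otherwise neither multiplication changes the ascent condition of the other.\<close>

lemma lt_rt_commute:
  assumes u: "u \<in> Sinf" and ij: "1 \<le> i" "1 \<le> j"
  shows "lt j (rt i u) = rt i (lt j u)"
proof -
  let ?p = "pinv u"
  note pu = Sinf_inv_eq_iff[OF u]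
  consider "?p j = i" "?p (Suc j) = Suc i" | "?p j = Suc i" "?p (Suc j) = i"
    | "(?p j, ?p (Suc j)) \<noteq> (i, Suc i)" "(?p j, ?p (Suc j)) \<noteq> (Suc i, i)" by auto
  then show ?thesis
  proof cases
    case 1
    then have v: "u i = j" "u (Suc i) = Suc j" using pu by auto
    have "simple_refl j \<circ> u = u \<circ> simple_refl i"
    proof
      fix a
      show "(simple_refl j \<circ> u) a = (u \<circ> simple_refl i) a"
        using v Sinf_eq_iff[OF u, of a i] Sinf_eq_iff[OF u, of a "Suc i"]
        by (auto simp: transpose_def)
    qed
    then show ?thesis using 1 v u ij
      by (simp add: lt_def rt_def Sinf_inv_comp_refl)
  next
    case 2
    then have v: "u i = Suc j" "u (Suc i) = j" using pu by auto
    then show ?thesis using 2 by (simp add: lt_def rt_def)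
  next
    case 3
    then have "(u i, u (Suc i)) \<noteq> (j, Suc j)" "(u i, u (Suc i)) \<noteq> (Suc j, j)" by (auto simp: pu)
    then have A: "(simple_refl j \<circ> u) i < (simple_refl j \<circ> u) (Suc i) \<longleftrightarrow> u i < u (Suc i)"
      using simple_refl_less_iff[of "u i" "u (Suc i)" j] by simp
    have B: "(simple_refl i \<circ> ?p) j < (simple_refl i \<circ> ?p) (Suc j) \<longleftrightarrow> ?p j < ?p (Suc j)"
      using simple_refl_less_iff[of "?p j" "?p (Suc j)" i] 3 by simp
    show ?thesis unfolding lt_def rt_def
      using A B u ij by (auto simp: Sinf_inv_comp_refl comp_assoc)
  qed
qed

lemma fold_rt_Sinf: "u \<in> Sinf \<Longrightarrow> \<forall>i\<in>set a. 1 \<le> i \<Longrightarrow> fold rt a u \<in> Sinf"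
  by (induction a arbitrary: u) simp_all

lemma lt_fold_rt:
  "u \<in> Sinf \<Longrightarrow> 1 \<le> j \<Longrightarrow> \<forall>i\<in>set a. 1 \<le> i \<Longrightarrow> lt j (fold rt a u) = fold rt a (lt j u)"
  by (induction a arbitrary: u) (simp_all add: lt_rt_commute)

lemma foldr_lt_reduced_word: "reduced_word a w \<Longrightarrow> foldr lt a id = w"
proof (induction a arbitrary: w)
  case (Cons i a)
  note A = reduced_word_ConsD[OF Cons.prems]
  have "foldr lt (i # a) id = lt i (foldr lt a id)" by simp
  also have "foldr lt a id = simple_refl i \<circ> w" by (rule Cons.IH[OF A(2)])
  also have "lt i \<dots> = w" using A reduced_word_Sinf[OF Cons.prems]
    by (simp add: lt_def Sinf_inv_refl_comp)
  finally show ?case .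
qed simp

lemma inv_fold_rt:
  "u \<in> Sinf \<Longrightarrow> \<forall>i\<in>set a. 1 \<le> i \<Longrightarrow> pinv (fold rt a u) = fold lt a (pinv u)"
  by (induction a arbitrary: u) (simp_all add: inv_rt)

lemma reduced_word_set: "reduced_word a w \<Longrightarrow> \<forall>i\<in>set a. 1 \<le> i"
  by (auto simp: reduced_word_def is_word_def)

lemma fold_rt_reduced_word:
  assumes "reduced_word a w"
  shows "fold rt a id = w"
proof -
  have "pinv (fold rt a id) = foldr lt (rev a) id"
    using inv_fold_rt[OF Sinf_id reduced_word_set[OF assms]] by (simp add: foldr_conv_fold)
  also have "\<dots> = pinv w" using foldr_lt_reduced_word reduced_word_rev assms by blast
  finally show ?thesis
    using fold_rt_Sinf[OF Sinf_id reduced_word_set[OF assms]] reduced_word_Sinf[OF assms]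
    by (metis Sinf_inv_inv)
qed

text \<open>The right operators commute with the left ones, and the latter generate everything from
  the identity; hence a composite of right operators is determined by its value there.\<close>
lemma fold_rt_determined:
  assumes "u \<in> Sinf" "\<forall>i\<in>set a. 1 \<le> i" "\<forall>i\<in>set b. 1 \<le> i" "fold rt a id = fold rt b id"
  shows "fold rt a u = fold rt b u"
proof -
  obtain c where c: "reduced_word c u" using ex_reduced_word assms(1) by blast
  have "fold rt d (foldr lt c id) = foldr lt c (fold rt d id)" if d: "\<forall>i\<in>set d. 1 \<le> i" for d
    using reduced_word_set[OF c]
  proof (induction c)
    case (Cons i c)
    have "foldr lt c id \<in> Sinf" using Cons.prems by (induction c) simp_all
    then have "lt i (fold rt d (foldr lt c id)) = fold rt d (lt i (foldr lt c id))"
      using Cons.prems d by (intro lt_fold_rt) auto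
    also have "fold rt d (foldr lt c id) = foldr lt c (fold rt d id)"
      using Cons.prems by (intro Cons.IH) auto
    finally have "fold rt d (lt i (foldr lt c id)) = lt i (foldr lt c (fold rt d id))" by (rule sym)
    moreover have "foldr lt (i # c) e = lt i (foldr lt c e)" for e by simp
    ultimately show ?case by (simp only:)
  qed simp
  then show ?thesis using assms foldr_lt_reduced_word[OF c] by metis
qed

text \<open>As \<open>demazure\<close> is a choice, its axioms are available only after a witness is
  exhibited: a reduced word of v acting on u through the right operators \<open>rt\<close>.\<close>

lemma ex_demazure_product: "\<exists>D. is_demazure_product D"
proof
  define wd where "wd v = (SOME a. reduced_word a v)" for v
  have wd: "reduced_word (wd v) v" if "v \<in> Sinf" for v
    unfolding wd_def using that by (rule reduced_word_some)
  note S = reduced_word_set[OF wd]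
  define D where "D u v = fold rt (wd v) u" for u v
  have DS: "D u v \<in> Sinf" if "u \<in> Sinf" "v \<in> Sinf" for u v
    using that S fold_rt_Sinf by (simp add: D_def)
  show "is_demazure_product D"
    unfolding is_demazure_product_def
  proof (intro conjI ballI impI allI)
    fix u v w assume S': "u \<in> Sinf" "v \<in> Sinf" "w \<in> Sinf"
    \<comment> \<open>Associativity: both words send \<open>id\<close> to \<open>D v w\<close>, so
      they are the same operator.\<close>
    have "fold rt (wd v @ wd w) u = fold rt (wd (D v w)) u"
    proof (rule fold_rt_determined[OF S'(1)])
      show "\<forall>i\<in>set (wd v @ wd w). 1 \<le> i" using S S' by auto
      show "\<forall>i\<in>set (wd (D v w)). 1 \<le> i" using S[OF DS] S' by auto
      show "fold rt (wd v @ wd w) id = fold rt (wd (D v w)) id"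
        using fold_rt_reduced_word[OF wd[OF S'(2)]] fold_rt_reduced_word[OF wd[OF DS[OF S'(2,3)]]]
        by (simp add: D_def)
    qed
    then show "D (D u v) w = D u (D v w)" by (simp add: D_def)
  next
    fix u v assume S': "u \<in> Sinf" "v \<in> Sinf" and l: "perm_length (u \<circ> v) = perm_length u + perm_length v"
    have "reduced_word (wd u @ wd v) (u \<circ> v)"
      using reduced_word_append[OF wd wd] S' l by (simp add: perm_length_eq)
    then have "fold rt (wd u @ wd v) id = u \<circ> v" by (rule fold_rt_reduced_word)
    then show "D u v = u \<circ> v" using fold_rt_reduced_word[OF wd[OF S'(1)]] by (simp add: D_def)
  next
    fix i :: nat assume i: "1 \<le> i"
    have "fold rt (wd (simple_refl i)) (simple_refl i) = fold rt [i] (simple_refl i)"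
    proof (rule fold_rt_determined)
      show "fold rt (wd (simple_refl i)) id = fold rt [i] id"
        using fold_rt_reduced_word[OF wd[OF Sinf_simple_refl[OF i]]] by (simp add: rt_def)
      show "\<forall>j\<in>set (wd (simple_refl i)). 1 \<le> j" by (rule S) (use i in simp)
    qed (use i in auto)
    then show "D (simple_refl i) (simple_refl i) = simple_refl i" by (simp add: D_def rt_def)
  qed (rule DS)
qed

lemma demazure_product: "is_demazure_product demazure"
  unfolding demazure_def using ex_demazure_product by (rule someI_ex)

lemma demazure_Sinf [simp]: "u \<in> Sinf \<Longrightarrow> v \<in> Sinf \<Longrightarrow> demazure u v \<in> Sinf"
  using demazure_product by (simp add: is_demazure_product_def)

lemma demazure_assoc:
  "u \<in> Sinf \<Longrightarrow> v \<in> Sinf \<Longrightarrow> w \<in> Sinf \<Longrightarrow> demazure (demazure u v) w = demazure u (demazure v w)"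
  using demazure_product by (simp add: is_demazure_product_def)

lemma demazure_additive:
  "u \<in> Sinf \<Longrightarrow> v \<in> Sinf \<Longrightarrow> inv_count (u \<circ> v) = inv_count u + inv_count v \<Longrightarrow> demazure u v = u \<circ> v"
  using demazure_product by (simp add: is_demazure_product_def perm_length_eq)

lemma demazure_refl_refl: "1 \<le> i \<Longrightarrow> demazure (simple_refl i) (simple_refl i) = simple_refl i"
  using demazure_product by (simp add: is_demazure_product_def)

lemma inv_count_refl: "1 \<le> i \<Longrightarrow> inv_count (simple_refl i) = 1"
  using inv_count_ascent[of id i] by simp

text \<open>At a descent u = v s_i with additive lengths, so s_i is absorbed by associativity and
  the idempotence of s_i.\<close>

lemma demazure_refl_right:
  assumes "u \<in> Sinf" "1 \<le> i"
  shows "demazure u (simple_refl i) = rt i u"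
proof (cases "u i < u (Suc i)")
  case True
  then show ?thesis using demazure_additive[of u "simple_refl i"] assms inv_count_ascent[of u i]
    by (simp add: rt_def inv_count_refl)
next
  case False
  then have d: "u (Suc i) < u i" using Sinf_ascent_or_descent assms by blast
  let ?v = "u \<circ> simple_refl i"
  have v: "demazure ?v (simple_refl i) = u"
    using demazure_additive[of ?v "simple_refl i"] assms inv_count_descent[OF assms d]
    by (simp add: inv_count_refl)
  then have "demazure u (simple_refl i) = demazure (demazure ?v (simple_refl i)) (simple_refl i)" by simp
  also have "\<dots> = demazure ?v (simple_refl i)"
    using assms by (simp add: demazure_assoc demazure_refl_refl)
  also have "\<dots> = u" by (rule v)
  finally show ?thesis using False by (simp add: rt_def)
qed

lemma demazure_refl_left:
  assumes "u \<in> Sinf" "1 \<le> i"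
  shows "demazure (simple_refl i) u = lt i u"
proof (cases "pinv u i < pinv u (Suc i)")
  case True
  then show ?thesis using demazure_additive[of "simple_refl i" u] assms inv_count_left_ascent[of u i]
    by (simp add: lt_def inv_count_refl)
next
  case False
  then have d: "pinv u (Suc i) < pinv u i" using Sinf_ascent_or_descent[of "pinv u"] assms by simp
  let ?v = "simple_refl i \<circ> u"
  have v: "demazure (simple_refl i) ?v = u"
    using demazure_additive[of "simple_refl i" ?v] assms inv_count_left_descent[OF assms d]
    by (simp add: inv_count_refl)
  then have "demazure (simple_refl i) u = demazure (simple_refl i) (demazure (simple_refl i) ?v)" by simp
  also have "\<dots> = demazure (simple_refl i) ?v"
    using assms by (simp add: demazure_assoc[symmetric] demazure_refl_refl)
  also have "\<dots> = u" by (rule v)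
  finally show ?thesis using False by (simp add: lt_def)
qed

section \<open>Schubert polynomials\<close>

lemma divdiff_perm_reduced_word: "reduced_word a w \<Longrightarrow> divdiff_perm w f = foldr divdiff a f"
  unfolding divdiff_perm_def
  using foldr_divdiff_reduced_word reduced_word_some reduced_word_Sinf by metis

lemma divdiff_divdiff_perm:
  assumes "w \<in> Sinf" "1 \<le> i"
  shows "divdiff i (divdiff_perm w f)
    = (if pinv w i < pinv w (Suc i) then divdiff_perm (simple_refl i \<circ> w) f else 0)"
proof (cases "pinv w i < pinv w (Suc i)")
  case True
  obtain a where a: "reduced_word a w" using ex_reduced_word assms(1) by blast
  have "reduced_word (i # a) (simple_refl i \<circ> w)" using a assms True by (intro reduced_word_ConsI)
  then show ?thesis using True a by (simp add: divdiff_perm_reduced_word)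
next
  case False
  then have d: "pinv w (Suc i) < pinv w i" using Sinf_ascent_or_descent[of "pinv w"] assms by simp
  obtain a where a: "reduced_word a (simple_refl i \<circ> w)" using ex_reduced_word assms by force
  have "reduced_word (i # a) w" using a assms d by (intro reduced_word_ConsI')
  then show ?thesis using False by (simp add: divdiff_perm_reduced_word)
qed

lemma longest_perm_permutes: "longest_perm m permutes {1..m}"
proof (rule bij_imp_permutes)
  show "bij_betw (longest_perm m) {1..m} {1..m}"
    by (rule bij_betw_byWitness[where f' = "longest_perm m"]) (auto simp: longest_perm_def)
qed (auto simp: longest_perm_def)

lemma longest_perm_Sinf [simp]: "longest_perm m \<in> Sinf"
  using longest_perm_permutes by (rule SinfI)

lemma pinv_longest_perm [simp]: "pinv (longest_perm m) = longest_perm m"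
  by (intro inv_equality) (auto simp: longest_perm_def)

lemma pinv_comp_longest_perm: "w \<in> Sinf \<Longrightarrow> pinv (pinv w \<circ> longest_perm m) = longest_perm m \<circ> w"
  by (simp add: Sinf_inv_comp)

lemma swap_vars_power [simp]: "swap_vars i (f ^ k) = swap_vars i f ^ k"
  by (induction k) simp_all

lemma swap_vars_prod: "swap_vars i (prod f A) = (\<Prod>x\<in>A. swap_vars i (f x))"
  by (induction A rule: infinite_finite_induct) simp_all

lemma swap_vars_monomial:
  assumes "simple_refl j ` A = A" "\<And>i. i \<in> A \<Longrightarrow> e (simple_refl j i) = e i"
  shows "swap_vars j (\<Prod>i\<in>A. X i ^ e i) = (\<Prod>i\<in>A. X i ^ e i)"
proof -
  have "swap_vars j (\<Prod>i\<in>A. X i ^ e i) = (\<Prod>i\<in>A. X (simple_refl j i) ^ e (simple_refl j i))"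
    using assms(2) by (simp add: swap_vars_prod)
  also have "\<dots> = (\<Prod>i\<in>simple_refl j ` A. X i ^ e i)"
    by (subst prod.reindex) (auto simp: o_def intro: inj_on_subset)
  finally show ?thesis by (simp add: assms(1))
qed

lemma divdiff_X_same: "divdiff i (X i) = 1"
  using divdiff_X_mult[of i i 1] divdiff_of_int[of i 1] by simp

text \<open>Applying first d_1, then d_2, up to d_k: when d_(k+1) comes, x_(k+1) occurs once more
  than in a monomial symmetric in x_(k+1) and x_(k+2), and that extra copy is removed. For k = m the
  staircase of S_(m+1) has become that of S_m.\<close>

lemma divdiff_staircase:
  assumes "k \<le> m"
  shows "foldr divdiff (rev [1..<Suc k]) (\<Prod>i = 1..<Suc m. X i ^ (Suc m - i))
    = (\<Prod>i = 1..Suc m. X i ^ (if i \<le> k then m - i else Suc m - i))"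
  using assms
proof (induction k)
  case 0
  have "(\<Prod>i = 1..Suc m. X i ^ (Suc m - i)) = (\<Prod>i = 1..<Suc m. X i ^ (Suc m - i))"
    by (simp add: atLeastLessThanSuc_atLeastAtMost)
  moreover have "(\<Prod>i = 1..Suc m. X i ^ (if i \<le> 0 then m - i else Suc m - i))
      = (\<Prod>i = 1..Suc m. X i ^ (Suc m - i))"
    by (intro prod.cong) auto
  ultimately show ?case by simp
next
  case (Suc k)
  let ?e = "\<lambda>k i. if i \<le> k then m - i else Suc m - i"
  let ?g = "\<lambda>k. \<Prod>i = 1..Suc m. X i ^ ?e k i"
  have k: "Suc k \<in> {1..Suc m}" using Suc.prems by auto
  have "?g k = X (Suc k) ^ ?e k (Suc k) * (\<Prod>i\<in>{1..Suc m} - {Suc k}. X i ^ ?e k i)"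
    using k by (intro prod.remove) auto
  also have "(\<Prod>i\<in>{1..Suc m} - {Suc k}. X i ^ ?e k i) = (\<Prod>i\<in>{1..Suc m} - {Suc k}. X i ^ ?e (Suc k) i)"
    by (intro prod.cong) auto
  also have "?e k (Suc k) = Suc (?e (Suc k) (Suc k))" using Suc.prems by auto
  finally have "?g k = X (Suc k) * (X (Suc k) ^ ?e (Suc k) (Suc k)
      * (\<Prod>i\<in>{1..Suc m} - {Suc k}. X i ^ ?e (Suc k) i))"
    by (simp add: mult.assoc)
  also have "X (Suc k) ^ ?e (Suc k) (Suc k) * (\<Prod>i\<in>{1..Suc m} - {Suc k}. X i ^ ?e (Suc k) i) = ?g (Suc k)"
    using k by (intro prod.remove[symmetric]) auto
  finally have g: "?g k = ?g (Suc k) * X (Suc k)" by (simp only: mult.commute)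
  have sym: "swap_vars (Suc k) (?g (Suc k)) = ?g (Suc k)"
  proof (rule swap_vars_monomial)
    have "simple_refl (Suc k) permutes {1..Suc m}" using Suc.prems by (intro simple_refl_permutes) auto
    then show "simple_refl (Suc k) ` {1..Suc m} = {1..Suc m}" by (rule permutes_image)
  qed (auto simp: transpose_def)
  have "foldr divdiff (rev [1..<Suc (Suc k)]) (\<Prod>i = 1..<Suc m. X i ^ (Suc m - i))
      = divdiff (Suc k) (?g k)"
    using Suc by simp
  also have "\<dots> = ?g (Suc k)"
    unfolding g divdiff_symmetric_mult[OF sym] by (simp only: divdiff_X_same mult_1_right)
  finally show ?case .
qed

declare upt_Suc [simp del]

lemma word_prod_cycle:
  assumes "1 \<le> k" "k \<le> Suc m"
  shows "word_prod (rev [k..<Suc m]) j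
    = (if j = k then Suc m else if k < j \<and> j \<le> Suc m then j - 1 else j)"
  using assms
proof (induction "Suc m - k" arbitrary: k j)
  case 0
  then have "k = Suc m" by simp
  then show ?case by simp
next
  case (Suc d)
  then have "rev [k..<Suc m] = rev [Suc k..<Suc m] @ [k]" by (simp add: upt_conv_Cons)
  then have "word_prod (rev [k..<Suc m]) j = word_prod (rev [Suc k..<Suc m]) (simple_refl k j)"
    by (simp only: word_prod_append) simp
  also have "\<dots> = (if simple_refl k j = Suc k then Suc m
      else if Suc k < simple_refl k j \<and> simple_refl k j \<le> Suc m then simple_refl k j - 1 else simple_refl k j)"
    using Suc(2-4) by (intro Suc(1)) auto
  finally show ?case using Suc(2-4) by (auto simp: transpose_def)
qed

lemma longest_perm_Suc: "longest_perm (Suc m) = longest_perm m \<circ> word_prod (rev [1..<Suc m])"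
  by (rule ext) (auto simp: word_prod_cycle longest_perm_def)

text \<open>Each additional letter is applied at an ascent: before letter k, position k + 1 carries
  the value m + 1 and position k a value at most m.\<close>

lemma inv_count_comp_cycle:
  assumes v: "v permutes {1..m}" and "1 \<le> k" "k \<le> Suc m"
  shows "inv_count (v \<circ> word_prod (rev [k..<Suc m])) = inv_count v + (Suc m - k)"
  using assms(2,3)
proof (induction "Suc m - k" arbitrary: k)
  case 0
  then have "k = Suc m" by simp
  then show ?case by simp
next
  case (Suc d)
  let ?c = "word_prod (rev [Suc k..<Suc m])"
  have r: "rev [k..<Suc m] = rev [Suc k..<Suc m] @ [k]" using Suc(2) by (simp add: upt_conv_Cons)
  then have e: "v \<circ> word_prod (rev [k..<Suc m]) = (v \<circ> ?c) \<circ> simple_refl k"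
    by (simp only: word_prod_append word_prod_Cons word_prod_Nil comp_id comp_assoc)
  have "v k \<le> m" using permutes_in_image[OF v, of k] Suc(2,3) by auto
  moreover have "v (Suc m) = Suc m" by (rule permutes_not_in[OF v]) simp
  ultimately have "(v \<circ> ?c) k < (v \<circ> ?c) (Suc k)"
    using Suc(2-4) by (simp add: word_prod_cycle)
  moreover have "v \<circ> ?c \<in> Sinf"
    using SinfI[OF v] Suc(3) by (intro Sinf_comp word_prod_Sinf) auto
  ultimately have "inv_count (v \<circ> word_prod (rev [k..<Suc m])) = Suc (inv_count (v \<circ> ?c))"
    unfolding e by (rule inv_count_ascent[rotated])
  also have "inv_count (v \<circ> ?c) = inv_count v + (Suc m - Suc k)" using Suc by (intro Suc(1)) auto
  finally show ?case using Suc(2) by linarith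
qed

text \<open>A reduced word for w^-1 w_m followed by s_m ... s_1 is one for w^-1 w_(m+1), and the
  added letters reduce the larger staircase to the smaller.\<close>

lemma schubert_in_Suc:
  assumes "w permutes {1..m}"
  shows "schubert_in (Suc m) w = schubert_in m w"
proof -
  let ?v = "pinv w \<circ> longest_perm m" and ?c = "rev [1..<Suc m]"
  have v: "?v permutes {1..m}"
    using assms longest_perm_permutes by (intro permutes_compose permutes_inv)
  obtain a where a: "reduced_word a ?v" using ex_reduced_word SinfI[OF v] by blast
  have "reduced_word (a @ ?c) (?v \<circ> word_prod ?c)"
    using a inv_count_comp_cycle[OF v, of 1]
    by (auto simp: reduced_word_iff is_word_def word_prod_append)
  then have "schubert_in (Suc m) w = foldr divdiff a (foldr divdiff ?c (\<Prod>i = 1..<Suc m. X i ^ (Suc m - i)))"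
    by (simp only: schubert_in_def longest_perm_Suc comp_assoc[symmetric] divdiff_perm_reduced_word
        foldr_append)
  also have "foldr divdiff ?c (\<Prod>i = 1..<Suc m. X i ^ (Suc m - i))
      = (\<Prod>i = 1..Suc m. X i ^ (if i \<le> m then m - i else Suc m - i))"
    by (rule divdiff_staircase) simp
  also have "\<dots> = (\<Prod>i = 1..<m. X i ^ (m - i))"
    by (intro prod.mono_neutral_cong_right) auto
  finally show ?thesis by (simp only: schubert_in_def divdiff_perm_reduced_word[OF a])
qed

declare upt_Suc [simp]

lemma schubert_eq:
  assumes "w permutes {1..m}"
  shows "schubert w = schubert_in m w"
proof -
  let ?l = "LEAST m. w permutes {1..m}"
  have l: "w permutes {1..?l}" using assms by (rule LeastI)
  have "?l \<le> m" using assms by (rule Least_le)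
  then have "schubert_in m w = schubert_in ?l w"
  proof (induction m rule: dec_induct)
    case (step k)
    have "w permutes {1..k}" using l step(1) by (rule permutes_atMost_mono)
    then show ?case using step.IH by (simp only: schubert_in_Suc)
  qed simp
  then show ?thesis by (simp only: schubert_def)
qed

text \<open>Left multiplication of w^-1 w_m by s_i amounts to replacing w by w s_i; as w_m reverses
  order, descents of w correspond to the left ascents that \<open>divdiff_divdiff_perm\<close> asks
  for.\<close>

lemma divdiff_schubert:
  assumes "w \<in> Sinf" "1 \<le> i"
  shows "divdiff i (schubert w) = (if w (Suc i) < w i then schubert (w \<circ> simple_refl i) else 0)"
proof -
  obtain m where m: "w permutes {1..m}" "simple_refl i permutes {1..m}"
    using Sinf_common assms Sinf_simple_refl by blast
  have im: "Suc i \<le> m"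
  proof (rule ccontr)
    assume "\<not> Suc i \<le> m"
    then have "simple_refl i (Suc i) = Suc i" by (intro permutes_not_in[OF m(2)]) auto
    then show False by simp
  qed
  have ws: "w \<circ> simple_refl i permutes {1..m}" using m by (intro permutes_compose)
  let ?v = "pinv w \<circ> longest_perm m"
  have wi: "w i \<in> {1..m}" "w (Suc i) \<in> {1..m}"
    using permutes_in_image[OF m(1)] im assms(2) by (metis Suc_leD atLeastAtMost_iff le_SucI)+
  have d: "pinv ?v i < pinv ?v (Suc i) \<longleftrightarrow> w (Suc i) < w i"
    unfolding pinv_comp_longest_perm[OF assms(1)] using wi by (auto simp: longest_perm_def)
  have "simple_refl i \<circ> ?v = pinv (w \<circ> simple_refl i) \<circ> longest_perm m"
    by (simp only: Sinf_inv_comp_refl[OF assms] comp_assoc)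
  moreover have "?v \<in> Sinf" using assms(1) by simp
  ultimately show ?thesis
    unfolding schubert_eq[OF m(1)] schubert_eq[OF ws] schubert_in_def
    using divdiff_divdiff_perm[of ?v i] assms(2) d by (simp only:)
qed

lemma schubert_id: "schubert id = 1"
proof -
  have "schubert id = schubert_in 0 id" by (rule schubert_eq) simp
  moreover have "pinv id \<circ> longest_perm 0 = id" by (auto simp: longest_perm_def)
  ultimately show ?thesis using divdiff_perm_reduced_word[of "[]" id]
    by (simp add: schubert_in_def)
qed

lemma homog_X_power_mult: "homog d f \<Longrightarrow> 1 \<le> i \<Longrightarrow> homog (k + d) (X i ^ k * f)"
  by (induction k) (auto intro: homog.X_mult simp: mult.assoc)

lemma ex_homog_monomial:
  assumes "finite A" "\<And>i. i \<in> A \<Longrightarrow> 1 \<le> i"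
  shows "\<exists>d. homog d (\<Prod>i\<in>A. X i ^ e i)"
  using assms
proof (induction A rule: finite_induct)
  case empty
  show ?case using homog.of_int[of 1] by auto
next
  case (insert i A)
  then obtain d where "homog d (\<Prod>i\<in>A. X i ^ e i)" by auto
  then have "homog (e i + d) (X i ^ e i * (\<Prod>i\<in>A. X i ^ e i))"
    using insert.prems by (intro homog_X_power_mult) auto
  then show ?case using insert.hyps by auto
qed

lemma ex_homog_divdiff: "\<forall>i\<in>set a. 1 \<le> i \<Longrightarrow> \<exists>d. homog d f \<Longrightarrow> \<exists>d. homog d (foldr divdiff a f)"
proof (induction a)
  case (Cons i a)
  then obtain d where "homog d (foldr divdiff a f)" by auto
  then show ?case using homog_divdiff[of d "foldr divdiff a f" i] Cons.prems by auto
qed simp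

lemma ex_homog_schubert:
  assumes "w \<in> Sinf"
  shows "\<exists>d. homog d (schubert w)"
proof -
  obtain m where m: "w permutes {1..m}" using assms unfolding Sinf_def by blast
  obtain a where a: "reduced_word a (pinv w \<circ> longest_perm m)"
    using ex_reduced_word assms by fastforce
  show ?thesis
    unfolding schubert_eq[OF m] schubert_in_def divdiff_perm_reduced_word[OF a]
    by (intro ex_homog_divdiff reduced_word_set[OF a] ex_homog_monomial) auto
qed

text \<open>Dividing along descents ends at 1, so Schubert polynomials do not vanish. At a descent
  of w the divided difference is therefore nonzero, which forces positive degree.\<close>

lemma no_const_schubert:
  assumes "w \<in> Sinf" "w \<noteq> id"
  shows "no_const (schubert w)"
proof -
  have nz: "schubert w \<noteq> 0" if "w \<in> Sinf" for w
    using that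
  proof (induction "inv_count w" arbitrary: w rule: less_induct)
    case less
    show ?case
    proof (cases "w = id")
      case False
      then obtain i where i: "1 \<le> i" "w (Suc i) < w i" using ex_descent less.prems by blast
      have "schubert (w \<circ> simple_refl i) \<noteq> 0"
        using inv_count_descent[OF less.prems i] less.prems i by (intro less.hyps) auto
      then have "divdiff i (schubert w) \<noteq> 0" using divdiff_schubert less.prems i by simp
      then show ?thesis by auto
    qed (simp only: schubert_id one_neq_zero not_False_eq_True)
  qed
  obtain d where d: "homog d (schubert w)" using ex_homog_schubert assms(1) by blast
  obtain i where i: "1 \<le> i" "w (Suc i) < w i" using ex_descent assms by blast
  have "divdiff i (schubert w) \<noteq> 0" using divdiff_schubert[OF assms(1) i(1)] i assms(1) nz by simp
  then have "0 < d" using homog_divdiff[OF d i(1)] by auto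
  then show ?thesis using d homog_no_const by blast
qed

section \<open>Atoms of involutions\<close>

definition invol :: "(nat \<Rightarrow> nat) \<Rightarrow> bool" where
  "invol y \<longleftrightarrow> y \<in> Sinf \<and> (\<forall>k. y (y k) = k)"

definition st :: "nat \<Rightarrow> (nat \<Rightarrow> nat) \<Rightarrow> nat \<Rightarrow> nat" where
  "st i y = lt i (rt i y)"

text \<open>\<open>st i\<close> is \<open>y \<mapsto> s_i \<circ> y \<circ> s_i\<close> for the Demazure product, and \<open>ds i\<close> inverts it at descents.\<close>
definition ds :: "nat \<Rightarrow> (nat \<Rightarrow> nat) \<Rightarrow> nat \<Rightarrow> nat" where
  "ds i y = (if y i = Suc i then y \<circ> simple_refl i else simple_refl i \<circ> y \<circ> simple_refl i)"

text \<open>Twice the length of the atoms; see \<open>At_nonempty\<close>.\<close>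
definition hgt :: "(nat \<Rightarrow> nat) \<Rightarrow> nat" where
  "hgt y = inv_count y + card {k. k < y k}"

lemma invol_Sinf: "invol y \<Longrightarrow> y \<in> Sinf"
  by (simp add: invol_def)

lemma invol_invol: "invol y \<Longrightarrow> y (y k) = k"
  by (simp add: invol_def)

lemma invol_pinv: "invol y \<Longrightarrow> pinv y = y"
  by (intro inv_equality) (simp_all add: invol_def)

lemma invol_eq_iff: "invol y \<Longrightarrow> y a = b \<longleftrightarrow> y b = a"
  by (auto simp: invol_def)

lemma invol_id [simp]: "invol id"
  by (simp add: invol_def)

lemma hgt_id [simp]: "hgt id = 0"
proof -
  have "{k. k < (id k :: nat)} = {}" by simp
  then show ?thesis unfolding hgt_def inv_count_id by (simp only: card.empty)
qed

lemma finite_exceedances: "y \<in> Sinf \<Longrightarrow> finite {k. k < y k}"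
proof -
  assume "y \<in> Sinf"
  then obtain m where m: "y permutes {1..m}" unfolding Sinf_def by blast
  have "{k. k < y k} \<subseteq> {1..m}"
    using permutes_not_in[OF m] by (metis (mono_tags, lifting) less_irrefl mem_Collect_eq subsetI)
  then show ?thesis by (rule finite_subset) (rule finite_atLeastAtMost)
qed

lemma st_descent:
  assumes "invol y" "y (Suc i) < y i"
  shows "st i y = y"
  using assms by (simp add: st_def rt_def lt_def invol_pinv)

lemma invol_conj: "invol y \<Longrightarrow> 1 \<le> i \<Longrightarrow> invol (simple_refl i \<circ> y \<circ> simple_refl i)"
  by (simp add: invol_def)

lemma invol_fixed_comp:
  assumes "invol y" "1 \<le> i" "y i = i" "y (Suc i) = Suc i"
  shows "y \<circ> simple_refl i = simple_refl i \<circ> y" "invol (y \<circ> simple_refl i)"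
proof -
  show c: "y \<circ> simple_refl i = simple_refl i \<circ> y"
  proof
    fix k
    show "(y \<circ> simple_refl i) k = (simple_refl i \<circ> y) k"
      using assms Sinf_eq_iff[OF invol_Sinf[OF assms(1)], of k i]
        Sinf_eq_iff[OF invol_Sinf[OF assms(1)], of k "Suc i"]
      by (auto simp: transpose_def)
  qed
  have "(y \<circ> simple_refl i) ((y \<circ> simple_refl i) k) = k" for k
    using fun_cong[OF c, of "(y \<circ> simple_refl i) k"] assms(1) by (simp add: invol_def)
  then show "invol (y \<circ> simple_refl i)" using assms by (simp add: invol_def)
qed

text \<open>If y fixes i and i + 1, then y s_i = s_i y is already an involution with the left
  descent, and the left operator does nothing. Otherwise both multiplications take place.\<close>

lemma st_ascent_eq:
  assumes "invol y" "1 \<le> i" "y i < y (Suc i)"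
  shows "st i y = (if y i = i \<and> y (Suc i) = Suc i then y \<circ> simple_refl i
    else simple_refl i \<circ> y \<circ> simple_refl i)"
proof -
  have p: "pinv (y \<circ> simple_refl i) = simple_refl i \<circ> y"
    using assms by (simp add: Sinf_inv_comp_refl invol_Sinf invol_pinv)
  show ?thesis
  proof (cases "y i = i \<and> y (Suc i) = Suc i")
    case True
    then show ?thesis using assms by (simp add: st_def rt_def lt_def p)
  next
    case False
    then have "simple_refl i (y i) < simple_refl i (y (Suc i))"
      using simple_refl_less_iff[of "y i" "y (Suc i)" i] assms(3) by auto
    then show ?thesis unfolding if_not_P[OF False]
      using assms by (simp add: st_def rt_def lt_def p comp_assoc)
  qed
qed

text \<open>This explains \<open>hgt\<close>: conjugation adds two inversions and keeps the number
  of 2-cycles, while multiplication by s_i adds one inversion and one 2-cycle.\<close>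

lemma st_ascent:
  assumes "invol y" "1 \<le> i" "y i < y (Suc i)"
  shows "invol (st i y)" "st i y (Suc i) < st i y i" "ds i (st i y) = y" "hgt (st i y) = hgt y + 2"
proof -
  note S = invol_Sinf[OF assms(1)]
  have "invol (st i y) \<and> st i y (Suc i) < st i y i \<and> ds i (st i y) = y \<and> hgt (st i y) = hgt y + 2"
  proof (cases "y i = i \<and> y (Suc i) = Suc i")
    case True
    then have z: "st i y = y \<circ> simple_refl i" by (simp add: st_ascent_eq[OF assms])
    have "{k. k < (y \<circ> simple_refl i) k} = insert i {k. k < y k}"
      using True by (auto simp: transpose_def split: if_splits)
    moreover have "i \<notin> {k. k < y k}" using True by simp
    ultimately have "card {k. k < (y \<circ> simple_refl i) k} = Suc (card {k. k < y k})"
      using finite_exceedances[OF S] by simp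
    then have "hgt (st i y) = hgt y + 2"
      unfolding z hgt_def using inv_count_ascent[OF S assms(3)] by simp
    moreover have "ds i (st i y) = y" unfolding z ds_def using True by simp
    ultimately show ?thesis using invol_fixed_comp[OF assms(1,2)] True z by simp
  next
    case False
    then have z: "st i y = simple_refl i \<circ> y \<circ> simple_refl i"
      by (simp only: st_ascent_eq[OF assms] if_False)
    have ni: "y i \<noteq> Suc i" using assms invol_invol[OF assms(1), of i] by auto
    then have ni': "y (Suc i) \<noteq> i" using invol_eq_iff[OF assms(1)] by metis
    have desc: "simple_refl i (y i) < simple_refl i (y (Suc i))"
      using simple_refl_less_iff[of "y i" "y (Suc i)" i] assms(3) False by auto
    have "{k. k < st i y k} = simple_refl i ` {k. k < y k}"
      unfolding set_eq_iff
    proof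
      fix k
      have "k < st i y k \<longleftrightarrow> simple_refl i (simple_refl i k) < simple_refl i (y (simple_refl i k))"
        by (simp add: z)
      also have "\<dots> \<longleftrightarrow> simple_refl i k < y (simple_refl i k)"
        using ni ni' by (intro simple_refl_less_iff) auto
      also have "\<dots> \<longleftrightarrow> k \<in> simple_refl i ` {k. k < y k}"
        by (auto intro!: image_eqI[of k _ "simple_refl i k"])
      finally show "k \<in> {k. k < st i y k} \<longleftrightarrow> k \<in> simple_refl i ` {k. k < y k}" by simp
    qed
    then have c: "card {k. k < st i y k} = card {k. k < y k}"
      by (simp add: card_image inj_on_subset[OF inj_transpose])
    have "inv_count (st i y) = Suc (inv_count (y \<circ> simple_refl i))"
      unfolding z comp_assoc
      using S assms(2) desc
      by (intro inv_count_left_ascent) (simp_all add: Sinf_inv_comp_refl invol_pinv[OF assms(1)])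
    then have "hgt (st i y) = hgt y + 2"
      using inv_count_ascent[OF S assms(3)] c by (simp add: hgt_def)
    moreover have "st i y (Suc i) < st i y i" using desc by (simp add: z)
    moreover have "ds i (st i y) = y"
    proof -
      have "st i y i \<noteq> Suc i" using ni' by (auto simp: z transpose_def split: if_splits)
      then show ?thesis by (simp add: ds_def z fun_eq_iff)
    qed
    ultimately show ?thesis using invol_conj[OF assms(1,2)] z by simp
  qed
  then show "invol (st i y)" "st i y (Suc i) < st i y i" "ds i (st i y) = y" "hgt (st i y) = hgt y + 2"
    by auto
qed

lemma ds_descent:
  assumes "invol y" "1 \<le> i" "y (Suc i) < y i"
  shows "invol (ds i y)" "ds i y i < ds i y (Suc i)" "st i (ds i y) = y" "hgt y = hgt (ds i y) + 2"
proof -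
  have *: "invol (ds i y) \<and> ds i y i < ds i y (Suc i) \<and> st i (ds i y) = y"
  proof (cases "y i = Suc i")
    case True
    then have yi: "y (Suc i) = i" using invol_eq_iff[OF assms(1)] by metis
    have "(y \<circ> simple_refl i) ((y \<circ> simple_refl i) k) = k" for k
      using True yi invol_invol[OF assms(1)] invol_eq_iff[OF assms(1), of k i]
        invol_eq_iff[OF assms(1), of k "Suc i"]
      by (auto simp: transpose_def)
    then have "invol (y \<circ> simple_refl i)" using assms by (simp add: invol_def)
    moreover have "ds i y = y \<circ> simple_refl i" using True by (simp add: ds_def)
    ultimately show ?thesis
      using st_ascent_eq[of "y \<circ> simple_refl i" i] True yi assms(2) by simp
  next
    case False
    then have d: "ds i y = simple_refl i \<circ> y \<circ> simple_refl i" by (simp add: ds_def)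
    have asc: "ds i y i < ds i y (Suc i)"
      using simple_refl_less_iff[of "y (Suc i)" "y i" i] assms(3) False by (auto simp: d)
    have n: "\<not> (ds i y i = i \<and> ds i y (Suc i) = Suc i)"
      using assms(3) by (auto simp: d transpose_def split: if_splits)
    have "invol (ds i y)" unfolding d by (rule invol_conj[OF assms(1,2)])
    then have "st i (ds i y) = simple_refl i \<circ> ds i y \<circ> simple_refl i"
      using st_ascent_eq[of "ds i y" i] assms(2) asc n by (simp only: if_False)
    also have "\<dots> = y" by (simp add: d fun_eq_iff)
    finally show ?thesis using asc invol_conj[OF assms(1,2)] by (simp add: d)
  qed
  then show "invol (ds i y)" "ds i y i < ds i y (Suc i)" "st i (ds i y) = y" by auto
  then show "hgt y = hgt (ds i y) + 2" using st_ascent(4)[of "ds i y" i] assms(2) by simp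
qed

lemma invol_ascent_or_descent: "invol y \<Longrightarrow> \<not> y i < y (Suc i) \<longleftrightarrow> y (Suc i) < y i"
  using Sinf_ascent_or_descent invol_Sinf by blast

lemma st_props:
  assumes "invol y" "1 \<le> i"
  shows "invol (st i y)" "st i y (Suc i) < st i y i" "hgt (st i y) \<le> hgt y + 2"
    "hgt (st i y) = hgt y + 2 \<Longrightarrow> y i < y (Suc i)"
proof -
  consider "y i < y (Suc i)" | "y (Suc i) < y i" using invol_ascent_or_descent[OF assms(1)] by blast
  note c = this
  show "invol (st i y)" by (cases rule: c) (use assms st_ascent st_descent in auto)
  show "st i y (Suc i) < st i y i" by (cases rule: c) (use assms st_ascent st_descent in auto)
  show "hgt (st i y) \<le> hgt y + 2" by (cases rule: c) (use assms st_ascent st_descent in auto)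
  show "y i < y (Suc i)" if "hgt (st i y) = hgt y + 2"
    by (cases rule: c) (use that assms st_descent in auto)
qed

section \<open>Atoms as words that raise the height at every letter\<close>

definition inv_hecke :: "(nat \<Rightarrow> nat) \<Rightarrow> nat \<Rightarrow> nat" where
  "inv_hecke w = demazure (pinv w) w"

lemma inv_hecke_id: "inv_hecke id = id"
  unfolding inv_hecke_def using demazure_additive[of id id] by simp

lemma inv_hecke_ascent:
  assumes "w \<in> Sinf" "1 \<le> i" "w i < w (Suc i)"
  shows "inv_hecke (w \<circ> simple_refl i) = st i (inv_hecke w)"
proof -
  let ?s = "simple_refl i"
  have r: "w \<circ> ?s = demazure w ?s" using assms by (simp add: demazure_refl_right rt_def)
  have l: "pinv (w \<circ> ?s) = demazure ?s (pinv w)"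
    using assms by (simp add: demazure_refl_left lt_def Sinf_inv_comp_refl)
  have "inv_hecke (w \<circ> ?s) = demazure (demazure ?s (pinv w)) (demazure w ?s)"
    unfolding inv_hecke_def l by (simp only: r)
  also have "\<dots> = demazure ?s (demazure (demazure (pinv w) w) ?s)"
    using assms by (simp add: demazure_assoc)
  also have "\<dots> = st i (inv_hecke w)"
    unfolding st_def inv_hecke_def using assms by (simp add: demazure_refl_left demazure_refl_right)
  finally show ?thesis .
qed

lemma inv_hecke_descent:
  assumes "w \<in> Sinf" "1 \<le> i" "w (Suc i) < w i"
  shows "inv_hecke w = st i (inv_hecke (w \<circ> simple_refl i))"
  using inv_hecke_ascent[of "w \<circ> simple_refl i" i] assms by simp

text \<open>One more letter raises the height by at most 2. This is the lower bound on length behind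
  the minimality in \<open>atoms\<close>.\<close>

lemma inv_hecke_bound:
  assumes "w \<in> Sinf"
  shows "invol (inv_hecke w) \<and> hgt (inv_hecke w) \<le> 2 * inv_count w"
  using assms
proof (induction "inv_count w" arbitrary: w rule: less_induct)
  case less
  show ?case
  proof (cases "w = id")
    case True
    then show ?thesis using inv_hecke_id by (simp only: invol_id hgt_id) simp
  next
    case False
    then obtain i where i: "1 \<le> i" "w (Suc i) < w i" using ex_descent less.prems by blast
    let ?v = "w \<circ> simple_refl i"
    have IH: "invol (inv_hecke ?v) \<and> hgt (inv_hecke ?v) \<le> 2 * inv_count ?v"
      using inv_count_descent[OF less.prems i] less.prems i by (intro less.hyps) auto
    then show ?thesis
      using inv_hecke_descent[OF less.prems i] st_props(1,3)[of "inv_hecke ?v" i] i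
        inv_count_descent[OF less.prems i] by simp
  qed
qed

text \<open>The permutations that attain \<open>inv_hecke_bound\<close>; \<open>atoms_eq\<close>
  identifies them with the atoms. Unlike minimality, this condition passes directly to
  prefixes.\<close>

definition At :: "(nat \<Rightarrow> nat) \<Rightarrow> (nat \<Rightarrow> nat) set" where
  "At y = {w \<in> Sinf. inv_hecke w = y \<and> 2 * inv_count w = hgt y}"

lemma At_ascent:
  assumes "invol y" "1 \<le> i" "y (Suc i) < y i" "w \<in> At (ds i y)"
  shows "w i < w (Suc i)" "w \<circ> simple_refl i \<in> At y"
proof -
  have w: "w \<in> Sinf" "inv_hecke w = ds i y" "2 * inv_count w = hgt (ds i y)"
    using assms(4) by (auto simp: At_def)
  note D = ds_descent[OF assms(1-3)]
  show asc: "w i < w (Suc i)"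
  proof (rule ccontr)
    assume "\<not> w i < w (Suc i)"
    then have "w (Suc i) < w i" using Sinf_ascent_or_descent w by blast
    then have "ds i y = st i (inv_hecke (w \<circ> simple_refl i))"
      using inv_hecke_descent[OF w(1) assms(2)] w(2) by simp
    then have "ds i y (Suc i) < ds i y i"
      using st_props(2)[of "inv_hecke (w \<circ> simple_refl i)" i] inv_hecke_bound w(1) assms(2) by simp
    then show False using D(2) by simp
  qed
  show "w \<circ> simple_refl i \<in> At y"
    using w asc assms(2) D inv_hecke_ascent[OF w(1) assms(2) asc] inv_count_ascent[OF w(1) asc]
    by (simp add: At_def)
qed

lemma At_nonempty: "invol y \<Longrightarrow> At y \<noteq> {}"
proof (induction "hgt y" arbitrary: y rule: less_induct)
  case less
  show ?case
  proof (cases "y = id")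
    case True
    then have "id \<in> At y" using inv_hecke_id by (simp add: At_def)
    then show ?thesis by blast
  next
    case False
    then obtain i where i: "1 \<le> i" "y (Suc i) < y i" using ex_descent less.prems invol_Sinf by blast
    note D = ds_descent[OF less.prems i]
    have "At (ds i y) \<noteq> {}" using D by (intro less.hyps) auto
    then show ?thesis using At_ascent[OF less.prems i] by blast
  qed
qed

text \<open>Equality in the height bound forces the last letter to be a genuine ascent of the
  involution reached before it, which must then be \<open>ds i y\<close>. Removing s_i is thus a
  bijection between atoms.\<close>

lemma At_descents:
  assumes "invol y" "1 \<le> i"
  shows "{w \<in> At y. w (Suc i) < w i}
    = (if y (Suc i) < y i then (\<lambda>w. w \<circ> simple_refl i) ` At (ds i y) else {})"
proof -
  have *: "y (Suc i) < y i \<and> w \<circ> simple_refl i \<in> At (ds i y)"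
    if w: "w \<in> At y" "w (Suc i) < w i" for w
  proof -
    let ?v = "w \<circ> simple_refl i"
    have w': "w \<in> Sinf" "inv_hecke w = y" "2 * inv_count w = hgt y" using w by (auto simp: At_def)
    have y: "y = st i (inv_hecke ?v)" using inv_hecke_descent[OF w'(1) assms(2) w(2)] w'(2) by simp
    have v: "invol (inv_hecke ?v)" "hgt (inv_hecke ?v) \<le> 2 * inv_count ?v"
      using inv_hecke_bound[of ?v] w' assms(2) by auto
    have l: "inv_count w = Suc (inv_count ?v)" using inv_count_descent[OF w'(1) assms(2) w(2)] .
    have h: "hgt y = hgt (inv_hecke ?v) + 2"
      using st_props(3)[OF v(1) assms(2)] v(2) l w'(3) y by simp
    then have "inv_hecke ?v i < inv_hecke ?v (Suc i)" using st_props(4)[OF v(1) assms(2)] y by simp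
    then have "ds i y = inv_hecke ?v" using st_ascent(3)[OF v(1) assms(2)] y by simp
    then show ?thesis using st_props(2)[OF v(1) assms(2)] y h l w' assms(2) by (simp add: At_def)
  qed
  show ?thesis
  proof (cases "y (Suc i) < y i")
    case True
    have "{w \<in> At y. w (Suc i) < w i} = (\<lambda>w. w \<circ> simple_refl i) ` At (ds i y)"
    proof (intro equalityI subsetI)
      fix w assume "w \<in> {w \<in> At y. w (Suc i) < w i}"
      then have "w \<circ> simple_refl i \<in> At (ds i y)" using * by blast
      moreover have "w = (w \<circ> simple_refl i) \<circ> simple_refl i" by simp
      ultimately show "w \<in> (\<lambda>w. w \<circ> simple_refl i) ` At (ds i y)" by blast
    next
      fix w assume "w \<in> (\<lambda>w. w \<circ> simple_refl i) ` At (ds i y)"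
      then obtain v where v: "v \<in> At (ds i y)" "w = v \<circ> simple_refl i" by blast
      then show "w \<in> {w \<in> At y. w (Suc i) < w i}" using At_ascent[OF assms True v(1)] by simp
    qed
    then show ?thesis using True by simp
  next
    case False
    then show ?thesis using * by auto
  qed
qed

lemma At_id: "At id = {id}"
proof -
  have "w = id" if "w \<in> At id" for w
  proof (rule ccontr)
    assume "w \<noteq> id"
    moreover have "w \<in> Sinf" using that by (simp add: At_def)
    ultimately obtain i where "1 \<le> i" "w (Suc i) < w i" using ex_descent by blast
    then show False using At_descents[of id i] that by auto
  qed
  moreover have "id \<in> At id" using inv_hecke_id by (simp add: At_def)
  ultimately show ?thesis by blast
qed

text \<open>A sum over an infinite set would be 0 by convention. A nontrivial atom has a descent,
  which is one of the finitely many descents of y.\<close>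

lemma finite_At: "invol y \<Longrightarrow> finite (At y)"
proof (induction "hgt y" arbitrary: y rule: less_induct)
  case less
  show ?case
  proof (cases "y = id")
    case True
    then show ?thesis by (simp only: At_id) simp
  next
    case False
    let ?I = "{i. 1 \<le> i \<and> y (Suc i) < y i}"
    have "At y \<subseteq> (\<Union>i\<in>?I. (\<lambda>w. w \<circ> simple_refl i) ` At (ds i y))"
    proof
      fix w assume w: "w \<in> At y"
      then have "w \<in> Sinf" "w \<noteq> id" using False inv_hecke_id by (auto simp: At_def)
      then obtain i where i: "1 \<le> i" "w (Suc i) < w i" using ex_descent by blast
      then have "w \<in> {w \<in> At y. w (Suc i) < w i}" using w by simp
      then show "w \<in> (\<Union>i\<in>?I. (\<lambda>w. w \<circ> simple_refl i) ` At (ds i y))"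
        unfolding At_descents[OF less.prems i(1)] using i(1) by (auto split: if_splits)
    qed
    moreover have "finite ?I"
    proof (rule finite_subset)
      show "?I \<subseteq> fst ` inversions y" by (force simp: inversions_def image_iff)
    qed (use less.prems invol_Sinf in auto)
    moreover have "finite (At (ds i y))" if "i \<in> ?I" for i
      using ds_descent[OF less.prems, of i] that by (intro less.hyps) auto
    ultimately show ?thesis by (auto intro: finite_subset)
  qed
qed

text \<open>The lower bound on length is attained by some permutation (\<open>At_nonempty\<close>),
  so it is the minimum.\<close>

lemma atoms_eq: assumes "invol y" shows "atoms y = At y"
proof -
  have lb: "hgt y \<le> 2 * perm_length v" if "v \<in> Sinf" "demazure (pinv v) v = y" for v
    using inv_hecke_bound[of v] that by (simp add: inv_hecke_def perm_length_eq)
  obtain v where v: "v \<in> At y" using At_nonempty[OF assms] by blast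
  have v': "v \<in> Sinf" "demazure (pinv v) v = y" "2 * perm_length v = hgt y"
    using v by (auto simp: At_def inv_hecke_def perm_length_eq)
  show ?thesis
  proof (intro equalityI subsetI)
    fix w assume "w \<in> atoms y"
    then have w: "w \<in> Sinf" "demazure (pinv w) w = y" "perm_length w \<le> perm_length v"
      using v' by (auto simp: atoms_def)
    then have "2 * perm_length w = hgt y" using lb[OF w(1,2)] v' by simp
    then show "w \<in> At y" using w by (simp add: At_def inv_hecke_def perm_length_eq)
  next
    fix w assume "w \<in> At y"
    then have w: "w \<in> Sinf" "demazure (pinv w) w = y" "2 * perm_length w = hgt y"
      by (auto simp: At_def inv_hecke_def perm_length_eq)
    then show "w \<in> atoms y" using lb unfolding atoms_def by fastforce
  qed
qed

lemma inv_schubert_id: "inv_schubert id = 1"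
  unfolding inv_schubert_def atoms_eq[OF invol_id] At_id using schubert_id by simp

text \<open>Only atoms with a descent at i survive the divided difference, and
  \<open>At_descents\<close> reindexes these by the atoms of \<open>ds i y\<close>.\<close>

lemma divdiff_inv_schubert:
  assumes "invol y" "1 \<le> i"
  shows "divdiff i (inv_schubert y) = (if y (Suc i) < y i then inv_schubert (ds i y) else 0)"
proof -
  note fin = finite_At[OF assms(1)]
  have "divdiff i (inv_schubert y)
      = (\<Sum>w\<in>At y. if w (Suc i) < w i then schubert (w \<circ> simple_refl i) else 0)"
    unfolding inv_schubert_def atoms_eq[OF assms(1)] divdiff_sum
    by (intro sum.cong refl divdiff_schubert assms(2)) (simp add: At_def)
  also have "\<dots> = (\<Sum>w\<in>{w \<in> At y. w (Suc i) < w i}. schubert (w \<circ> simple_refl i))"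
    using fin by (simp add: sum.If_cases Int_def)
  also have "\<dots> = (if y (Suc i) < y i then inv_schubert (ds i y) else 0)"
  proof (cases "y (Suc i) < y i")
    case True
    have "inj_on (\<lambda>w. w \<circ> simple_refl i) (At (ds i y))"
      by (rule inj_on_inverseI[where g = "\<lambda>w. w \<circ> simple_refl i"]) simp
    then show ?thesis
      using True unfolding At_descents[OF assms] inv_schubert_def atoms_eq[OF ds_descent(1)[OF assms True]]
      by (simp add: sum.reindex)
  next
    case False
    then show ?thesis unfolding At_descents[OF assms] by simp
  qed
  finally show ?thesis .
qed

lemma no_const_inv_schubert:
  assumes "invol y" "y \<noteq> id"
  shows "no_const (inv_schubert y)"
  unfolding inv_schubert_def atoms_eq[OF assms(1)]
proof (rule no_const_sum)
  fix w assume "w \<in> At y"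
  then have "w \<in> Sinf" "w \<noteq> id" using assms(2) inv_hecke_id by (auto simp: At_def)
  then show "no_const (schubert w)" by (rule no_const_schubert)
qed

section \<open>The nilCoxeter action on functions of involutions\<close>

text \<open>The right action of the nilCoxeter generator \<open>u_i\<close>.\<close>
definition ua :: "nat \<Rightarrow> ((nat \<Rightarrow> nat) \<Rightarrow> ipoly) \<Rightarrow> (nat \<Rightarrow> nat) \<Rightarrow> ipoly" where
  "ua i F y = (if invol y \<and> 1 \<le> i \<and> y (Suc i) < y i then F (ds i y) else 0)"

definition unit_at :: "(nat \<Rightarrow> nat) \<Rightarrow> ipoly" where
  "unit_at y = (if y = id then 1 else 0)"

lemma fold_st_bound:
  "invol z \<Longrightarrow> \<forall>i\<in>set a. 1 \<le> i \<Longrightarrow> invol (fold st a z) \<and> hgt (fold st a z) \<le> hgt z + 2 * length a"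
proof (induction a arbitrary: z)
  case (Cons i a)
  have 1: "invol (st i z)" "hgt (st i z) \<le> hgt z + 2"
    using st_props(1,3)[OF Cons.prems(1), of i] Cons.prems(2) by auto
  have "invol (fold st a (st i z)) \<and> hgt (fold st a (st i z)) \<le> hgt (st i z) + 2 * length a"
    using 1(1) Cons.prems(2) by (intro Cons.IH) auto
  then show ?case using 1(2) by simp
qed simp

lemma ua_neq_0D: "ua i F y \<noteq> 0 \<Longrightarrow> invol y \<and> 1 \<le> i \<and> y (Suc i) < y i \<and> F (ds i y) \<noteq> 0"
  by (auto simp: ua_def split: if_splits)

text \<open>Along a word in which every letter raises the height by the full 2, the operators merely
  transport the value at z to the end point.\<close>

lemma fold_ua_eq:
  assumes "invol z" "\<forall>i\<in>set a. 1 \<le> i" "hgt (fold st a z) = hgt z + 2 * length a"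
  shows "fold ua a F (fold st a z) = F z"
  using assms
proof (induction a rule: rev_induct)
  case (snoc i a)
  let ?y = "fold st a z"
  have y: "invol ?y" "hgt ?y \<le> hgt z + 2 * length a" using fold_st_bound snoc.prems by auto
  have i: "1 \<le> i" using snoc.prems by simp
  have h: "hgt (st i ?y) = hgt z + 2 * length a + 2" using snoc.prems by simp
  then have e: "hgt (st i ?y) = hgt ?y + 2" "hgt ?y = hgt z + 2 * length a"
    using st_props(3)[OF y(1) i] y(2) by auto
  have "?y i < ?y (Suc i)" by (rule st_props(4)[OF y(1) i e(1)])
  then have "ua i (fold ua a F) (st i ?y) = fold ua a F ?y"
    using st_ascent[OF y(1) i] i by (simp add: ua_def)
  also have "\<dots> = F z" using snoc.prems e(2) by (intro snoc.IH) auto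
  finally show ?case by simp
qed simp

lemma fold_ua_neq_0:
  assumes "invol y" "\<forall>i\<in>set a. 1 \<le> i" "fold ua a F y \<noteq> 0"
  shows "\<exists>z. invol z \<and> fold st a z = y \<and> hgt y = hgt z + 2 * length a"
  using assms
proof (induction a arbitrary: y rule: rev_induct)
  case (snoc i a)
  then have "ua i (fold ua a F) y \<noteq> 0" by simp
  then have d: "1 \<le> i" "y (Suc i) < y i" "fold ua a F (ds i y) \<noteq> 0"
    using ua_neq_0D by blast+
  note D = ds_descent[OF snoc.prems(1) d(1,2)]
  obtain z where "invol z" "fold st a z = ds i y" "hgt (ds i y) = hgt z + 2 * length a"
    using snoc.IH[OF D(1) _ d(3)] snoc.prems(2) by auto
  then show ?case using D(3,4) by (intro exI[of _ z]) simp
qed auto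

lemma fold_ua_not_invol: "a \<noteq> [] \<Longrightarrow> \<not> invol y \<Longrightarrow> fold ua a F y = 0"
  by (cases a rule: rev_cases) (simp_all add: ua_def)

text \<open>Relations between the operators u_i follow from relations between words in
  \<open>st\<close>, tested only where F is nonzero. Equal length makes both words raise the height
  fully as soon as one does. The support condition admits relations that hold at the identity
  alone.\<close>

lemma fold_ua_cong:
  assumes "a \<noteq> []" "length a = length b" "\<forall>i\<in>set a. 1 \<le> i" "\<forall>i\<in>set b. 1 \<le> i"
    and "\<And>z. invol z \<Longrightarrow> F z \<noteq> 0 \<Longrightarrow> fold st a z = fold st b z"
  shows "fold ua a F = fold ua b F"
proof
  fix y
  have *: "fold ua a F y = fold ua b F y"
    if a: "a \<noteq> []" "length a = length b" "\<forall>i\<in>set a. 1 \<le> i" "\<forall>i\<in>set b. 1 \<le> i" "fold ua a F y \<noteq> 0"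
      and c: "\<And>z. invol z \<Longrightarrow> F z \<noteq> 0 \<Longrightarrow> fold st a z = fold st b z" for a b
  proof -
    have y: "invol y" using fold_ua_not_invol a by blast
    obtain z where z: "invol z" "fold st a z = y" "hgt y = hgt z + 2 * length a"
      using fold_ua_neq_0[OF y a(3,5)] by blast
    have "fold ua a F y = F z" using fold_ua_eq[OF z(1) a(3), of F] z by simp
    moreover have "fold st b z = y" using c[OF z(1)] calculation a(5) z(2) by simp
    then have "fold ua b F y = F z" using fold_ua_eq[OF z(1) a(4), of F] z a(2) by simp
    ultimately show ?thesis by simp
  qed
  show "fold ua a F y = fold ua b F y"
  proof (cases "fold ua a F y = 0 \<and> fold ua b F y = 0")
    case False
    then consider "fold ua a F y \<noteq> 0" | "fold ua b F y \<noteq> 0" by blast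
    then show ?thesis
    proof cases
      case 1
      then show ?thesis by (intro *[of a b] assms)
    next
      case 2
      have b: "b \<noteq> []" using assms(1,2) by auto
      show ?thesis
        by (rule sym, rule *[of b a]) (simp_all add: b assms(2-4) 2 assms(5) del: One_nat_def)
    qed
  qed simp
qed

lemma fold_st_eq_lt_rt:
  "y \<in> Sinf \<Longrightarrow> \<forall>i\<in>set a. 1 \<le> i \<Longrightarrow> fold st a y = fold lt a (fold rt a y)"
proof (induction a arbitrary: y)
  case (Cons i a)
  have "fold st (i # a) y = fold st a (st i y)" by simp
  also have "\<dots> = fold lt a (fold rt a (st i y))"
    using Cons.prems by (intro Cons.IH) (auto simp: st_def)
  also have "st i y = lt i (rt i y)" by (rule st_def)
  also have "fold rt a (lt i (rt i y)) = lt i (fold rt a (rt i y))"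
    using Cons.prems by (intro lt_fold_rt[symmetric]) auto
  also have "fold lt a \<dots> = fold lt (i # a) (fold rt (i # a) y)" by simp
  finally show ?case .
qed simp

text \<open>\<open>st\<close> is a left operator after a right one, and these commute; hence every
  relation of the Demazure monoid carries over to involutions.\<close>

lemma fold_st_cong:
  assumes "invol y" "\<forall>i\<in>set a. 1 \<le> i" "\<forall>i\<in>set b. 1 \<le> i" "fold rt a id = fold rt b id"
  shows "fold st a y = fold st b y"
proof -
  have r: "fold rt a u = fold rt b u" if "u \<in> Sinf" for u
    using fold_rt_determined that assms by blast
  have l: "fold lt a u = fold lt b u" if u: "u \<in> Sinf" for u
  proof -
    have "pinv (fold rt a (pinv u)) = pinv (fold rt b (pinv u))" using r u by simp
    then show ?thesis using inv_fold_rt[of "pinv u"] assms(2,3) u by simp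
  qed
  have "y \<in> Sinf" using assms(1) by (rule invol_Sinf)
  then show ?thesis using r l fold_rt_Sinf assms by (simp add: fold_st_eq_lt_rt)
qed

lemma ua_ua_same: "ua i (ua i F) = (\<lambda>y. 0)"
proof
  fix y
  show "ua i (ua i F) y = 0"
    using ds_descent(2)[of y i] by (auto simp: ua_def)
qed

lemma rt_ascent: "u i < u (Suc i) \<Longrightarrow> rt i u = u \<circ> simple_refl i"
  by (simp add: rt_def)

lemma ext_on_four:
  assumes "f i = g i" "f (Suc i) = g (Suc i)" "f (Suc (Suc i)) = g (Suc (Suc i))"
    "f (Suc (Suc (Suc i))) = g (Suc (Suc (Suc i)))"
    "\<And>k. k \<noteq> i \<Longrightarrow> k \<noteq> Suc i \<Longrightarrow> k \<noteq> Suc (Suc i) \<Longrightarrow> k \<noteq> Suc (Suc (Suc i)) \<Longrightarrow> f k = g k"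
  shows "f = g"
proof
  fix k
  consider "k = i" | "k = Suc i" | "k = Suc (Suc i)" | "k = Suc (Suc (Suc i))"
    | "k \<noteq> i" "k \<noteq> Suc i" "k \<noteq> Suc (Suc i)" "k \<noteq> Suc (Suc (Suc i))" by blast
  then show "f k = g k" by cases (simp_all only: assms(1-4), rule assms(5))
qed

lemma ua_commute:
  assumes "1 \<le> i" "1 \<le> j" "Suc i < j \<or> Suc j < i"
  shows "ua i (ua j F) = ua j (ua i F)"
proof -
  have "fold rt [j, i] id = fold rt [i, j] id"
    using assms by (auto simp: rt_ascent fun_eq_iff transpose_def)
  then have "fold ua [j, i] F = fold ua [i, j] F"
    using assms by (intro fold_ua_cong fold_st_cong) auto
  then show ?thesis by simp
qed

lemma ua_braid:
  assumes "1 \<le> i"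
  shows "ua i (ua (Suc i) (ua i F)) = ua (Suc i) (ua i (ua (Suc i) F))"
proof -
  have "fold rt [i, Suc i, i] id = simple_refl i \<circ> simple_refl (Suc i) \<circ> simple_refl i"
    by (simp add: rt_ascent)
  also have "\<dots> = simple_refl (Suc i) \<circ> simple_refl i \<circ> simple_refl (Suc i)"
    by (rule ext_on_four[of _ i]) simp_all
  also have "\<dots> = fold rt [Suc i, i, Suc i] id"
    by (simp add: rt_ascent)
  finally have "fold rt [i, Suc i, i] id = fold rt [Suc i, i, Suc i] id" .
  then have "fold ua [i, Suc i, i] F = fold ua [Suc i, i, Suc i] F"
    using assms by (intro fold_ua_cong fold_st_cong) auto
  then show ?thesis by simp
qed

section \<open>Relations that hold only at the identity involution\<close>

lemma st_conj:
  assumes "invol y" "1 \<le> i" "y i < y (Suc i)" "y i \<noteq> i \<or> y (Suc i) \<noteq> Suc i"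
  shows "st i y = simple_refl i \<circ> y \<circ> simple_refl i"
proof -
  have "\<not> (y i = i \<and> y (Suc i) = Suc i)" using assms(4) by blast
  then show ?thesis by (simp only: st_ascent_eq[OF assms(1-3)] if_False)
qed

lemma st_fixed:
  "invol y \<Longrightarrow> 1 \<le> i \<Longrightarrow> y i = i \<Longrightarrow> y (Suc i) = Suc i \<Longrightarrow> st i y = y \<circ> simple_refl i"
  using st_ascent_eq[of y i] by simp

lemma invol_simple_refl: "1 \<le> i \<Longrightarrow> invol (simple_refl i)"
  by (simp add: invol_def)

lemma st_id: "1 \<le> i \<Longrightarrow> st i id = simple_refl i"
  by (subst st_fixed) simp_all

lemma st_two:
  assumes "1 \<le> i"
  shows "st (Suc i) (st i id) = transpose i (Suc (Suc i))" "st i (st (Suc i) id) = transpose i (Suc (Suc i))"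
proof -
  have "st (Suc i) (simple_refl i) = simple_refl (Suc i) \<circ> simple_refl i \<circ> simple_refl (Suc i)"
    using assms invol_simple_refl[OF assms] by (intro st_conj) simp_all
  also have "\<dots> = transpose i (Suc (Suc i))" by (rule ext_on_four[of _ i]) simp_all
  finally show "st (Suc i) (st i id) = transpose i (Suc (Suc i))" by (simp only: st_id[OF assms])
  have "st i (simple_refl (Suc i)) = simple_refl i \<circ> simple_refl (Suc i) \<circ> simple_refl i"
    using assms invol_simple_refl[of "Suc i"] by (intro st_conj) simp_all
  also have "\<dots> = transpose i (Suc (Suc i))" by (rule ext_on_four[of _ i]) simp_all
  finally show "st i (st (Suc i) id) = transpose i (Suc (Suc i))" by (simp add: st_id)
qed

lemma invol_transpose: "1 \<le> i \<Longrightarrow> 1 \<le> j \<Longrightarrow> invol (transpose i j)"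
proof -
  assume "1 \<le> i" "1 \<le> j"
  then have "transpose i j permutes {1..max i j}" by (intro permutes_swap_id) auto
  then have "transpose i j \<in> Sinf" by (rule SinfI)
  then show ?thesis by (simp add: invol_def)
qed

text \<open>Starting from the identity, both words build the transposition of i and i + 3, one
  extending its 2-cycle upwards and the other downwards.\<close>

lemma st_three:
  assumes "1 \<le> i"
  shows "fold st [i, Suc i, Suc (Suc i)] id = fold st [Suc (Suc i), Suc i, i] id"
proof -
  have 1: "st (Suc (Suc i)) (transpose i (Suc (Suc i)))
      = simple_refl (Suc (Suc i)) \<circ> transpose i (Suc (Suc i)) \<circ> simple_refl (Suc (Suc i))"
    using assms by (intro st_conj invol_transpose) simp_all
  have 2: "st i (transpose (Suc i) (Suc (Suc (Suc i))))
      = simple_refl i \<circ> transpose (Suc i) (Suc (Suc (Suc i))) \<circ> simple_refl i"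
    using assms by (intro st_conj invol_transpose) simp_all
  have 3: "simple_refl (Suc (Suc i)) \<circ> transpose i (Suc (Suc i)) \<circ> simple_refl (Suc (Suc i))
      = simple_refl i \<circ> transpose (Suc i) (Suc (Suc (Suc i))) \<circ> simple_refl i"
    by (rule ext_on_four[of _ i]) simp_all
  have "st (Suc i) (st (Suc (Suc i)) id) = transpose (Suc i) (Suc (Suc (Suc i)))"
    by (rule st_two(2)) simp
  then have "st (Suc (Suc i)) (st (Suc i) (st i id)) = st i (st (Suc i) (st (Suc (Suc i)) id))"
    by (simp only: st_two(1)[OF assms] 1 2 3)
  then show ?thesis by simp
qed

text \<open>The first three letters give (i, i+2)(i+1, i+3), and conjugating this by s_i or by
  s_(i+2) gives the same nested pair (i, i+3)(i+1, i+2).\<close>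

lemma st_four:
  assumes "1 \<le> i"
  shows "fold st [i, Suc (Suc i), Suc i, i] id = fold st [i, Suc (Suc i), Suc i, Suc (Suc i)] id"
proof -
  let ?y = "simple_refl i \<circ> simple_refl (Suc (Suc i))"
  have y: "st (Suc (Suc i)) (st i id) = ?y"
    unfolding st_id[OF assms] using assms invol_simple_refl[OF assms] by (intro st_fixed) auto
  have iy: "invol ?y"
    unfolding y[symmetric] using assms by (intro st_props) auto
  let ?z = "simple_refl (Suc i) \<circ> ?y \<circ> simple_refl (Suc i)"
  have z: "st (Suc i) ?y = ?z" using iy by (intro st_conj) simp_all
  have iz: "invol ?z" unfolding z[symmetric] using iy by (intro st_props) auto
  have "st i ?z = simple_refl i \<circ> ?z \<circ> simple_refl i"
    using iz assms by (intro st_conj) simp_all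
  moreover have "st (Suc (Suc i)) ?z = simple_refl (Suc (Suc i)) \<circ> ?z \<circ> simple_refl (Suc (Suc i))"
    using iz by (intro st_conj) simp_all
  moreover have "simple_refl i \<circ> ?z \<circ> simple_refl i
      = simple_refl (Suc (Suc i)) \<circ> ?z \<circ> simple_refl (Suc (Suc i))"
    by (rule ext_on_four[of _ i]) simp_all
  ultimately have "st i (st (Suc i) (st (Suc (Suc i)) (st i id)))
      = st (Suc (Suc i)) (st (Suc i) (st (Suc (Suc i)) (st i id)))"
    unfolding y z by (simp only:)
  then show ?thesis by simp
qed

lemma fold_ua_unit_cong:
  assumes "a \<noteq> []" "length a = length b" "\<forall>i\<in>set a. 1 \<le> i" "\<forall>i\<in>set b. 1 \<le> i"
    "fold st a id = fold st b id"
  shows "fold ua a unit_at = fold ua b unit_at"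
  using assms by (intro fold_ua_cong) (auto simp: unit_at_def split: if_splits)

lemma ua_unit:
  assumes "1 \<le> i"
  shows "ua (Suc i) (ua i unit_at) = ua i (ua (Suc i) unit_at)"
    "ua (Suc (Suc i)) (ua (Suc i) (ua i unit_at)) = ua i (ua (Suc i) (ua (Suc (Suc i)) unit_at))"
    "ua i (ua (Suc i) (ua (Suc (Suc i)) (ua i unit_at)))
      = ua (Suc (Suc i)) (ua (Suc i) (ua (Suc (Suc i)) (ua i unit_at)))"
proof -
  have "fold ua [i, Suc i] unit_at = fold ua [Suc i, i] unit_at"
    using assms st_two[OF assms] by (intro fold_ua_unit_cong) auto
  then show "ua (Suc i) (ua i unit_at) = ua i (ua (Suc i) unit_at)" by simp
  have "fold ua [i, Suc i, Suc (Suc i)] unit_at = fold ua [Suc (Suc i), Suc i, i] unit_at"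
    using assms by (intro fold_ua_unit_cong st_three) auto
  then show "ua (Suc (Suc i)) (ua (Suc i) (ua i unit_at)) = ua i (ua (Suc i) (ua (Suc (Suc i)) unit_at))" by simp
  have "fold ua [i, Suc (Suc i), Suc i, i] unit_at = fold ua [i, Suc (Suc i), Suc i, Suc (Suc i)] unit_at"
    using assms by (intro fold_ua_unit_cong st_four) auto
  then show "ua i (ua (Suc i) (ua (Suc (Suc i)) (ua i unit_at)))
      = ua (Suc (Suc i)) (ua (Suc i) (ua (Suc (Suc i)) (ua i unit_at)))" by simp
qed

text \<open>The right action of \<open>1 + z u_k\<close>.\<close>
definition hh :: "nat \<Rightarrow> ipoly \<Rightarrow> ((nat \<Rightarrow> nat) \<Rightarrow> ipoly) \<Rightarrow> (nat \<Rightarrow> nat) \<Rightarrow> ipoly" where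
  "hh k z F = (\<lambda>y. F y + z * ua k F y)"

lemma ua_lin: "ua k (\<lambda>y. F y + z * G y) = (\<lambda>y. ua k F y + z * ua k G y)"
  by (auto simp: ua_def)

lemma hh_hh_same: "hh k z (hh k w F) = hh k (w + z) F"
  unfolding hh_def ua_lin ua_ua_same by (simp add: algebra_simps)

lemma hh_commute:
  assumes "1 \<le> k" "1 \<le> l" "Suc k < l \<or> Suc l < k"
  shows "hh k z (hh l w F) = hh l w (hh k z F)"
  unfolding hh_def ua_lin ua_commute[OF assms] by (simp add: algebra_simps)

lemma hh_yang_baxter:
  assumes "1 \<le> k"
  shows "hh k z (hh (Suc k) (w + z) (hh k w F)) = hh (Suc k) w (hh k (w + z) (hh (Suc k) z F))"
  unfolding hh_def ua_lin ua_ua_same ua_braid[OF assms] by (simp add: algebra_simps)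

text \<open>Boundary relation for a column of two factors: at the identity u_p and u_(p+1) commute,
  and u_p u_(p+1) u_p vanishes.\<close>

lemma hh_unit_two:
  assumes "1 \<le> p"
  shows "hh (Suc p) (x + y) (hh p y unit_at) = hh p (y - x) (hh (Suc p) (x + y) (hh p x unit_at))"
proof -
  have z: "ua p (ua (Suc p) (ua p unit_at)) = (\<lambda>y. 0)"
    unfolding ua_unit(1)[OF assms] by (rule ua_ua_same)
  show ?thesis
    unfolding hh_def ua_lin z ua_ua_same ua_unit(1)[OF assms]
    by (simp add: algebra_simps)
qed

text \<open>A reflection equation at the identity: exchanging x and y in the inner factors moves the
  outer factor with parameter y - x from generator p + 2 to generator p.\<close>

lemma hh_unit_three:
  assumes "1 \<le> p"
  shows "hh (Suc (Suc p)) (y - x) (hh (Suc p) (x + y) (hh p y (hh (Suc (Suc p)) x unit_at)))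
    = hh p (y - x) (hh (Suc p) (x + y) (hh p x (hh (Suc (Suc p)) y unit_at)))"
proof -
  let ?a = "ua p" and ?b = "ua (Suc p)" and ?c = "ua (Suc (Suc p))"
  note B = ua_unit(1)[of "Suc p"]
  have comm: "?c (?a F) = ?a (?c F)" for F using assms by (intro ua_commute) auto
  have 1: "?b (?a unit_at) = ?a (?b unit_at)" by (rule ua_unit(1)[OF assms])
  have 2: "?b (?c unit_at) = ?c (?b unit_at)" using B by simp
  have 3: "?a (?b (?c unit_at)) = ?c (?b (?a unit_at))" using ua_unit(2)[OF assms] by simp
  have 4: "?a (?b (?a (?c unit_at))) = ?c (?b (?a (?c unit_at)))" using ua_unit(3)[OF assms] comm by simp
  have 5: "?a (?b (?a unit_at)) = (\<lambda>y. 0)" unfolding 1 by (rule ua_ua_same)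
  have 6: "?c (?b (?c unit_at)) = (\<lambda>y. 0)" unfolding 2 by (rule ua_ua_same)
  have 7: "?c (?a (?c unit_at)) = (\<lambda>y. 0)"
    unfolding comm[of unit_at, symmetric] by (rule ua_ua_same)
  show ?thesis
    unfolding hh_def ua_lin
  proof (rule ext)
    fix Y
    \<comment> \<open>The relations reduce all monomials in the operators to these coefficients.
      Named, they turn the claim into a commutative ring identity.\<close>
    define A where "A = ?a unit_at Y"
    define C where "C = ?c unit_at Y"
    define BB where "BB = ?b unit_at Y"
    define AC where "AC = ?a (?c unit_at) Y"
    define AB where "AB = ?a (?b unit_at) Y"
    define CB where "CB = ?c (?b unit_at) Y"
    define CBA where "CBA = ?c (?b (?a unit_at)) Y"
    define BAC where "BAC = ?b (?a (?c unit_at)) Y"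
    define CBAC where "CBAC = ?c (?b (?a (?c unit_at))) Y"
    have e: "?c (?a unit_at) Y = AC" "?b (?a unit_at) Y = AB" "?b (?c unit_at) Y = CB"
      "?a (?b (?c unit_at)) Y = CBA" "?a (?b (?a (?c unit_at))) Y = CBAC"
      "?a (?b (?a unit_at)) Y = 0" "?c (?b (?c unit_at)) Y = 0" "?c (?a (?c unit_at)) Y = 0"
      "?a (?a unit_at) Y = 0" "?c (?c unit_at) Y = 0" "?a (?a (?c unit_at)) Y = 0"
      using comm[of unit_at] 1 2 3 4 5 6 7 ua_ua_same[of p unit_at] ua_ua_same[of "Suc (Suc p)" unit_at]
        ua_ua_same[of p "?c unit_at"]
      by (simp_all only: AC_def AB_def CB_def CBA_def CBAC_def)
    show "unit_at Y + x * ?c unit_at Y + y * (?a unit_at Y + x * ?a (?c unit_at) Y) +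
          (x + y) * (?b unit_at Y + x * ?b (?c unit_at) Y + y * (?b (?a unit_at) Y + x * ?b (?a (?c unit_at)) Y)) +
          (y - x) * (?c unit_at Y + x * ?c (?c unit_at) Y + y * (?c (?a unit_at) Y + x * ?c (?a (?c unit_at)) Y) +
          (x + y) * (?c (?b unit_at) Y + x * ?c (?b (?c unit_at)) Y +
             y * (?c (?b (?a unit_at)) Y + x * ?c (?b (?a (?c unit_at))) Y))) =
        unit_at Y + y * ?c unit_at Y + x * (?a unit_at Y + y * ?a (?c unit_at) Y) +
          (x + y) * (?b unit_at Y + y * ?b (?c unit_at) Y + x * (?b (?a unit_at) Y + y * ?b (?a (?c unit_at)) Y)) +
          (y - x) * (?a unit_at Y + y * ?a (?c unit_at) Y + x * (?a (?a unit_at) Y + y * ?a (?a (?c unit_at)) Y) +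
          (x + y) * (?a (?b unit_at) Y + y * ?a (?b (?c unit_at)) Y +
             x * (?a (?b (?a unit_at)) Y + y * ?a (?b (?a (?c unit_at))) Y)))"
      unfolding e A_def[symmetric] C_def[symmetric] BB_def[symmetric] AC_def[symmetric]
        AB_def[symmetric] CB_def[symmetric] CBA_def[symmetric] BAC_def[symmetric] CBAC_def[symmetric]
      by (simp add: algebra_simps)
  qed
qed

section \<open>Swapping variables in products of the operators\<close>

definition sw :: "nat \<Rightarrow> ((nat \<Rightarrow> nat) \<Rightarrow> ipoly) \<Rightarrow> (nat \<Rightarrow> nat) \<Rightarrow> ipoly" where
  "sw i F y = swap_vars i (F y)"

lemma sw_hh: "sw i (hh k z F) = hh k (swap_vars i z) (sw i F)"
  by (auto simp: sw_def hh_def ua_def)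

lemma sw_unit [simp]: "sw i unit_at = unit_at"
  by (auto simp: sw_def unit_at_def)

text \<open>The head of the list acts first, so it is the factor nearest to
  \<open>F\<close>.\<close>

definition hprod :: "(nat \<times> ipoly) list \<Rightarrow> ((nat \<Rightarrow> nat) \<Rightarrow> ipoly) \<Rightarrow> (nat \<Rightarrow> nat) \<Rightarrow> ipoly" where
  "hprod = fold (\<lambda>(k, z). hh k z)"

lemma hprod_simps [simp]:
  "hprod [] F = F" "hprod ((k, z) # L) F = hprod L (hh k z F)" "hprod (L @ L') F = hprod L' (hprod L F)"
  by (simp_all add: hprod_def)

lemma sw_hprod: "sw i (hprod L F) = hprod (map (apsnd (swap_vars i)) L) (sw i F)"
  by (induction L arbitrary: F) (auto simp: sw_hh)

lemma hh_hprod: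
  assumes "1 \<le> k" "\<forall>(l, w)\<in>set L. 1 \<le> l \<and> (Suc k < l \<or> Suc l < k)"
  shows "hh k z (hprod L F) = hprod L (hh k z F)"
  using assms(2)
proof (induction L arbitrary: F)
  case (Cons p L)
  obtain l w where p: "p = (l, w)" by (cases p)
  have "hh k z (hh l w F) = hh l w (hh k z F)" using Cons.prems assms(1) p by (intro hh_commute) auto
  then show ?case using Cons p by simp
qed simp

section \<open>A product formula for the involution Schubert polynomials\<close>

definition xx :: "nat \<Rightarrow> nat \<Rightarrow> ipoly" where
  "xx a b = (if a = b then X a else X a + X b)"

text \<open>The column of x_(c+1): the diagonal entry i = c + 1 gives the weight x_(c+1), a later i
  the weight x_(c+1) + x_i. The generators run from 2c + 1 to M, the last one available in
  S_(M+1).\<close>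

definition inv_col :: "nat \<Rightarrow> nat \<Rightarrow> (nat \<times> ipoly) list" where
  "inv_col M c = map (\<lambda>i. (i + c, xx (Suc c) i)) [Suc c..<Suc M - c]"

text \<open>Columns of high number act first, hence directly on the identity; those with 2c + 1 > M
  are empty.\<close>

definition inv_cols :: "nat \<Rightarrow> nat \<Rightarrow> (nat \<times> ipoly) list" where
  "inv_cols M c = concat (map (inv_col M) (rev [c..<M]))"

lemma inv_cols_rec: "c < M \<Longrightarrow> inv_cols M c = inv_cols M (Suc c) @ inv_col M c"
  by (simp add: inv_cols_def upt_conv_Cons)

lemma set_inv_cols:
  "(k, z) \<in> set (inv_cols M c) \<Longrightarrow> \<exists>c' i. c \<le> c' \<and> Suc c' \<le> i \<and> i \<le> M - c' \<and> k = i + c' \<and> z = xx (Suc c') i"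
  by (auto simp: inv_cols_def inv_col_def) force

lemma inv_cols_empty: "M < Suc (2 * c) \<Longrightarrow> inv_cols M c = []"
  by (auto simp: inv_cols_def inv_col_def concat_eq_Nil_conv)

lemma inv_cols_index: "(k, z) \<in> set (inv_cols M c) \<Longrightarrow> Suc (2 * c) \<le> k"
  by (drule set_inv_cols) auto

lemma swap_vars_xx_fixed: "a \<notin> {i, Suc i} \<Longrightarrow> b \<notin> {i, Suc i} \<Longrightarrow> swap_vars i (xx a b) = xx a b"
  by (simp add: xx_def transpose_def)

lemma map_swap_vars_fixed:
  assumes "\<And>k z. (k, z) \<in> set L \<Longrightarrow> swap_vars i z = z"
  shows "map (apsnd (swap_vars i)) L = L"
  using assms by (intro map_idI) auto

text \<open>Two adjacent columns exchange their variables x and y. The extra factor with parameter y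
  - x climbs the columns by one Yang-Baxter move per rung, until the last factor of the longer
  column absorbs it.\<close>

lemma hprod_ladder:
  assumes "s \<le> N" "1 \<le> s"
  shows "hprod (map (\<lambda>i. (i + c, y + X i)) [s..<Suc N])
      (hprod (map (\<lambda>i. (i + Suc c, x + X i)) [s..<N]) F)
    = hprod (map (\<lambda>i. (i + c, x + X i)) [s..<Suc N])
      (hprod (map (\<lambda>i. (i + Suc c, y + X i)) [s..<N]) (hh (s + c) (y - x) F))"
  using assms
proof (induction "N - s" arbitrary: s F)
  case 0
  then have "s = N" by simp
  then show ?case by (simp add: hh_hh_same)
next
  case (Suc n)
  define A where "A u = map (\<lambda>i. (i + Suc c, u + X i)) [Suc s..<N]" for u
  define B where "B u = map (\<lambda>i. (i + c, u + X i)) [Suc s..<Suc N]" for u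
  define k where "k = s + c"
  have k: "1 \<le> k" using Suc by (simp add: k_def)
  have l: "map (\<lambda>i. (i + c, u + X i)) [s..<Suc N] = (k, u + X s) # B u"
    "map (\<lambda>i. (i + Suc c, u + X i)) [s..<N] = (Suc k, u + X s) # A u" for u
    using Suc(2) by (simp_all add: A_def B_def k_def upt_conv_Cons)
  have IH: "hprod (B y) (hprod (A x) G) = hprod (B x) (hprod (A y) (hh (Suc k) (y - x) G))" for G
  proof -
    have "n = N - Suc s" "Suc s \<le> N" using Suc(2) by auto
    from Suc(1)[OF this] show ?thesis by (simp add: A_def B_def k_def del: upt_Suc)
  qed
  have comm: "hh k z (hprod (A u) G) = hprod (A u) (hh k z G)" for z u G
    using k by (intro hh_hprod) (auto simp: A_def k_def)
  have yb: "hh k (x + X s) (hh (Suc k) (y + X s) (hh k (y - x) F))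
      = hh (Suc k) (y - x) (hh k (y + X s) (hh (Suc k) (x + X s) F))"
    using hh_yang_baxter[OF k, of "x + X s" "y - x" F] by simp
  show ?case
    unfolding l k_def[symmetric] hprod_simps comm yb IH[symmetric] ..
qed

text \<open>Going from column c + 1 to column c lowers the generator of the extra factor from i + c
  + 1 to i + c. For c = 0 it is u_i, and the statement becomes the divided difference recursion. If
  i > c + 1, both variables are entries of column c and Yang-Baxter suffices; if i = c + 1, they are
  the labels of columns c and c + 1.\<close>

lemma sw_hprod_inv_cols:
  assumes "Suc c \<le> i"
  shows "(M < i + c \<longrightarrow> sw i (hprod (inv_cols M c) unit_at) = hprod (inv_cols M c) unit_at) \<and>
    (i + c \<le> M \<longrightarrow> sw i (hprod (inv_cols M c) unit_at)
      = hh (i + c) (X (Suc i) - X i) (hprod (inv_cols M c) unit_at))"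
  using assms
proof (induction "M - c" arbitrary: c i rule: less_induct)
  case less
  let ?U = "\<lambda>c. hprod (inv_cols M c) unit_at"
  \<comment> \<open>Neither variable occurs: the columns end before x_i, or they begin after
    x_(i+1).\<close>
  have fixed: "sw i (?U c') = ?U c'" if "M < i + c' \<or> Suc i \<le> c'" for c'
  proof -
    have "map (apsnd (swap_vars i)) (inv_cols M c') = inv_cols M c'"
    proof (rule map_swap_vars_fixed)
      fix k z assume "(k, z) \<in> set (inv_cols M c')"
      then obtain c'' j where "c' \<le> c''" "Suc c'' \<le> j" "j \<le> M - c''" "z = xx (Suc c'') j"
        using set_inv_cols by blast
      moreover from this have "Suc c'' \<notin> {i, Suc i}" "j \<notin> {i, Suc i}" using that by auto
      ultimately show "swap_vars i z = z" using swap_vars_xx_fixed by blast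
    qed
    then show ?thesis by (simp add: sw_hprod)
  qed
  show ?case
  proof (intro conjI impI)
    assume "M < i + c"
    then show "sw i (?U c) = ?U c" by (intro fixed) simp
  next
    assume M: "i + c \<le> M"
    then have c: "c < M" using less.prems by simp
    define d where "d = X (Suc i) - X i"
    define k where "k = i + c"
    have k: "1 \<le> k" using less.prems by (simp add: k_def)
    define H where "H = ?U (Suc c)"
    have UH: "?U c = hprod (inv_col M c) H" by (simp add: inv_cols_rec[OF c] H_def)
    show "sw i (?U c) = hh (i + c) (X (Suc i) - X i) (?U c)"
    proof (cases "i = Suc c")
      case False
      then have i: "Suc (Suc c) \<le> i" using less.prems by simp
      \<comment> \<open>The columns beyond c supply a factor at generator k + 1, provided that it
        still exists.\<close>
      have IH: "(M < Suc k \<longrightarrow> sw i H = H) \<and> (Suc k \<le> M \<longrightarrow> sw i H = hh (Suc k) d H)"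
        using less.hyps[of "Suc c" i] c i by (simp add: k_def d_def H_def)
      define I where "I = map (\<lambda>i. (i + c, xx (Suc c) i)) [Suc c..<i]"
      define a b where "a = X (Suc c) + X i" and "b = X (Suc c) + X (Suc i)"
      have ab: "xx (Suc c) i = a" "xx (Suc c) (Suc i) = b" "swap_vars i a = b" "swap_vars i b = a"
        using i by (auto simp: a_def b_def xx_def transpose_def)
      have sI: "map (apsnd (swap_vars i)) I = I"
        unfolding I_def using i by (intro map_swap_vars_fixed) (auto intro!: swap_vars_xx_fixed)
      show ?thesis
      proof (cases "k = M")
        case True
        then have "Suc M - c = Suc i" using c by (simp add: k_def)
        then have "[Suc c..<Suc M - c] = [Suc c..<i] @ [i]" using i by simp
        then have inv_col: "inv_col M c = I @ [(k, a)]" by (simp add: inv_col_def I_def ab k_def)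
        have "sw i (?U c) = hh k b (hprod I H)"
          using IH True by (simp add: UH inv_col sw_hprod sw_hh sI ab)
        also have "\<dots> = hh k d (?U c)"
          by (simp add: UH inv_col hh_hh_same a_def b_def d_def)
        finally show ?thesis by (simp add: k_def d_def)
      next
        case False
        then have kM: "Suc k \<le> M" using M by (simp add: k_def)
        define R where "R = map (\<lambda>i. (i + c, xx (Suc c) i)) [Suc (Suc i)..<Suc M - c]"
        have "[Suc c..<Suc M - c] = [Suc c..<i] @ i # Suc i # [Suc (Suc i)..<Suc M - c]"
          using kM i upt_add_eq_append[of "Suc c" i "Suc M - c - i"] by (simp add: k_def upt_conv_Cons)
        then have inv_col: "inv_col M c = I @ (k, a) # (Suc k, b) # R" by (simp add: inv_col_def I_def R_def ab k_def)
        have sR: "map (apsnd (swap_vars i)) R = R"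
          unfolding R_def using i by (intro map_swap_vars_fixed) (auto intro!: swap_vars_xx_fixed)
        let ?G = "hprod I H"
        have "sw i (?U c) = hprod R (hh (Suc k) a (hh k b (hprod I (sw i H))))"
          by (simp add: UH inv_col sw_hprod sw_hh sI sR ab)
        also have "hprod I (sw i H) = hh (Suc k) d ?G"
        proof -
          have "hh (Suc k) d ?G = hprod I (hh (Suc k) d H)"
            using i by (intro hh_hprod) (auto simp: I_def k_def)
          then show ?thesis using IH kM by simp
        qed
        \<comment> \<open>Yang-Baxter applies because b = a + d.\<close>
        also have "hh (Suc k) a (hh k b (hh (Suc k) d ?G)) = hh k d (hh (Suc k) b (hh k a ?G))"
          using hh_yang_baxter[OF k, of d a ?G] by (simp add: a_def b_def d_def)
        also have "hprod R (hh k d (hh (Suc k) b (hh k a ?G))) = hh k d (hprod R (hh (Suc k) b (hh k a ?G)))"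
          using k by (intro hh_hprod[symmetric]) (auto simp: R_def k_def)
        also have "\<dots> = hh k d (?U c)" by (simp add: UH inv_col)
        finally show ?thesis by (simp add: k_def d_def)
      qed
    next
      case True
      \<comment> \<open>Here x labels column c and y labels column c + 1. The generator k = 2c + 1
        is the lowest of column c, so everything hinges on the factors closest to the
        identity.\<close>
      define x y where "x = X i" and "y = X (Suc i)"
      have swap: "swap_vars i x = y" "swap_vars i y = x" by (simp_all add: x_def y_def)
      have kc: "k = Suc (2 * c)" using True by (simp add: k_def)
      have "k = M \<or> Suc k = M \<or> Suc (Suc k) \<le> M" using M unfolding k_def by linarith
      then consider "k = M" | "Suc k = M" | "Suc (Suc k) \<le> M" by blast
      then have "sw i (?U c) = hh k (y - x) (?U c)"
      proof cases
        case 1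
        then have e: "inv_cols M (Suc c) = []" by (intro inv_cols_empty) (simp add: kc)
        have "[Suc c..<Suc M - c] = [Suc c]" using 1 kc by (simp add: upt_conv_Cons)
        then have inv_col: "inv_col M c = [(k, x)]" using True by (simp add: inv_col_def xx_def x_def k_def)
        show ?thesis by (simp add: inv_cols_rec[OF c] e inv_col sw_hprod sw_hh swap hh_hh_same)
      next
        case 2
        then have e: "inv_cols M (Suc c) = []" by (intro inv_cols_empty) (simp add: kc)
        have "[Suc c..<Suc M - c] = [Suc c, Suc (Suc c)]" using 2 kc by (simp add: upt_conv_Cons)
        then have inv_col: "inv_col M c = [(k, x), (Suc k, x + y)]"
          using True by (simp add: inv_col_def xx_def x_def y_def k_def)
        show ?thesis using hh_unit_two[OF k, of x y]
          by (simp add: inv_cols_rec[OF c] e inv_col sw_hprod sw_hh swap add.commute)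
      next
        case 3
        let ?p1 = "Suc k" and ?p2 = "Suc (Suc k)"
        have c2: "Suc c < M" using 3 kc by simp
        define N where "N = M - c"
        define A where "A u = map (\<lambda>i. (i + Suc c, u + X i)) [Suc (Suc (Suc c))..<N]" for u
        define B where "B u = map (\<lambda>i. (i + c, u + X i)) [Suc (Suc (Suc c))..<Suc N]" for u
        have N: "Suc M - c = Suc N" "Suc M - Suc c = N" "Suc (Suc (Suc c)) \<le> N"
          using 3 kc by (auto simp: N_def)
        have "[Suc (Suc c)..<N] = Suc (Suc c) # [Suc (Suc (Suc c))..<N]" using N(3) by (simp add: upt_conv_Cons)
        then have col1: "inv_col M (Suc c) = (?p2, y) # A y"
          unfolding inv_col_def N(2) A_def using True by (auto simp: xx_def y_def k_def)
        have "[Suc c..<Suc N] = Suc c # Suc (Suc c) # [Suc (Suc (Suc c))..<Suc N]"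
          using N(3) by (simp add: upt_conv_Cons)
        then have col0: "inv_col M c = (k, x) # (?p1, x + y) # B x"
          unfolding inv_col_def N(1) B_def using True by (auto simp: xx_def x_def y_def k_def)
        have sA: "map (apsnd (swap_vars i)) (A y) = A x" "map (apsnd (swap_vars i)) (B x) = B y"
          unfolding A_def B_def using True swap by (auto simp: transpose_def)
        define G where "G = ?U (Suc (Suc c))"
        have sG: "sw i G = G" unfolding G_def using True by (intro fixed) simp
        have commA: "hh l z (hprod (A u) F) = hprod (A u) (hh l z F)" if "l = k \<or> l = ?p1" for l z u F
          using that k by (intro hh_hprod) (auto simp: A_def kc)
        have commB: "hh k z (hprod (B u) F) = hprod (B u) (hh k z F)" for z u F
          using k by (intro hh_hprod) (auto simp: B_def kc)
        have U: "?U c = hprod (B x) (hprod (A y) (hh ?p1 (x + y) (hh k x (hh ?p2 y G))))"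
          by (simp add: inv_cols_rec[OF c] inv_cols_rec[OF c2] col0 col1 G_def commA)
        have "sw i (?U c) = hprod (B y) (hprod (A x) (hh ?p1 (x + y) (hh k y (hh ?p2 x G))))"
          unfolding U by (simp only: sw_hprod sA sw_hh swap swap_vars_add sG add.commute)
        \<comment> \<open>The ladder restores the upper parts of both columns and leaves the factor
          y - x at generator k + 2, the left side of the reflection equation.\<close>
        also have "\<dots> = hprod (B x) (hprod (A y) (hh ?p2 (y - x) (hh ?p1 (x + y) (hh k y (hh ?p2 x G)))))"
          unfolding A_def B_def using N(3) by (subst hprod_ladder) (auto simp: kc mult_2)
        also have "hh ?p2 (y - x) (hh ?p1 (x + y) (hh k y (hh ?p2 x G)))
            = hh k (y - x) (hh ?p1 (x + y) (hh k x (hh ?p2 y G)))"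
        proof -
          \<comment> \<open>Later columns use generators from 2c + 5 = k + 4 on and commute with the
            four factors; thus the relation is applied directly at \<open>unit_at\<close>.\<close>
          have comm: "hh l z (hprod (inv_cols M (Suc (Suc c))) F) = hprod (inv_cols M (Suc (Suc c))) (hh l z F)"
            if "l = k \<or> l = ?p1 \<or> l = ?p2" for l z F
          proof (rule hh_hprod)
            show "1 \<le> l" using that k by auto
            show "\<forall>(l', w)\<in>set (inv_cols M (Suc (Suc c))). 1 \<le> l' \<and> (Suc l < l' \<or> Suc l' < l)"
              using inv_cols_index[of _ _ M "Suc (Suc c)"] that by (fastforce simp: kc)
          qed
          show ?thesis unfolding G_def using hh_unit_three[OF k, of y x] by (simp add: comm)
        qed
        also have "hprod (B x) (hprod (A y) (hh k (y - x) (hh ?p1 (x + y) (hh k x (hh ?p2 y G))))) = hh k (y - x) (?U c)"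
          unfolding U by (simp add: commA commB)
        finally show ?thesis .
      qed
      then show ?thesis by (simp add: k_def x_def y_def)
    qed
  qed
qed

definition hdeg :: "((nat \<Rightarrow> nat) \<Rightarrow> ipoly) \<Rightarrow> bool" where
  "hdeg F \<longleftrightarrow> (\<forall>y d. invol y \<and> hgt y = 2 * d \<longrightarrow> homog d (F y))"

lemma hdeg_unit: "hdeg unit_at"
  using homog.of_int[of 1] homog.zero by (auto simp: hdeg_def unit_at_def)

lemma homog_xx_mult: "homog d f \<Longrightarrow> 1 \<le> a \<Longrightarrow> 1 \<le> b \<Longrightarrow> homog (Suc d) (xx a b * f)"
  by (auto simp: xx_def distrib_right intro!: homog.add homog.X_mult)

text \<open>A used factor raises the height by 2 and brings one linear form, so the degree stays
  half the height.\<close>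

lemma hdeg_hh:
  assumes "hdeg F" "1 \<le> a" "1 \<le> b"
  shows "hdeg (hh k (xx a b) F)"
  unfolding hdeg_def
proof (intro allI impI, elim conjE)
  fix y d assume y: "invol y" "hgt y = 2 * d"
  have "homog d (xx a b * ua k F y)"
  proof (cases "1 \<le> k \<and> y (Suc k) < y k")
    case True
    note D = ds_descent[OF y(1), of k]
    have "hgt (ds k y) = 2 * (d - 1)" "d = Suc (d - 1)" using D(4) True y(2) by auto
    moreover have "homog (d - 1) (F (ds k y))"
      using assms(1) D(1) True calculation(1) by (auto simp: hdeg_def)
    ultimately show ?thesis using homog_xx_mult[OF _ assms(2,3), of "d - 1"] True y(1) by (simp add: ua_def)
  qed (auto simp: ua_def homog.zero)
  then show "homog d (hh k (xx a b) F y)"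
    using assms(1) y by (auto simp: hdeg_def hh_def intro: homog.add)
qed

lemma hdeg_inv_cols: "hdeg (hprod (inv_cols M c) unit_at)"
proof -
  have "hdeg (hprod L F)" if "hdeg F" "\<forall>(k, z)\<in>set L. \<exists>a b. 1 \<le> a \<and> 1 \<le> b \<and> z = xx a b" for L F
    using that
  proof (induction L arbitrary: F)
    case (Cons p L)
    then show ?case by (cases p) (auto intro!: Cons.IH hdeg_hh)
  qed simp
  moreover have "\<forall>(k, z)\<in>set (inv_cols M c). \<exists>a b. 1 \<le> a \<and> 1 \<le> b \<and> z = xx a b"
  proof clarify
    fix k z assume "(k, z) \<in> set (inv_cols M c)"
    then obtain c' i where "Suc c' \<le> i" "z = xx (Suc c') i" using set_inv_cols by blast
    then show "\<exists>a b. 1 \<le> a \<and> 1 \<le> b \<and> z = xx a b" by (intro exI[of _ "Suc c'"] exI[of _ i]) simp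
  qed
  ultimately show ?thesis using hdeg_unit by blast
qed

lemma hgt_even: "invol y \<Longrightarrow> \<exists>d. hgt y = 2 * d"
proof -
  assume "invol y"
  then obtain w where "w \<in> At y" using At_nonempty by blast
  then have "hgt y = 2 * inv_count w" by (simp add: At_def)
  then show ?thesis ..
qed

lemma hgt_pos:
  assumes "invol y" "y \<noteq> id"
  shows "0 < hgt y"
proof -
  obtain i where "1 \<le> i" "y (Suc i) < y i" using ex_descent invol_Sinf assms by blast
  then show ?thesis using ds_descent(4)[OF assms(1), of i] by simp
qed

lemma descent_bound:
  assumes "y permutes {1..m}" "y (Suc i) < y i"
  shows "Suc i \<le> m"
proof (rule ccontr)
  assume "\<not> Suc i \<le> m"
  then have s: "y (Suc i) = Suc i" by (intro permutes_not_in[OF assms(1)]) simp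
  show False
  proof (cases "i \<in> {1..m}")
    case True
    then have "y i \<in> {1..m}" using permutes_in_image[OF assms(1)] by blast
    then show False using s assms(2) \<open>\<not> Suc i \<le> m\<close> by simp
  next
    case False
    then have "y i = i" by (intro permutes_not_in[OF assms(1)])
    then show False using s assms(2) by simp
  qed
qed

lemma ds_permutes:
  assumes "y permutes {1..m}" "1 \<le> i" "y (Suc i) < y i"
  shows "ds i y permutes {1..m}"
proof -
  have "simple_refl i permutes {1..m}"
    using assms(2) descent_bound[OF assms(1,3)] by (rule simple_refl_permutes)
  then show ?thesis unfolding ds_def using assms(1) by (simp add: permutes_compose comp_assoc)
qed

lemma hprod_id: "hprod L F id = F id"
proof (induction L arbitrary: F)
  case (Cons p L)
  obtain k z where p: "p = (k, z)" by (cases p)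
  have "hh k z F id = F id" by (simp add: hh_def ua_def)
  have "hprod (p # L) F id = hprod L (hh k z F) id" by (simp only: p hprod_simps)
  also have "\<dots> = hh k z F id" by (rule Cons.IH)
  also have "\<dots> = F id" by fact
  finally show ?case .
qed simp

text \<open>Both sides satisfy the same divided difference recursion; their difference is thus
  symmetric in all variables and has no constant term.\<close>
theorem inv_schubert_eq_hprod:
  assumes "invol y" "y permutes {1..Suc M}"
  shows "inv_schubert y = hprod (inv_cols M 0) unit_at y"
  using assms
proof (induction "hgt y" arbitrary: y rule: less_induct)
  case less
  note y = less.prems
  let ?T = "hprod (inv_cols M 0) unit_at"
  show ?case
  proof (cases "y = id")
    case True
    have "?T id = 1" unfolding hprod_id by (simp add: unit_at_def)
    then show ?thesis unfolding True using inv_schubert_id by (simp only:)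
  next
    case False
    let ?f = "?T y - inv_schubert y"
    have "?f = 0"
    proof (rule symmetric_eq_0)
      obtain d where d: "hgt y = 2 * d" using hgt_even y(1) by blast
      have "0 < d" using hgt_pos[OF y(1) False] d by simp
      moreover have "homog d (?T y)" using hdeg_inv_cols y(1) d by (auto simp: hdeg_def)
      ultimately have "no_const (?T y)" using homog_no_const by blast
      then show "no_const ?f" using no_const_inv_schubert[OF y(1) False] by (intro no_const_diff)
    next
      fix i :: nat assume i: "1 \<le> i"
      have S: "swap_vars i (inv_schubert y) = inv_schubert y - (X i - X (Suc i)) * divdiff i (inv_schubert y)"
        unfolding divdiff_eq by simp
      show "swap_vars i ?f = ?f"
      proof (cases "i \<le> M")
        case True
        have "sw i ?T = hh i (X (Suc i) - X i) ?T" using sw_hprod_inv_cols[of 0 i M] i True by simp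
        then have "swap_vars i (?T y) = ?T y + (X (Suc i) - X i) * ua i ?T y"
          by (metis sw_def hh_def)
        moreover have "ua i ?T y = divdiff i (inv_schubert y)"
        proof (cases "y (Suc i) < y i")
          case d: True
          have "inv_schubert (ds i y) = ?T (ds i y)"
            using ds_descent[OF y(1) i d] ds_permutes[OF y(2) i d] by (intro less.hyps) auto
          then show ?thesis using d i y(1) divdiff_inv_schubert[OF y(1) i] by (simp add: ua_def)
        next
          case False
          then show ?thesis using divdiff_inv_schubert[OF y(1) i] by (simp add: ua_def)
        qed
        ultimately have T: "swap_vars i (?T y) = ?T y + (X (Suc i) - X i) * divdiff i (inv_schubert y)"
          by (simp only:)
        show ?thesis unfolding swap_vars_diff S T by (simp add: algebra_simps)
      next
        case False
        \<comment> \<open>No descent of y lies beyond M, so both polynomials are symmetric in x_i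
          and x_(i+1).\<close>
        then have "\<not> y (Suc i) < y i" using descent_bound[OF y(2), of i] by auto
        then have "swap_vars i (inv_schubert y) = inv_schubert y"
          using S divdiff_inv_schubert[OF y(1) i] by simp
        moreover have "sw i ?T = ?T" using sw_hprod_inv_cols[of 0 i M] i False by simp
        then have "swap_vars i (?T y) = ?T y" by (metis sw_def)
        ultimately show ?thesis by simp
      qed
    qed
    then show ?thesis by simp
  qed
qed

section \<open>The dominant case\<close>

text \<open>\<open>A\<close> lists the 2-cycles of y. Equality of involutions becomes equality of
  sets of pairs (\<open>is_match_unique\<close>), and conjugation becomes relabelling.\<close>

definition is_match :: "(nat \<times> nat) set \<Rightarrow> (nat \<Rightarrow> nat) \<Rightarrow> bool" where
  "is_match A y \<longleftrightarrow> (\<forall>(a, b)\<in>A. y a = b \<and> y b = a) \<and> (\<forall>p. (\<forall>(a, b)\<in>A. p \<noteq> a \<and> p \<noteq> b) \<longrightarrow> y p = p)"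

lemma is_match_fixed: "is_match A y \<Longrightarrow> (\<And>a b. (a, b) \<in> A \<Longrightarrow> p \<noteq> a \<and> p \<noteq> b) \<Longrightarrow> y p = p"
  unfolding is_match_def by blast

lemma is_match_pair: "is_match A y \<Longrightarrow> (a, b) \<in> A \<Longrightarrow> y a = b \<and> y b = a"
  by (force simp: is_match_def)

lemma is_match_unique:
  assumes "is_match A y" "is_match A z"
  shows "y = z"
proof
  fix p
  show "y p = z p"
  proof (cases "\<exists>a b. (a, b) \<in> A \<and> (p = a \<or> p = b)")
    case True
    then show ?thesis using is_match_pair[OF assms(1)] is_match_pair[OF assms(2)] by metis
  next
    case False
    then show ?thesis using is_match_fixed[OF assms(1)] is_match_fixed[OF assms(2)] by metis
  qed
qed

lemma is_match_involutive: "is_match A y \<Longrightarrow> y (y p) = p"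
proof -
  assume m: "is_match A y"
  show ?thesis
  proof (cases "\<exists>a b. (a, b) \<in> A \<and> (p = a \<or> p = b)")
    case True
    then show ?thesis using is_match_pair[OF m] by metis
  next
    case False
    then have "y p = p" using is_match_fixed[OF m] by metis
    then show ?thesis by simp
  qed
qed

lemma is_match_permutes:
  assumes "is_match A y" "\<And>a b. (a, b) \<in> A \<Longrightarrow> 1 \<le> a \<and> a \<le> m \<and> 1 \<le> b \<and> b \<le> m"
  shows "y permutes {1..m}"
proof -
  have "y p = p" if "p \<notin> {1..m}" for p
    using that assms(2) by (intro is_match_fixed[OF assms(1)]) force
  then show ?thesis using is_match_involutive[OF assms(1)] unfolding permutes_def by metis
qed

lemma is_match_invol:
  assumes "is_match A y" "\<And>a b. (a, b) \<in> A \<Longrightarrow> 1 \<le> a \<and> a \<le> m \<and> 1 \<le> b \<and> b \<le> m"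
  shows "invol y"
proof -
  have "y \<in> Sinf" using is_match_permutes[OF assms] by (rule SinfI)
  then show ?thesis using is_match_involutive[OF assms(1)] by (simp add: invol_def)
qed

lemma is_match_conj:
  assumes "is_match A y"
  shows "is_match (map_prod (simple_refl i) (simple_refl i) ` A) (simple_refl i \<circ> y \<circ> simple_refl i)"
  unfolding is_match_def
proof (intro conjI allI impI ballI)
  fix x assume "x \<in> map_prod (simple_refl i) (simple_refl i) ` A"
  then obtain a b where "(a, b) \<in> A" "x = (simple_refl i a, simple_refl i b)" by auto
  then show "case x of (a, b) \<Rightarrow> (simple_refl i \<circ> y \<circ> simple_refl i) a = b
      \<and> (simple_refl i \<circ> y \<circ> simple_refl i) b = a"
    using is_match_pair[OF assms] by auto
next
  fix p assume p: "\<forall>(a, b)\<in>map_prod (simple_refl i) (simple_refl i) ` A. p \<noteq> a \<and> p \<noteq> b"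
  have "y (simple_refl i p) = simple_refl i p"
  proof (rule is_match_fixed[OF assms])
    fix a b assume "(a, b) \<in> A"
    then have "p \<noteq> simple_refl i a \<and> p \<noteq> simple_refl i b" using p by force
    then show "simple_refl i p \<noteq> a \<and> simple_refl i p \<noteq> b" by auto
  qed
  then show "(simple_refl i \<circ> y \<circ> simple_refl i) p = p" by simp
qed

lemma is_match_remove:
  assumes m: "is_match A y" and a: "(a, Suc a) \<in> A" "(Suc a, a) \<notin> A"
  shows "is_match (A - {(a, Suc a)}) (y \<circ> simple_refl a)"
  unfolding is_match_def
proof (intro conjI allI impI ballI)
  fix x assume x: "x \<in> A - {(a, Suc a)}"
  obtain p q where pq: "x = (p, q)" by (cases x)
  note P = is_match_pair[OF m, of p q] is_match_pair[OF m a(1)]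
  have "p \<noteq> a" "p \<noteq> Suc a" "q \<noteq> a" "q \<noteq> Suc a" using P x pq a by auto
  then show "case x of (p, q) \<Rightarrow> (y \<circ> simple_refl a) p = q \<and> (y \<circ> simple_refl a) q = p"
    using P x pq by simp
next
  fix p assume p: "\<forall>(b, c)\<in>A - {(a, Suc a)}. p \<noteq> b \<and> p \<noteq> c"
  show "(y \<circ> simple_refl a) p = p"
  proof (cases "p = a \<or> p = Suc a")
    case True
    then show ?thesis using is_match_pair[OF m a(1)] by auto
  next
    case False
    then have "y p = p" using p by (intro is_match_fixed[OF m]) blast
    then show ?thesis using False by simp
  qed
qed

lemma hh_neq_0D: "hh k z G y \<noteq> 0 \<Longrightarrow> G y \<noteq> 0 \<or> invol y \<and> 1 \<le> k \<and> y (Suc k) < y k \<and> G (ds k y) \<noteq> 0"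
  using ua_neq_0D[of k G y] by (auto simp: hh_def)

lemma hprod_support_fixed:
  assumes "\<forall>(k, z)\<in>set L. m < k" "\<And>y p. F y \<noteq> 0 \<Longrightarrow> p \<le> m \<Longrightarrow> y p = p"
    "hprod L F y \<noteq> 0" "p \<le> m"
  shows "y p = p"
  using assms
proof (induction L arbitrary: F)
  case (Cons q L)
  obtain k z where q: "q = (k, z)" by (cases q)
  show ?case
  proof (rule Cons.IH[of "hh k z F"])
    fix y p assume y: "hh k z F y \<noteq> 0" and p: "p \<le> m"
    have "m < k" using Cons.prems(1) q by simp
    have "F y \<noteq> 0 \<or> F (ds k y) \<noteq> 0" using hh_neq_0D[OF y] by blast
    then consider "y p = p" | "ds k y p = p" using Cons.prems(2) p by blast
    then show "y p = p"
    proof cases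
      case 2
      then show ?thesis using \<open>m < k\<close> p
        by (auto simp: ds_def transpose_def split: if_splits)
    qed
  qed (use Cons.prems q in auto)
qed simp

lemma hprod_no_descent:
  assumes "\<forall>(k, z)\<in>set L. \<not> y (Suc k) < y k"
  shows "hprod L F y = F y"
  using assms
proof (induction L rule: rev_induct)
  case (snoc q L)
  obtain k z where q: "q = (k, z)" by (cases q)
  have "hh k z (hprod L F) y = hprod L F y" using snoc.prems q by (simp add: hh_def ua_def)
  then show ?case using snoc q by simp
qed simp

text \<open>The factor at a can create the 2-cycle (a, a+1), and every later factor moves the
  partner of a up by at most one.\<close>

lemma column_support:
  assumes "a \<le> c" "\<And>y. F y \<noteq> 0 \<Longrightarrow> y a = a \<and> y (Suc a) = Suc a"
    "hprod (map (\<lambda>k. (k, z k)) [a..<c]) F y \<noteq> 0"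
  shows "y a \<le> c"
  using assms
proof (induction "c - a" arbitrary: c y)
  case 0
  then have "c = a" "F y \<noteq> 0" by simp_all
  then show ?case using 0(3)[of y] by simp
next
  case (Suc d)
  then obtain e where c: "c = Suc e" "a \<le> e" by (cases c) auto
  let ?G = "hprod (map (\<lambda>k. (k, z k)) [a..<e]) F"
  have IH: "y a \<le> e" if "?G y \<noteq> 0" for y using Suc(1)[of e y] Suc(2,4) c that by auto
  have "hh e (z e) ?G y \<noteq> 0" using Suc.prems(3) c by simp
  then consider "?G y \<noteq> 0" | "invol y" "?G (ds e y) \<noteq> 0" using hh_neq_0D by blast
  then show ?case
  proof cases
    case 1
    then show ?thesis using IH[OF 1] c by simp
  next
    case 2
    show ?thesis
    proof (cases "e = a")
      case True
      then have "ds a y a = a" "ds a y (Suc a) = Suc a" using 2(2) Suc.prems(2) by auto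
      then show ?thesis using c True by (auto simp: ds_def transpose_def split: if_splits)
    next
      case False
      have "ds e y a \<le> e" using IH[OF 2(2)] .
      then show ?thesis using c False by (auto simp: ds_def transpose_def split: if_splits)
    qed
  qed
qed

text \<open>The product s_(a+1) ... s_(b-1), which relabels points when the factors of a column are
  undone from the top.\<close>

definition cyc :: "nat \<Rightarrow> nat \<Rightarrow> nat \<Rightarrow> nat" where
  "cyc a b k = (if k = b then Suc a else if a < k \<and> k < b then Suc k else k)"

text \<open>To bring the partner of a from a + 1 up to b no factor may be skipped, so a single term
  survives. Undoing the factors conjugates y by the cycle \<open>cyc a b\<close> and finally deletes
  the 2-cycle (a, a+1).\<close>

lemma column_extract:
  assumes "a < b" "invol y" "1 \<le> a" "y a = b" "\<And>p. p < a \<Longrightarrow> y p = p"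
    and F: "\<And>y. F y \<noteq> 0 \<Longrightarrow> y a = a \<and> y (Suc a) = Suc a"
    and A: "is_match A y" "(a, b) \<in> A" "(b, a) \<notin> A"
  shows "\<exists>y'. invol y' \<and> is_match (map_prod (cyc a b) (cyc a b) ` A - {(a, Suc a)}) y' \<and>
    hprod (map (\<lambda>k. (k, z k)) [a..<b]) F y = (\<Prod>k = a..<b. z k) * F y'"
  using assms(1-5) A
proof (induction "b - Suc a" arbitrary: b y A)
  case 0
  then have b: "b = Suc a" by simp
  have d: "y (Suc a) < y a" using 0 b invol_invol[OF 0(3), of a] by simp
  have dy: "ds a y = y \<circ> simple_refl a" using 0 b by (simp add: ds_def)
  have "F y = 0" using F[of y] 0 b by auto
  then have "hprod (map (\<lambda>k. (k, z k)) [a..<b]) F y = (\<Prod>k = a..<b. z k) * F (ds a y)"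
    using b d 0 by (simp add: hh_def ua_def)
  moreover have "invol (ds a y)" using ds_descent d 0 by blast
  moreover have "is_match (map_prod (cyc a b) (cyc a b) ` A - {(a, Suc a)}) (ds a y)"
  proof -
    have "cyc a b = id" by (auto simp: cyc_def b)
    then have "map_prod (cyc a b) (cyc a b) ` A = A" by (simp add: map_prod.id)
    then show ?thesis unfolding dy using is_match_remove 0 b by metis
  qed
  ultimately show ?case by blast
next
  case (Suc d)
  then obtain e where b: "b = Suc e" "a < e" by (cases b) auto
  let ?L = "\<lambda>e. hprod (map (\<lambda>k. (k, z k)) [a..<e]) F"
  have yb: "y b = a" using invol_invol[OF Suc(4), of a] Suc.prems by simp
  have ye: "y e \<noteq> e + 1" using yb b invol_eq_iff[OF Suc(4), of e b] by auto
  have "\<not> y e < a"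
  proof
    assume "y e < a"
    then have "y (y e) = y e" by (rule Suc.prems(5))
    then show False using invol_invol[OF Suc(4), of e] \<open>y e < a\<close> b by simp
  qed
  moreover have "y e \<noteq> a" using invol_eq_iff[OF Suc(4), of e a] Suc.prems(4) b by auto
  ultimately have d: "y (Suc e) < y e" using yb b by simp
  have dy: "ds e y = simple_refl e \<circ> y \<circ> simple_refl e" using ye by (simp add: ds_def)
  \<comment> \<open>If the factor at e were skipped, the remaining ones could move a no farther than
    e, but y sends it to e + 1.\<close>
  have zero: "?L e y = 0"
  proof (rule ccontr)
    assume "?L e y \<noteq> 0"
    have "y a \<le> e" by (rule column_support[OF _ F \<open>?L e y \<noteq> 0\<close>]) (use b in auto)
    then show False using Suc.prems(4) b by simp
  qed
  have "hprod (map (\<lambda>k. (k, z k)) [a..<b]) F y = hh e (z e) (?L e) y"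
    using b by simp
  also have "\<dots> = z e * ?L e (ds e y)" using zero d Suc.prems b by (simp add: hh_def ua_def)
  finally have eq: "hprod (map (\<lambda>k. (k, z k)) [a..<b]) F y = z e * ?L e (ds e y)" .
  let ?A = "map_prod (simple_refl e) (simple_refl e) ` A"
  have "\<exists>y'. invol y' \<and> is_match (map_prod (cyc a e) (cyc a e) ` ?A - {(a, Suc a)}) y' \<and>
    ?L e (ds e y) = (\<Prod>k = a..<e. z k) * F y'"
  proof (rule Suc(1))
    show "d = e - Suc a" using Suc(2) b by simp
    show "invol (ds e y)" using ds_descent(1)[OF Suc(4) _ d] b by simp
    show "ds e y a = e" unfolding dy using Suc.prems b by simp
    show "ds e y p = p" if "p < a" for p unfolding dy using that Suc.prems(5) b by simp
    show "is_match ?A (ds e y)" unfolding dy using Suc.prems(6) by (rule is_match_conj)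
    show "(a, e) \<in> ?A" using Suc.prems(7) b by (intro image_eqI[of _ _ "(a, b)"]) auto
    show "(e, a) \<notin> ?A"
    proof
      assume "(e, a) \<in> ?A"
      then obtain p q where pq: "(p, q) \<in> A" "e = simple_refl e p" "a = simple_refl e q" by auto
      have "simple_refl e e = p" unfolding pq(2)[symmetric] by (metis pq(2) transpose_involutory)
      moreover have "simple_refl e a = q" by (metis pq(3) transpose_involutory)
      ultimately have "p = b" "q = a" using b by auto
      then show False using pq(1) Suc.prems(8) by simp
    qed
  qed (use b Suc.prems in auto)
  moreover have "cyc a e \<circ> simple_refl e = cyc a b"
    using b by (auto simp: cyc_def fun_eq_iff transpose_def)
  then have "map_prod (cyc a e) (cyc a e) ` ?A = map_prod (cyc a b) (cyc a b) ` A"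
    by (simp add: image_comp map_prod.comp)
  moreover have "(\<Prod>k = a..<b. z k) = (\<Prod>k = a..<e. z k) * z e" using b by simp
  ultimately show ?case unfolding eq by (auto simp: mult_ac)
qed

text \<open>Column c is responsible for the 2-cycle of t = c + 1. Before it is treated, the first c
  cycles have been removed and each remaining left end has moved up by c; extracting (2c+1, n+c+1)
  restores this shape for c + 1. The value of M reflects that y starts out in S_(n+r).\<close>

lemma dominant_coefficient:
  assumes "c \<le> r" "r \<le> n" "1 \<le> r" "M = n + r - 1"
    "invol y" "is_match {(t + c, n + t) |t. c < t \<and> t \<le> r} y"
  shows "hprod (inv_cols M c) unit_at y = (\<Prod>c' = c..<r. \<Prod>i = Suc c'..<Suc n. xx (Suc c') i)"
  using assms
proof (induction "r - c" arbitrary: c y)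
  case 0
  then have "c = r" by simp
  then have e: "{(t + c, n + t) |t. c < t \<and> t \<le> r} = {}" by auto
  have "is_match {} y" using 0(7) by (simp only: e)
  moreover have "is_match {} id" by (simp add: is_match_def)
  ultimately have "y = id" by (rule is_match_unique)
  then have "hprod (inv_cols M c) unit_at y = unit_at id" by (simp only: hprod_id)
  also have "\<dots> = 1" by (simp add: unit_at_def)
  finally show ?case using \<open>c = r\<close> by simp
next
  case (Suc d)
  note m = Suc.prems(6)
  let ?A = "{(t + c, n + t) |t. c < t \<and> t \<le> r}"
  have c: "c < r" "c < M" using Suc by auto
  define F where "F = hprod (inv_cols M (Suc c)) unit_at"
  define a where "a = Suc (2 * c)"
  define b where "b = Suc n + c"
  have "a < b" using c Suc.prems(2) by (simp add: a_def b_def)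
  \<comment> \<open>The factors with i > n act at ascents of y and contribute nothing; those with i
    \<le> n have the generators a, ..., b - 1 and are all used.\<close>
  let ?R = "map (\<lambda>i. (i + c, xx (Suc c) i)) [Suc n..<Suc M - c]"
  have "[Suc c..<Suc n + k] = [Suc c..<Suc n] @ [Suc n..<Suc n + k]" for k
    using c Suc.prems by (intro upt_add_eq_append) simp
  moreover have "Suc M - c = Suc n + (M - c - n)" using c Suc.prems by simp
  ultimately have "[Suc c..<Suc M - c] = [Suc c..<Suc n] @ [Suc n..<Suc M - c]" by (simp only:)
  moreover have "map (\<lambda>i. (i + c, xx (Suc c) i)) [Suc c..<Suc n] = map (\<lambda>k. (k, xx (Suc c) (k - c))) [a..<b]"
    by (rule nth_equalityI) (auto simp: a_def b_def nth_append simp del: upt_Suc)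
  ultimately have E1: "hprod (inv_cols M c) unit_at
      = hprod ?R (hprod (map (\<lambda>k. (k, xx (Suc c) (k - c))) [a..<b]) F)"
    by (simp add: inv_cols_rec[OF c(2)] F_def inv_col_def del: upt_Suc)
  have E2: "hprod ?R G y = G y" for G
  proof (rule hprod_no_descent, clarify)
    fix k z assume "(k, z) \<in> set ?R" and d: "y (Suc k) < y k"
    then have k: "n + Suc c \<le> k" by auto
    have f: "y p = p" if "n + r < p" for p
      using that Suc.prems(1,2) by (intro is_match_fixed[OF m]) auto
    have g: "y p = p - n + c" if "n + c < p" "p \<le> n + r" for p
    proof -
      have "(p - n + c, p) \<in> ?A" using that by (intro CollectI exI[of _ "p - n"]) auto
      then show ?thesis using is_match_pair[OF m] by blast
    qed
    have "y k \<le> k"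
    proof (cases "k \<le> n + r")
      case True
      then have "y k = k - n + c" using g k by simp
      then show ?thesis using k c(1) Suc.prems(2) by linarith
    qed (simp add: f)
    show False
    proof (cases "Suc k \<le> n + r")
      case True
      then have "y k = k - n + c" "y (Suc k) = Suc k - n + c" using g k by simp_all
      then show False using d k by linarith
    next
      case False
      then have "y (Suc k) = Suc k" using f by simp
      then show False using d \<open>y k \<le> k\<close> by linarith
    qed
  qed
  have "\<exists>y'. invol y' \<and> is_match (map_prod (cyc a b) (cyc a b) ` ?A - {(a, Suc a)}) y' \<and>
    hprod (map (\<lambda>k. (k, xx (Suc c) (k - c))) [a..<b]) F y = (\<Prod>k = a..<b. xx (Suc c) (k - c)) * F y'"
  proof (rule column_extract)
    show "(a, b) \<in> ?A" using c by (auto simp: a_def b_def intro!: exI[of _ "Suc c"])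
    then show "y a = b" using is_match_pair[OF m] by blast
    show "(b, a) \<notin> ?A" using c Suc.prems(2) by (auto simp: a_def b_def)
    show "y p = p" if "p < a" for p
      using that c Suc.prems(2) by (intro is_match_fixed[OF m]) (auto simp: a_def)
    show "y a = a \<and> y (Suc a) = Suc a" if "F y \<noteq> 0" for y
    proof -
      \<comment> \<open>Later columns use generators from 2c + 3 on, so they cannot move a or a + 1
        = 2c + 2.\<close>
      have *: "y p = p" if "p \<le> 2 * Suc c" for p
      proof (rule hprod_support_fixed[of "inv_cols M (Suc c)" "2 * Suc c" unit_at])
        show "\<forall>(k, z)\<in>set (inv_cols M (Suc c)). 2 * Suc c < k"
          using inv_cols_index[of _ _ M "Suc c"] by fastforce
      qed (use \<open>F y \<noteq> 0\<close> that in \<open>auto simp: F_def unit_at_def split: if_splits\<close>)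
      show ?thesis using *[of a] *[of "Suc a"] by (simp add: a_def)
    qed
    show "1 \<le> a" by (simp add: a_def)
  qed (rule \<open>a < b\<close> Suc.prems(5) m)+
  then obtain y' where y': "invol y'" "is_match (map_prod (cyc a b) (cyc a b) ` ?A - {(a, Suc a)}) y'"
    "hprod (map (\<lambda>k. (k, xx (Suc c) (k - c))) [a..<b]) F y = (\<Prod>k = a..<b. xx (Suc c) (k - c)) * F y'"
    by blast
  \<comment> \<open>The pair of t = c + 1 becomes (a, a+1), which is then deleted. In the others the
    left end lies strictly between a and b and moves up, while the right end exceeds b and
    stays.\<close>
  have cy: "map_prod (cyc a b) (cyc a b) (t + c, n + t)
      = (if t = Suc c then (a, Suc a) else (t + Suc c, n + t))" if "c < t" "t \<le> r" for t
    using that Suc.prems(2) by (auto simp: cyc_def a_def b_def)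
  have "map_prod (cyc a b) (cyc a b) ` ?A - {(a, Suc a)} = {(t + Suc c, n + t) |t. Suc c < t \<and> t \<le> r}"
  proof (intro equalityI subsetI)
    fix x assume x: "x \<in> map_prod (cyc a b) (cyc a b) ` ?A - {(a, Suc a)}"
    obtain q where q: "x = map_prod (cyc a b) (cyc a b) q" "q \<in> ?A" by (rule imageE[OF DiffD1[OF x]])
    obtain t where "q = (t + c, n + t)" "c < t" "t \<le> r" using q(2) by blast
    moreover have "x \<noteq> (a, Suc a)" using DiffD2[OF x] by blast
    ultimately have t: "c < t" "t \<le> r" "x = map_prod (cyc a b) (cyc a b) (t + c, n + t)" "x \<noteq> (a, Suc a)"
      using q(1) by (simp_all only: not_False_eq_True)
    then show "x \<in> {(t + Suc c, n + t) |t. Suc c < t \<and> t \<le> r}" using t(1,2,4) unfolding t(3) cy[OF t(1,2)]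
      by (cases "t = Suc c") auto
  next
    fix x assume "x \<in> {(t + Suc c, n + t) |t. Suc c < t \<and> t \<le> r}"
    then obtain t where t: "x = (t + Suc c, n + t)" "Suc c < t" "t \<le> r" by blast
    then have "x = map_prod (cyc a b) (cyc a b) (t + c, n + t)" using cy[of t] by simp
    moreover have "(t + c, n + t) \<in> ?A" using t by auto
    moreover have "x \<noteq> (a, Suc a)" using t by (simp add: a_def)
    ultimately show "x \<in> map_prod (cyc a b) (cyc a b) ` ?A - {(a, Suc a)}" by blast
  qed
  then have "is_match {(t + Suc c, n + t) |t. Suc c < t \<and> t \<le> r} y'" using y'(2) by simp
  then have E3: "F y' = (\<Prod>c' = Suc c..<r. \<Prod>i = Suc c'..<Suc n. xx (Suc c') i)"
    unfolding F_def using Suc(2) Suc.prems y'(1) c by (intro Suc(1)) auto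
  have E4: "(\<Prod>k = a..<b. xx (Suc c) (k - c)) = (\<Prod>i = Suc c..<Suc n. xx (Suc c) i)"
    by (rule prod.reindex_bij_witness[where i = "\<lambda>i. i + c" and j = "\<lambda>k. k - c"]) (auto simp: a_def b_def)
  have E5: "(\<Prod>c' = c..<r. \<Prod>i = Suc c'..<Suc n. xx (Suc c') i)
      = (\<Prod>i = Suc c..<Suc n. xx (Suc c) i) * (\<Prod>c' = Suc c..<r. \<Prod>i = Suc c'..<Suc n. xx (Suc c') i)"
    using c(1) by (rule prod.atLeast_Suc_lessThan)
  have "hprod (inv_cols M c) unit_at y = (\<Prod>k = a..<b. xx (Suc c) (k - c)) * F y'"
    unfolding E1 E2 by (rule y'(3))
  then show ?case unfolding E3 E4 E5 .
qed

section \<open>The involutions of increasing sequences and their divided differences\<close>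

lemma grass_inv_is_match:
  assumes "distinct \<psi>" "\<forall>x\<in>set \<psi>. x \<le> n"
  shows "is_match {(\<psi> ! k, n + k + 1) |k. k < length \<psi>} (grass_inv \<psi> n)"
proof -
  let ?f = "\<lambda>j u. transpose (\<psi> ! j) (n + j + 1) \<circ> u"
  have "is_match {(\<psi> ! k, n + k + 1) |k. j \<le> k \<and> k < length \<psi>} (foldr ?f [j..<length \<psi>] id)"
    if "j \<le> length \<psi>" for j
    using that
  proof (induction "length \<psi> - j" arbitrary: j)
    case 0
    then have e: "{(\<psi> ! k, n + k + 1) |k. j \<le> k \<and> k < length \<psi>} = {}" "[j..<length \<psi>] = []" by auto
    have "foldr ?f [] id = id" by (subst foldr.simps) (rule id_apply)
    moreover have "is_match {} id" by (simp add: is_match_def)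
    ultimately show ?case unfolding e by metis
  next
    case (Suc d)
    let ?A = "\<lambda>j. {(\<psi> ! k, n + k + 1) |k. j \<le> k \<and> k < length \<psi>}"
    let ?u = "foldr ?f [Suc j..<length \<psi>] id"
    let ?t = "transpose (\<psi> ! j) (n + j + 1)"
    have IH: "is_match (?A (Suc j)) ?u" using Suc by auto
    have j: "j < length \<psi>" using Suc by simp
    have ne: "\<psi> ! j \<noteq> n + k + 1" if "k < length \<psi>" for k
      using assms(2) nth_mem[OF j] by fastforce
    have ne': "\<psi> ! k \<noteq> n + j + 1" if "k < length \<psi>" for k
      using assms(2) nth_mem[OF that] by fastforce
    have f: "?u (\<psi> ! j) = \<psi> ! j" "?u (n + j + 1) = n + j + 1"
    proof -
      have *: "\<psi> ! j \<noteq> a \<and> \<psi> ! j \<noteq> b" "n + j + 1 \<noteq> a \<and> n + j + 1 \<noteq> b" if ab: "(a, b) \<in> ?A (Suc j)" for a b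
      proof -
        obtain k where k: "a = \<psi> ! k" "b = n + k + 1" "Suc j \<le> k" "k < length \<psi>" using ab by blast
        then show "\<psi> ! j \<noteq> a \<and> \<psi> ! j \<noteq> b" using ne[of k] assms(1) j by (auto simp: nth_eq_iff_index_eq)
        show "n + j + 1 \<noteq> a \<and> n + j + 1 \<noteq> b" using k ne'[of k] by auto
      qed
      show "?u (\<psi> ! j) = \<psi> ! j" using *(1) by (rule is_match_fixed[OF IH])
      show "?u (n + j + 1) = n + j + 1" using *(2) by (rule is_match_fixed[OF IH])
    qed
    have "is_match (?A j) (?t \<circ> ?u)"
      unfolding is_match_def
    proof (intro conjI allI impI ballI)
      fix x assume "x \<in> ?A j"
      then obtain k where k: "j \<le> k" "k < length \<psi>" "x = (\<psi> ! k, n + k + 1)" by blast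
      show "case x of (a, b) \<Rightarrow> (?t \<circ> ?u) a = b \<and> (?t \<circ> ?u) b = a"
      proof (cases "k = j")
        case True
        then show ?thesis using f k by simp
      next
        case False
        then have "?u (\<psi> ! k) = n + k + 1 \<and> ?u (n + k + 1) = \<psi> ! k"
          using k by (intro is_match_pair[OF IH]) auto
        moreover have "\<psi> ! k \<noteq> \<psi> ! j" using assms(1) False k j by (simp add: nth_eq_iff_index_eq)
        ultimately show ?thesis using False k ne[of k] ne'[of k] by simp
      qed
    next
      fix p assume p: "\<forall>(a, b)\<in>?A j. p \<noteq> a \<and> p \<noteq> b"
      then have "p \<noteq> \<psi> ! j" "p \<noteq> n + j + 1" using j by auto
      moreover have "?u p = p"
      proof (rule is_match_fixed[OF IH])
        fix a b assume "(a, b) \<in> ?A (Suc j)"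
        then have "(a, b) \<in> ?A j" using Suc_leD by blast
        then show "p \<noteq> a \<and> p \<noteq> b" using p by blast
      qed
      ultimately show "(?t \<circ> ?u) p = p" by simp
    qed
    moreover have "foldr ?f [j..<length \<psi>] id = ?t \<circ> ?u" using j by (simp add: upt_conv_Cons)
    ultimately show ?case by (simp only:)
  qed
  from this[of 0] show ?thesis by (simp add: grass_inv_def)
qed

lemma grass_inv_invol:
  assumes "distinct \<psi>" "\<forall>x\<in>set \<psi>. 1 \<le> x \<and> x \<le> n"
  shows "grass_inv \<psi> n permutes {1..n + length \<psi>}" "invol (grass_inv \<psi> n)"
proof -
  have m: "is_match {(\<psi> ! k, n + k + 1) |k. k < length \<psi>} (grass_inv \<psi> n)"
    using assms by (intro grass_inv_is_match) auto
  have b: "1 \<le> a \<and> a \<le> n + length \<psi> \<and> 1 \<le> b \<and> b \<le> n + length \<psi>"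
    if "(a, b) \<in> {(\<psi> ! k, n + k + 1) |k. k < length \<psi>}" for a b
    using that assms(2) by (auto intro: nth_mem simp: trans_le_add1)
  show "grass_inv \<psi> n permutes {1..n + length \<psi>}" using m b by (rule is_match_permutes)
  show "invol (grass_inv \<psi> n)" using m b by (rule is_match_invol)
qed

lemma inv_schubert_dominant:
  assumes "r \<le> n"
  shows "inv_schubert (grass_inv [1..<Suc r] n) = (\<Prod>c = 0..<r. \<Prod>i = Suc c..<Suc n. xx (Suc c) i)"
proof (cases "r = 0")
  case True
  then show ?thesis using inv_schubert_id by (simp add: grass_inv_def)
next
  case False
  let ?y = "grass_inv [1..<Suc r] n" and ?M = "n + r - 1"
  have p: "?y permutes {1..n + r}" "invol ?y"
    using grass_inv_invol[of "[1..<Suc r]" n] assms by (simp_all add: less_Suc_eq_le del: upt_Suc)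
  have "is_match {([1..<Suc r] ! k, n + k + 1) |k. k < length [1..<Suc r]} ?y"
    using assms by (intro grass_inv_is_match) auto
  moreover have "{([1..<Suc r] ! k, n + k + 1) |k. k < length [1..<Suc r]} = {(t + 0, n + t) |t. 0 < t \<and> t \<le> r}"
    (is "?A = ?B")
  proof (intro equalityI subsetI)
    fix x assume "x \<in> ?A"
    then obtain k where "k < r" "x = (Suc k, n + k + 1)" by (auto simp del: upt_Suc)
    then show "x \<in> ?B" by (intro CollectI exI[of _ "Suc k"]) auto
  next
    fix x assume "x \<in> ?B"
    then obtain t where "0 < t" "t \<le> r" "x = (t, n + t)" by auto
    then show "x \<in> ?A" by (intro CollectI exI[of _ "t - 1"]) (auto simp del: upt_Suc)
  qed
  ultimately have "hprod (inv_cols ?M 0) unit_at ?y = (\<Prod>c' = 0..<r. \<Prod>i = Suc c'..<Suc n. xx (Suc c') i)"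
    using p(2) False assms by (intro dominant_coefficient) auto
  moreover have "inv_schubert ?y = hprod (inv_cols ?M 0) unit_at ?y"
    using p False by (intro inv_schubert_eq_hprod) auto
  ultimately show ?thesis by simp
qed

text \<open>The entry a is sent above n and a + 1 is fixed, so a is a descent whose removal is
  conjugation by s_a; this replaces the entry a by a + 1 and touches no other.\<close>

lemma divdiff_inv_schubert_grass:
  assumes d: "distinct (as @ a # bs)" and r: "\<forall>x\<in>set (as @ a # bs). 1 \<le> x \<and> x \<le> n"
    and a: "Suc a \<le> n" "Suc a \<notin> set (as @ bs)"
  shows "divdiff a (inv_schubert (grass_inv (as @ a # bs) n)) = inv_schubert (grass_inv (as @ Suc a # bs) n)"
proof -
  let ?p = "as @ a # bs" and ?q = "as @ Suc a # bs"
  let ?y = "grass_inv ?p n"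
  let ?A = "\<lambda>\<psi>. {(\<psi> ! k, n + k + 1) |k. k < length \<psi>}"
  have m: "is_match (?A ?p) ?y" using d r by (intro grass_inv_is_match) auto
  have "(?p ! length as, n + length as + 1) \<in> ?A ?p" by force
  then have ya: "?y a = n + length as + 1" using is_match_pair[OF m] by fastforce
  have "?y (Suc a) = Suc a"
  proof (rule is_match_fixed[OF m])
    fix b c assume "(b, c) \<in> ?A ?p"
    then obtain k where k: "b = ?p ! k" "c = n + k + 1" "k < length ?p" by blast
    then have "b \<in> set ?p" "n < c" using nth_mem[of k ?p] by (simp_all only:)
    then show "Suc a \<noteq> b \<and> Suc a \<noteq> c" using a by auto
  qed
  then have desc: "?y (Suc a) < ?y a" using ya a by simp
  have dy: "ds a ?y = simple_refl a \<circ> ?y \<circ> simple_refl a" using ya a by (simp add: ds_def)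
  have "map_prod (simple_refl a) (simple_refl a) ` ?A ?p = ?A ?q"
  proof -
    have e: "map_prod (simple_refl a) (simple_refl a) (?p ! k, n + k + 1) = (?q ! k, n + k + 1)"
      if k: "k < length ?p" for k
    proof -
      have "simple_refl a (?p ! k) = ?q ! k"
      proof (cases "k = length as")
        case False
        then have "?p ! k \<in> set (as @ bs)" "?q ! k = ?p ! k"
          using k by (auto simp: nth_append nth_Cons split: nat.splits)
        then show ?thesis using d a by (auto simp: transpose_def)
      qed (simp add: nth_append)
      then show ?thesis using a by simp
    qed
    have "map_prod (simple_refl a) (simple_refl a) ` ?A ?p
      = (\<lambda>k. map_prod (simple_refl a) (simple_refl a) (?p ! k, n + k + 1)) ` {..<length ?p}" by auto
    also have "\<dots> = (\<lambda>k. (?q ! k, n + k + 1)) ` {..<length ?p}" using e by (intro image_cong refl) blast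
    also have "\<dots> = ?A ?q" by auto
    finally show ?thesis .
  qed
  then have "is_match (?A ?q) (ds a ?y)" using is_match_conj[OF m, of a] dy by simp
  moreover have "is_match (?A ?q) (grass_inv ?q n)" using d r a by (intro grass_inv_is_match) auto
  ultimately have "ds a ?y = grass_inv ?q n" by (rule is_match_unique)
  then show ?thesis using divdiff_inv_schubert[of ?y a] grass_inv_invol(2)[OF d r] r desc by simp
qed

section \<open>A summation formula\<close>

text \<open>All denominators are nonzero, and the condition survives swapping coordinates. The case
  i = j yields \<open>p i \<noteq> 0\<close>.\<close>

definition good_pt :: "(nat \<Rightarrow> 'k::field) \<Rightarrow> bool" where
  "good_pt p \<longleftrightarrow> inj p \<and> (\<forall>i j. p i + p j \<noteq> 0)"

lemma good_pt_diff: "good_pt p \<Longrightarrow> i \<noteq> j \<Longrightarrow> p i - p j \<noteq> 0"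
  by (simp add: good_pt_def inj_eq)

lemma good_pt_add: "good_pt p \<Longrightarrow> p i + p j \<noteq> 0"
  by (simp add: good_pt_def)

lemma good_pt_swap: "good_pt p \<Longrightarrow> good_pt (p \<circ> simple_refl a)"
  by (simp add: good_pt_def inj_compose)

text \<open>The index 0 stands for a variable at infinity; it absorbs the padding in odd length.\<close>
definition sg :: "(nat \<Rightarrow> 'k::field) \<Rightarrow> nat \<Rightarrow> nat \<Rightarrow> 'k" where
  "sg p i j = (if j = 0 then (if i = 0 then 0 else 1) else if i = 0 then -1
    else (p j - p i) / (p j + p i))"

text \<open>For a = 1 this is x_1 (x_1 + x_2) ... (x_1 + x_n), the dominant case r = 1. Raising a by
  divided differences adds nodes to the denominator as in Newton interpolation. The padding entry a
  = 0 has weight 1.\<close>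

definition cf :: "nat \<Rightarrow> (nat \<Rightarrow> 'k::field) \<Rightarrow> nat \<Rightarrow> nat \<Rightarrow> 'k" where
  "cf n p a i = (if a = 0 then 1
    else p i * (\<Prod>j\<in>{1..n} - {i}. p i + p j) / (\<Prod>j\<in>{1..a} - {i}. p i - p j))"

definition ix :: "nat \<Rightarrow> nat set" where
  "ix a = (if a = 0 then {0} else {1..a})"

fun sumL :: "nat \<Rightarrow> (nat \<Rightarrow> 'k::field) \<Rightarrow> nat list \<Rightarrow> (nat list \<Rightarrow> 'k) \<Rightarrow> 'k" where
  "sumL n p [] f = f []"
| "sumL n p (a # as) f = (\<Sum>i\<in>ix a. cf n p a i * sumL n p as (\<lambda>is. f (i # is)))"

text \<open>Schur's product over all pairs of positions k < l; it vanishes as soon as an index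
  repeats, since \<open>sg p i i = 0\<close>.\<close>

fun Vl :: "(nat \<Rightarrow> 'k::field) \<Rightarrow> nat list \<Rightarrow> 'k" where
  "Vl p [] = 1"
| "Vl p (i # is) = prod_list (map (sg p i) is) * Vl p is"

section \<open>Nested sums over index lists\<close>

lemma finite_ix [simp]: "finite (ix a)"
  by (simp add: ix_def)

lemma sumL_zero: "sumL n p as (\<lambda>is. 0) = 0"
  by (induction as) simp_all

lemma sumL_sum: "sumL n p as (\<lambda>is. \<Sum>x\<in>A. f x is) = (\<Sum>x\<in>A. sumL n p as (f x))"
proof (induction as arbitrary: f)
  case (Cons a as)
  show ?case by (simp add: Cons.IH sum_distrib_left sum.swap[of _ A])
qed simp

lemma sumL_scale: "sumL n p as (\<lambda>is. c * f is) = c * sumL n p as f"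
proof (induction as arbitrary: f)
  case (Cons a as)
  show ?case by (simp add: Cons.IH sum_distrib_left mult.left_commute)
qed simp

lemma sumL_append: "sumL n p (as @ bs) f = sumL n p as (\<lambda>is. sumL n p bs (\<lambda>js. f (is @ js)))"
  by (induction as arbitrary: f) simp_all

lemma sumL_isolate:
  "sumL n p (as @ a # bs) f
    = (\<Sum>i\<in>ix a. cf n p a i * sumL n p as (\<lambda>is. sumL n p bs (\<lambda>js. f (is @ i # js))))"
  by (simp add: sumL_append sumL_sum sumL_scale)

lemma sumL_cong:
  assumes "\<And>is. list_all2 (\<lambda>i a. i \<in> ix a) is as \<Longrightarrow> f is = g is"
  shows "sumL n p as f = sumL n p as g"
  using assms
proof (induction as arbitrary: f g)
  case (Cons a as)
  have "sumL n p as (\<lambda>is. f (i # is)) = sumL n p as (\<lambda>is. g (i # is))" if "i \<in> ix a" for i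
    using that Cons.prems by (intro Cons.IH) simp
  then show ?case by simp
qed simp

lemma sg_same: "sg p i i = 0"
  by (simp add: sg_def)

lemma Vl_append: "Vl p (as @ bs) = Vl p as * prod_list (map (\<lambda>i. prod_list (map (sg p i) bs)) as) * Vl p bs"
  by (induction as) (simp_all add: mult_ac)

lemma Vl_repeat: "i \<in> set as \<Longrightarrow> Vl p (as @ i # bs) = 0"
proof (induction as)
  case (Cons a as)
  then show ?case by (auto simp: sg_same)
qed simp

text \<open>The recursion of Newton divided differences for an arbitrary numerator. With
  \<open>D i\<close> the denominator over the nodes below a, the terms i < a reduce to the
  difference of 1 / (p i - p a) and 1 / (p i - p (a+1)); the two outer nodes are compared
  directly.\<close>

lemma divided_difference_sum:
  assumes p: "good_pt p" and "1 \<le> a"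
  shows "(\<Sum>i\<in>{1..a}. G i / (\<Prod>j\<in>{1..a} - {i}. p i - p j))
      - (\<Sum>i\<in>{1..a}. G (simple_refl a i)
          / (\<Prod>j\<in>{1..a} - {i}. p (simple_refl a i) - p (simple_refl a j)))
    = (p a - p (Suc a)) * (\<Sum>i\<in>{1..Suc a}. G i / (\<Prod>j\<in>{1..Suc a} - {i}. p i - p j))"
proof -
  define D where "D i = (\<Prod>j\<in>{1..<a} - {i}. p i - p j)" for i
  have nz: "p i - p j \<noteq> 0" if "i \<noteq> j" for i j using good_pt_diff[OF p that] .
  have Dnz: "D i \<noteq> 0" for i unfolding D_def using nz by (auto simp: prod_zero_iff)
  have S: "{1..a} = insert a {1..<a}" "{1..Suc a} = insert (Suc a) (insert a {1..<a})" using assms(2) by auto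
  have 1: "(\<Prod>j\<in>{1..a} - {i}. p i - p j) = (p i - p a) * D i"
    and 2: "(\<Prod>j\<in>{1..a} - {i}. p (simple_refl a i) - p (simple_refl a j)) = (p i - p (Suc a)) * D i"
    and 3: "(\<Prod>j\<in>{1..Suc a} - {i}. p i - p j) = (p i - p a) * (p i - p (Suc a)) * D i"
    if i: "i \<in> {1..<a}" for i
  proof -
    have S1: "{1..a} - {i} = insert a ({1..<a} - {i})"
      "{1..Suc a} - {i} = insert (Suc a) (insert a ({1..<a} - {i}))" using i by auto
    show "(\<Prod>j\<in>{1..a} - {i}. p i - p j) = (p i - p a) * D i"
      unfolding S1 D_def by (subst prod.insert) auto
    have "(\<Prod>j\<in>{1..<a} - {i}. p i - p (simple_refl a j)) = D i"
      unfolding D_def by (intro prod.cong) auto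
    moreover have "simple_refl a i = i" using i by simp
    ultimately show "(\<Prod>j\<in>{1..a} - {i}. p (simple_refl a i) - p (simple_refl a j)) = (p i - p (Suc a)) * D i"
      unfolding S1 by (subst prod.insert) auto
    show "(\<Prod>j\<in>{1..Suc a} - {i}. p i - p j) = (p i - p a) * (p i - p (Suc a)) * D i"
      unfolding S1 D_def by (subst prod.insert, simp, simp, subst prod.insert) (auto simp: mult_ac)
  qed
  have a: "{1..a} - {a} = {1..<a}" "{1..Suc a} - {a} = insert (Suc a) {1..<a}"
    "{1..Suc a} - {Suc a} = insert a {1..<a}" "{1..<a} - {a} = {1..<a}" "{1..<a} - {Suc a} = {1..<a}"
    using assms(2) by auto
  have 4: "(\<Prod>j\<in>{1..a} - {a}. p a - p j) = D a" unfolding a D_def ..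
  have 5: "(\<Prod>j\<in>{1..a} - {a}. p (simple_refl a a) - p (simple_refl a j)) = D (Suc a)"
    unfolding a D_def by (intro prod.cong) auto
  have 6: "(\<Prod>j\<in>{1..Suc a} - {a}. p a - p j) = (p a - p (Suc a)) * D a"
    unfolding a D_def by (subst prod.insert) auto
  have 7: "(\<Prod>j\<in>{1..Suc a} - {Suc a}. p (Suc a) - p j) = (p (Suc a) - p a) * D (Suc a)"
    unfolding a D_def by (subst prod.insert) auto
  have "(\<Sum>i\<in>{1..a}. G i / (\<Prod>j\<in>{1..a} - {i}. p i - p j))
      = G a / D a + (\<Sum>i\<in>{1..<a}. G i / ((p i - p a) * D i))"
  proof -
    have "(\<Sum>i\<in>{1..<a}. G i / (\<Prod>j\<in>{1..a} - {i}. p i - p j)) = (\<Sum>i\<in>{1..<a}. G i / ((p i - p a) * D i))"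
      by (intro sum.cong refl) (simp only: 1)
    moreover have "(\<Sum>i\<in>insert a {1..<a}. G i / (\<Prod>j\<in>{1..a} - {i}. p i - p j))
      = G a / D a + (\<Sum>i\<in>{1..<a}. G i / (\<Prod>j\<in>{1..a} - {i}. p i - p j))"
      by (subst sum.insert) (simp_all only: 4 finite_atLeastLessThan, simp_all)
    ultimately show ?thesis by (simp only: S(1)[symmetric])
  qed
  moreover have "(\<Sum>i\<in>{1..a}. G (simple_refl a i)
          / (\<Prod>j\<in>{1..a} - {i}. p (simple_refl a i) - p (simple_refl a j)))
      = G (Suc a) / D (Suc a) + (\<Sum>i\<in>{1..<a}. G i / ((p i - p (Suc a)) * D i))"
  proof -
    have "(\<Sum>i\<in>{1..<a}. G (simple_refl a i)
          / (\<Prod>j\<in>{1..a} - {i}. p (simple_refl a i) - p (simple_refl a j)))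
      = (\<Sum>i\<in>{1..<a}. G i / ((p i - p (Suc a)) * D i))"
      by (intro sum.cong refl) (simp only: 2, simp)
    moreover have "(\<Sum>i\<in>insert a {1..<a}. G (simple_refl a i)
          / (\<Prod>j\<in>{1..a} - {i}. p (simple_refl a i) - p (simple_refl a j)))
      = G (Suc a) / D (Suc a) + (\<Sum>i\<in>{1..<a}. G (simple_refl a i)
          / (\<Prod>j\<in>{1..a} - {i}. p (simple_refl a i) - p (simple_refl a j)))"
      by (subst sum.insert) (simp_all only: 5 finite_atLeastLessThan, simp_all)
    ultimately show ?thesis by (simp only: S(1)[symmetric])
  qed
  moreover have "(\<Sum>i\<in>{1..Suc a}. G i / (\<Prod>j\<in>{1..Suc a} - {i}. p i - p j))
      = G (Suc a) / ((p (Suc a) - p a) * D (Suc a)) + G a / ((p a - p (Suc a)) * D a)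
        + (\<Sum>i\<in>{1..<a}. G i / ((p i - p a) * (p i - p (Suc a)) * D i))"
  proof -
    have "(\<Sum>i\<in>{1..<a}. G i / (\<Prod>j\<in>{1..Suc a} - {i}. p i - p j))
      = (\<Sum>i\<in>{1..<a}. G i / ((p i - p a) * (p i - p (Suc a)) * D i))"
      by (intro sum.cong refl) (simp only: 3)
    moreover have "(\<Sum>i\<in>insert (Suc a) (insert a {1..<a}). G i / (\<Prod>j\<in>{1..Suc a} - {i}. p i - p j))
      = G (Suc a) / ((p (Suc a) - p a) * D (Suc a)) + (G a / ((p a - p (Suc a)) * D a)
        + (\<Sum>i\<in>{1..<a}. G i / (\<Prod>j\<in>{1..Suc a} - {i}. p i - p j)))"
      by (subst sum.insert, simp, simp, subst sum.insert) (simp_all only: 6 7, simp_all)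
    ultimately show ?thesis by (simp only: S(2)[symmetric]) simp
  qed
  moreover have "(p a - p (Suc a)) * (G (Suc a) / ((p (Suc a) - p a) * D (Suc a))) = - (G (Suc a) / D (Suc a))"
    using nz[of "Suc a" a] Dnz by (simp add: field_simps)
  moreover have "(p a - p (Suc a)) * (G a / ((p a - p (Suc a)) * D a)) = G a / D a"
    using nz[of a "Suc a"] Dnz by simp
  moreover have "(\<Sum>i\<in>{1..<a}. G i / ((p i - p a) * D i)) - (\<Sum>i\<in>{1..<a}. G i / ((p i - p (Suc a)) * D i))
    = (p a - p (Suc a)) * (\<Sum>i\<in>{1..<a}. G i / ((p i - p a) * (p i - p (Suc a)) * D i))"
    unfolding sum_distrib_left sum_subtractf[symmetric]
  proof (intro sum.cong refl)
    fix i assume "i \<in> {1..<a}"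
    then have "p i - p a \<noteq> 0" "p i - p (Suc a) \<noteq> 0" using nz by auto
    then show "G i / ((p i - p a) * D i) - G i / ((p i - p (Suc a)) * D i)
      = (p a - p (Suc a)) * (G i / ((p i - p a) * (p i - p (Suc a)) * D i))"
      using Dnz[of i] by (simp add: divide_simps) (simp add: algebra_simps)
  qed
  ultimately show ?thesis by (simp add: distrib_left)
qed

lemma simple_refl_ix: "b \<noteq> a \<Longrightarrow> 1 \<le> a \<Longrightarrow> simple_refl a ` ix b = ix b"
proof -
  assume a: "b \<noteq> a" "1 \<le> a"
  show ?thesis
  proof (cases "b < a")
    case True
    then have "\<And>x. x \<in> ix b \<Longrightarrow> simple_refl a x = x" using a by (auto simp: ix_def split: if_splits)
    then show ?thesis by force
  next
    case False
    then have "simple_refl a permutes {1..b}" using a by (intro simple_refl_permutes) auto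
    then show ?thesis using False a permutes_image by (fastforce simp: ix_def)
  qed
qed

lemma prod_refl_reindex:
  assumes "simple_refl a ` A = A"
  shows "(\<Prod>j\<in>A - {i}. f (simple_refl a j)) = (\<Prod>j\<in>A - {simple_refl a i}. f j)"
proof -
  have "simple_refl a ` (A - {i}) = A - {simple_refl a i}"
    using assms by (simp add: image_set_diff)
  then show ?thesis by (metis (mono_tags, lifting) inj_on_subset inj_transpose prod.reindex_cong subset_UNIV)
qed

lemma cf_swap:
  assumes "1 \<le> a" "Suc a \<le> n" "b \<noteq> a"
  shows "cf n (p \<circ> simple_refl a) b i = cf n p b (simple_refl a i)"
proof (cases "b = 0")
  case False
  have 1: "simple_refl a ` {1..n} = {1..n}"
    using simple_refl_permutes[OF assms(1,2)] by (rule permutes_image)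
  have 2: "simple_refl a ` {1..b} = {1..b}" using simple_refl_ix[OF assms(3,1)] False by (simp add: ix_def)
  show ?thesis using False
    prod_refl_reindex[OF 1, of "\<lambda>j. p (simple_refl a i) + p j" i]
    prod_refl_reindex[OF 2, of "\<lambda>j. p (simple_refl a i) - p j" i]
    by (simp add: cf_def)
qed (simp add: cf_def)

lemma sumL_swap:
  assumes "1 \<le> a" "Suc a \<le> n" "a \<notin> set cs"
  shows "sumL n (p \<circ> simple_refl a) cs f = sumL n p cs (\<lambda>is. f (map (simple_refl a) is))"
  using assms(3)
proof (induction cs arbitrary: f)
  case (Cons b cs)
  have b: "b \<noteq> a" and cs: "a \<notin> set cs" using Cons.prems by auto
  have "sumL n (p \<circ> simple_refl a) (b # cs) f = (\<Sum>i\<in>ix b. cf n p b (simple_refl a i)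
      * sumL n p cs (\<lambda>is. f (i # map (simple_refl a) is)))"
    by (simp add: Cons.IH[OF cs] cf_swap[OF assms(1,2) b])
  also have "\<dots> = (\<Sum>i\<in>simple_refl a ` ix b. cf n p b i
      * sumL n p cs (\<lambda>is. f (simple_refl a i # map (simple_refl a) is)))"
    by (subst sum.reindex) (auto intro: inj_on_subset)
  also have "\<dots> = sumL n p (b # cs) (\<lambda>is. f (map (simple_refl a) is))"
    unfolding simple_refl_ix[OF b assms(1)] by simp
  finally show ?case .
qed simp

lemma Vl_swap: "1 \<le> a \<Longrightarrow> Vl (p \<circ> simple_refl a) (map (simple_refl a) is) = Vl p is"
proof (induction "is")
  case (Cons i "is")
  have "sg (p \<circ> simple_refl a) (simple_refl a i) (simple_refl a j) = sg p i j" for j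
  proof -
    have "simple_refl a k = 0 \<longleftrightarrow> k = 0" for k using Cons.prems by (auto simp: transpose_def)
    then show ?thesis by (simp add: sg_def)
  qed
  then show ?case using Cons by (simp add: o_def)
qed simp

text \<open>As a occurs nowhere else, s_a permutes the range of every other index, so the numerator
  and the inner sums are equivariant under s_a. Only the range {1..a} of the distinguished index is
  not stable, and \<open>divided_difference_sum\<close> extends it to a + 1.\<close>

lemma sumL_divdiff_step:
  assumes p: "good_pt p" and a: "1 \<le> a" "Suc a \<le> n" "a \<notin> set (as @ bs)"
  shows "(sumL n p (as @ a # bs) (Vl p) - sumL n (p \<circ> simple_refl a) (as @ a # bs) (Vl (p \<circ> simple_refl a)))
      / (p a - p (Suc a)) = sumL n p (as @ Suc a # bs) (Vl p)"
proof -
  let ?s = "simple_refl a"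
  let ?q = "p \<circ> ?s"
  define R where "R p i = sumL n p as (\<lambda>is. sumL n p bs (\<lambda>js. Vl p (is @ i # js)))" for p :: "nat \<Rightarrow> 'a" and i
  define N where "N p i = p i * (\<Prod>j\<in>{1..n} - {i}. p i + p j)" for p :: "nat \<Rightarrow> 'a" and i
  define G where "G i = N p i * R p i" for i
  have R: "R ?q i = R p (?s i)" for i
  proof -
    have "R ?q i = sumL n p as (\<lambda>is. sumL n p bs (\<lambda>js. Vl ?q (map ?s is @ i # map ?s js)))"
      unfolding R_def using a by (simp add: sumL_swap)
    also have "\<dots> = R p (?s i)"
      using Vl_swap[OF a(1), of p "is @ ?s i # js" for "is" js] by (simp add: R_def)
    finally show ?thesis .
  qed
  have N: "N ?q i = N p (?s i)" for i
  proof -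
    have "?s ` {1..n} = {1..n}" using simple_refl_permutes[OF a(1,2)] by (rule permutes_image)
    from prod_refl_reindex[OF this, of "\<lambda>j. p (?s i) + p j" i] show ?thesis by (simp add: N_def)
  qed
  have F: "sumL n p (as @ c # bs) (Vl p) = (\<Sum>i\<in>{1..c}. N p i * R p i / (\<Prod>j\<in>{1..c} - {i}. p i - p j))"
    if "c \<noteq> 0" for p :: "nat \<Rightarrow> 'a" and c
    using that by (simp add: sumL_isolate R_def N_def cf_def ix_def)
  have "sumL n p (as @ a # bs) (Vl p) = (\<Sum>i\<in>{1..a}. G i / (\<Prod>j\<in>{1..a} - {i}. p i - p j))"
    using F[of a p] a(1) by (simp add: G_def)
  moreover have "sumL n ?q (as @ a # bs) (Vl ?q)
      = (\<Sum>i\<in>{1..a}. G (?s i) / (\<Prod>j\<in>{1..a} - {i}. p (?s i) - p (?s j)))"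
    using F[of a ?q] a(1) by (simp add: G_def R N)
  moreover have "sumL n p (as @ Suc a # bs) (Vl p)
      = (\<Sum>i\<in>{1..Suc a}. G i / (\<Prod>j\<in>{1..Suc a} - {i}. p i - p j))"
    using F[of "Suc a" p] by (simp add: G_def)
  ultimately show ?thesis using divided_difference_sum[OF p a(1), of G] good_pt_diff[OF p, of a "Suc a"]
    by (simp only: nonzero_mult_div_cancel_left[of "p a - p (Suc a)"]) simp
qed

text \<open>Index k + 1 ranges over 1, ..., k + 1, of which 1, ..., k are already taken; a
  repetition kills the term, so only the choice k + 1 remains.\<close>

lemma sumL_initial:
  assumes "k \<le> r"
  shows "sumL n p [Suc k..<Suc r] (\<lambda>js. Vl p ([1..<Suc k] @ js))
    = (\<Prod>l = Suc k..<Suc r. cf n p l l) * Vl p [1..<Suc r]"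
  using assms
proof (induction "r - k" arbitrary: k)
  case 0
  then show ?case by simp
next
  case (Suc d)
  then have k: "k < r" by simp
  let ?f = "\<lambda>i. cf n p (Suc k) i * sumL n p [Suc (Suc k)..<Suc r] (\<lambda>js. Vl p ([1..<Suc k] @ i # js))"
  have z: "?f i = 0" if "i \<in> {1..Suc k} - {Suc k}" for i
  proof -
    have "i \<in> set [1..<Suc k]" using that by auto
    then have "(\<lambda>js. Vl p ([1..<Suc k] @ i # js)) = (\<lambda>js. 0)" using Vl_repeat by (intro ext)
    then show ?thesis by (simp only: sumL_zero mult_zero_right)
  qed
  have "[Suc k..<Suc r] = Suc k # [Suc (Suc k)..<Suc r]" using k by (simp add: upt_conv_Cons)
  then have "sumL n p [Suc k..<Suc r] (\<lambda>js. Vl p ([1..<Suc k] @ js)) = (\<Sum>i\<in>{1..Suc k}. ?f i)"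
    by (simp add: ix_def del: upt_Suc)
  also have "\<dots> = ?f (Suc k) + (\<Sum>i\<in>{1..Suc k} - {Suc k}. ?f i)" by (rule sum.remove) auto
  also have "(\<Sum>i\<in>{1..Suc k} - {Suc k}. ?f i) = 0" using z by (rule sum.neutral[OF ballI])
  also have "?f (Suc k) + 0 = ?f (Suc k)" by (rule add_0_right)
  also have "(\<lambda>js. Vl p ([1..<Suc k] @ Suc k # js)) = (\<lambda>js. Vl p ([1..<Suc (Suc k)] @ js))" by simp
  also have "sumL n p [Suc (Suc k)..<Suc r] \<dots> = (\<Prod>l = Suc (Suc k)..<Suc r. cf n p l l) * Vl p [1..<Suc r]"
    using Suc(2) k by (intro Suc(1)) auto
  also have "cf n p (Suc k) (Suc k) * \<dots> = (\<Prod>l = Suc k..<Suc r. cf n p l l) * Vl p [1..<Suc r]"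
    using k by (simp only: prod.atLeast_Suc_lessThan[of "Suc k" "Suc r"] Suc_less_eq mult.assoc)
  finally show ?case .
qed

text \<open>Passing to r + 1, the differences in the denominator of \<open>cf\<close> cancel the
  numerators of the new quotients, and the sums x_(r+1) + x_j with j \<le> r cancel their
  denominators. What is left is row r + 1 of the dominant product.\<close>

lemma prod_cf_Vl:
  assumes p: "good_pt p" and "r \<le> n"
  shows "(\<Prod>l = 1..<Suc r. cf n p l l) * Vl p [1..<Suc r]
    = (\<Prod>c = 0..<r. \<Prod>i = Suc c..<Suc n. ev p (xx (Suc c) i))"
  using assms(2)
proof (induction r)
  case (Suc r)
  let ?x = "Suc r"
  define A where "A = (\<Prod>j\<in>{1..<?x}. p ?x + p j)"
  define B where "B = (\<Prod>j\<in>{1..<?x}. p ?x - p j)"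
  define C where "C = (\<Prod>j\<in>{Suc ?x..<Suc n}. p ?x + p j)"
  have nz: "A \<noteq> 0" "B \<noteq> 0"
    using good_pt_add[OF p] good_pt_diff[OF p, of ?x] by (auto simp: A_def B_def)
  have "{1..n} - {?x} = {1..<?x} \<union> {Suc ?x..<Suc n}" using Suc.prems by auto
  then have "(\<Prod>j\<in>{1..n} - {?x}. p ?x + p j) = A * C"
    unfolding A_def C_def by (subst prod.union_disjoint[symmetric]) (auto simp del: One_nat_def)
  moreover have "{1..?x} - {?x} = {1..<?x}" by auto
  ultimately have cf: "cf n p ?x ?x = p ?x * (A * C) / B" by (simp add: cf_def B_def)
  have "Vl p [1..<Suc ?x] = Vl p [1..<?x] * prod_list (map (\<lambda>i. sg p i ?x) [1..<?x])"
    by (simp add: Vl_append)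
  also have "prod_list (map (\<lambda>i. sg p i ?x) [1..<?x]) = (\<Prod>i\<in>{1..<?x}. sg p i ?x)"
    by (subst prod.distinct_set_conv_list[symmetric]) (simp_all del: upt_Suc)
  also have "\<dots> = B / A"
    unfolding A_def B_def prod_dividef[symmetric] by (intro prod.cong) (auto simp: sg_def)
  finally have V: "Vl p [1..<Suc ?x] = Vl p [1..<?x] * (B / A)" .
  have "(\<Prod>l = 1..<Suc ?x. cf n p l l) = (\<Prod>l = 1..<?x. cf n p l l) * cf n p ?x ?x" by simp
  then have "(\<Prod>l = 1..<Suc ?x. cf n p l l) * Vl p [1..<Suc ?x]
      = ((\<Prod>l = 1..<?x. cf n p l l) * Vl p [1..<?x]) * (p ?x * C)"
    unfolding V cf using nz by (simp add: field_simps del: upt_Suc)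
  also have "p ?x * C = (\<Prod>i = ?x..<Suc n. ev p (xx ?x i))"
    using Suc.prems
    by (subst prod.atLeast_Suc_lessThan) (auto simp: C_def xx_def intro!: prod.cong)
  also have "(\<Prod>l = 1..<?x. cf n p l l) * Vl p [1..<?x]
      = (\<Prod>c = 0..<r. \<Prod>i = Suc c..<Suc n. ev p (xx (Suc c) i))"
    using Suc by simp
  finally show ?case by simp
qed simp

text \<open>Unless the sequence is the smallest one, some entry can be lowered by 1 without meeting
  its predecessor: this drives the induction on the sum of the entries.\<close>

lemma increasing_list_cases:
  assumes "sorted_wrt (<) \<psi>" "\<forall>x\<in>set \<psi>. (1::nat) \<le> x"
  shows "\<psi> = [1..<Suc (length \<psi>)] \<or>
    (\<exists>as a bs. \<psi> = as @ Suc a # bs \<and> 1 \<le> a \<and> (\<forall>x\<in>set as. x < a))"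
  using assms
proof (induction \<psi> rule: rev_induct)
  case (snoc x \<psi>)
  then have IH: "\<psi> = [1..<Suc (length \<psi>)] \<or>
    (\<exists>as a bs. \<psi> = as @ Suc a # bs \<and> 1 \<le> a \<and> (\<forall>x\<in>set as. x < a))"
    by (simp add: sorted_wrt_append)
  show ?case
  proof (cases "\<psi> = [1..<Suc (length \<psi>)]")
    case True
    let ?k = "length \<psi>"
    have lt: "\<forall>y\<in>set \<psi>. y < x" using snoc.prems by (simp add: sorted_wrt_append)
    have st: "set \<psi> = {1..<Suc ?k}" using True by (metis set_upt)
    have "?k < x"
    proof (cases "?k = 0")
      case False
      then have "1 \<le> ?k" by linarith
      then have "?k \<in> set \<psi>" unfolding st by simp
      then show ?thesis using lt by blast
    qed (use snoc.prems in simp)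
    show ?thesis
    proof (cases "x = Suc ?k")
      case x: True
      have "\<psi> @ [x] = [1..<Suc ?k] @ [Suc ?k]" using True x by simp
      also have "\<dots> = [1..<Suc (length (\<psi> @ [x]))]" by simp
      finally show ?thesis by blast
    next
      case False
      then have "\<psi> @ [x] = \<psi> @ Suc (x - 1) # [] \<and> 1 \<le> x - 1 \<and> (\<forall>y\<in>set \<psi>. y < x - 1)"
        using \<open>?k < x\<close> unfolding st by auto
      then show ?thesis by blast
    qed
  next
    case False
    then obtain as a bs where "\<psi> = as @ Suc a # bs" "1 \<le> a" "\<forall>x\<in>set as. x < a" using IH by blast
    then show ?thesis by (intro disjI2 exI[of _ as] exI[of _ a] exI[of _ "bs @ [x]"]) simp
  qed
qed simp

text \<open>The induction varies the point as well, because the divided difference at a needs the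
  formula at p and at p with coordinates a and a + 1 swapped.\<close>

theorem ev_inv_schubert_grass:
  assumes "good_pt p" "sorted_wrt (<) \<psi>" "\<forall>x\<in>set \<psi>. 1 \<le> x \<and> x \<le> n"
  shows "ev p (inv_schubert (grass_inv \<psi> n)) = sumL n p \<psi> (Vl p)"
  using assms
proof (induction "sum_list \<psi>" arbitrary: \<psi> p rule: less_induct)
  case less
  have "\<forall>x\<in>set \<psi>. 1 \<le> x" using less.prems(3) by blast
  from increasing_list_cases[OF less.prems(2) this] consider "\<psi> = [1..<Suc (length \<psi>)]"
    | as a bs where "\<psi> = as @ Suc a # bs" "1 \<le> a" "\<forall>x\<in>set as. x < a" by blast
  then show ?case
  proof cases
    case 1
    let ?r = "length \<psi>"
    have "?r \<le> n"
    proof (cases "?r = 0")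
      case False
      then have "1 \<le> ?r" by linarith
      then have "?r \<in> set [1..<Suc ?r]" by simp
      then show ?thesis using 1 less.prems(3) by metis
    qed simp
    have "sumL n p [Suc 0..<Suc ?r] (\<lambda>js. Vl p ([1..<Suc 0] @ js))
        = (\<Prod>l = Suc 0..<Suc ?r. cf n p l l) * Vl p [1..<Suc ?r]"
      by (rule sumL_initial) simp
    then have "sumL n p [1..<Suc ?r] (Vl p) = (\<Prod>l = 1..<Suc ?r. cf n p l l) * Vl p [1..<Suc ?r]"
      by (simp del: upt_Suc add: upt_rec[of 1 1])
    also have "\<dots> = ev p (inv_schubert (grass_inv [1..<Suc ?r] n))"
      unfolding prod_cf_Vl[OF less.prems(1) \<open>?r \<le> n\<close>] inv_schubert_dominant[OF \<open>?r \<le> n\<close>]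
      by (simp only: ev_prod)
    finally show ?thesis using 1 by metis
  next
    case 2
    let ?\<psi>' = "as @ a # bs"
    have s: "sorted_wrt (<) ?\<psi>'" using less.prems(2) 2 by (auto simp: sorted_wrt_append)
    have b: "\<forall>x\<in>set ?\<psi>'. 1 \<le> x \<and> x \<le> n" using less.prems(3) 2 by auto
    have n: "Suc a \<le> n" using less.prems(3) 2 by auto
    have na: "a \<notin> set (as @ bs)" "Suc a \<notin> set (as @ bs)"
      using less.prems(2) 2 by (auto simp: sorted_wrt_append)
    have IH: "ev p' (inv_schubert (grass_inv ?\<psi>' n)) = sumL n p' ?\<psi>' (Vl p')" if "good_pt p'" for p' :: "nat \<Rightarrow> 'a"
      using that s b by (intro less.hyps) (simp_all add: 2)
    have "distinct ?\<psi>'" using s by (simp add: strict_sorted_iff)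
    then have "ev p (inv_schubert (grass_inv \<psi> n)) = ev p (divdiff a (inv_schubert (grass_inv ?\<psi>' n)))"
      using divdiff_inv_schubert_grass[OF _ b n na(2)] 2(1) by simp
    also have "\<dots> = (sumL n p ?\<psi>' (Vl p) - sumL n (p \<circ> simple_refl a) ?\<psi>' (Vl (p \<circ> simple_refl a)))
        / (p a - p (Suc a))"
      using ev_divdiff[of p a] good_pt_diff[OF less.prems(1), of a "Suc a"]
        IH[OF less.prems(1)] IH[OF good_pt_swap[OF less.prems(1)]] by simp
    also have "\<dots> = sumL n p \<psi> (Vl p)"
      unfolding 2(1) using less.prems(1) 2(2) n na(1) by (rule sumL_divdiff_step)
    finally show ?thesis .
  qed
qed

section \<open>Expansion of the Pfaffian along the first row\<close>

text \<open>The Pfaffian with entries given by a function, so that deleting rows and columns is mere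
  reindexing.\<close>

definition pf_sum :: "nat \<Rightarrow> (nat \<Rightarrow> nat \<Rightarrow> 'a::comm_ring_1) \<Rightarrow> 'a" where
  "pf_sum k B = (\<Sum>\<pi>\<in>matching_perms k. of_int (sign \<pi>) * (\<Prod>i<k. B (\<pi> (2 * i)) (\<pi> (2 * i + 1))))"

text \<open>For j \<ge> 1, the increasing enumeration of the numbers other than 0 and j;
  \<open>unskip\<close> inverts it.\<close>

definition skip :: "nat \<Rightarrow> nat \<Rightarrow> nat" where
  "skip j v = (if Suc v < j then Suc v else v + 2)"

definition unskip :: "nat \<Rightarrow> nat \<Rightarrow> nat" where
  "unskip j x = (if x < j then x - 1 else x - 2)"

text \<open>The cycle that puts j in position 1 and keeps the order of the rest, a product of j - 1
  adjacent transpositions; it is the source of the sign in the expansion.\<close>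

definition front :: "nat \<Rightarrow> nat \<Rightarrow> nat" where
  "front j x = (if x = 1 then j else if 2 \<le> x \<and> x \<le> j then x - 1 else x)"

definition shift2 :: "(nat \<Rightarrow> nat) \<Rightarrow> nat \<Rightarrow> nat" where
  "shift2 p x = (if x < 2 then x else p (x - 2) + 2)"

lemma unskip_skip: "1 \<le> j \<Longrightarrow> unskip j (skip j v) = v"
  by (auto simp: skip_def unskip_def)

lemma skip_unskip: "1 \<le> j \<Longrightarrow> x \<noteq> 0 \<Longrightarrow> x \<noteq> j \<Longrightarrow> skip j (unskip j x) = x"
  by (auto simp: skip_def unskip_def)

lemma skip_less_iff: "skip j u < skip j v \<longleftrightarrow> u < v"
  by (auto simp: skip_def)

lemma skip_pos: "0 < skip j v"
  by (simp add: skip_def)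

lemma front_permutes_sign:
  assumes "1 \<le> j" "j < m"
  shows "front j permutes {0..<m} \<and> sign (front j) = (-1) ^ (j - 1)"
  using assms
proof (induction j rule: nat_induct_at_least)
  case base
  have e: "front 1 = id" by (auto simp: front_def)
  show ?case unfolding e by (intro conjI permutes_id) simp
next
  case (Suc j)
  have e: "front (Suc j) = transpose j (Suc j) \<circ> front j"
    using Suc(1) by (auto simp: front_def fun_eq_iff transpose_def)
  have IH: "front j permutes {0..<m}" "sign (front j) = (-1) ^ (j - 1)" using Suc by auto
  have t: "transpose j (Suc j) permutes {0..<m}" using Suc.prems by (intro permutes_swap_id) auto
  have "sign (front (Suc j)) = sign (transpose j (Suc j)) * sign (front j)"
    unfolding e by (intro sign_compose permutes_imp_permutation[OF _ t] permutes_imp_permutation[OF _ IH(1)]) auto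
  also have "\<dots> = (-1) ^ (Suc j - 1)"
  proof -
    obtain i where "j = Suc i" using Suc(1) by (cases j) auto
    then show ?thesis unfolding IH(2) by (simp add: sign_swap_id)
  qed
  finally show ?case using permutes_compose[OF IH(1) t] unfolding e by blast
qed

lemma shift2_permutes_sign:
  assumes "p permutes {0..<m}"
  shows "shift2 p permutes {0..<m + 2} \<and> sign (shift2 p) = sign p"
  using assms finite_atLeastLessThan
proof (induction rule: permutes_induct)
  case id
  have e: "shift2 id = id" by (rule ext) (auto simp: shift2_def)
  show ?case unfolding e by (intro conjI permutes_id) simp
next
  case (swap a b p)
  have e: "shift2 (transpose a b \<circ> p) = transpose (a + 2) (b + 2) \<circ> shift2 p"
    by (auto simp: shift2_def fun_eq_iff transpose_def)
  have t: "transpose (a + 2) (b + 2) permutes {0..<m + 2}" "transpose a b permutes {0..<m}"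
    using swap(1,2) by (auto intro: permutes_swap_id)
  have "sign (shift2 (transpose a b \<circ> p)) = sign (transpose (a + 2) (b + 2)) * sign (shift2 p)"
    unfolding e using swap.IH
    by (intro sign_compose permutes_imp_permutation[OF _ t(1)] permutes_imp_permutation[of "{0..<m + 2}"]) auto
  also have "\<dots> = sign (transpose a b) * sign p" using swap.IH swap(3) by (simp add: sign_swap_id)
  also have "\<dots> = sign (transpose a b \<circ> p)"
    by (intro sign_compose[symmetric] permutes_imp_permutation[OF _ t(2)] permutes_imp_permutation[OF _ swap(4)]) auto
  finally show ?case using permutes_compose[OF conjunct1[OF swap.IH] t(1)] unfolding e by blast
qed

text \<open>The matching made of the pair {0, j} and of the matching p on the remaining
  points.\<close>

definition glue :: "nat \<Rightarrow> (nat \<Rightarrow> nat) \<Rightarrow> nat \<Rightarrow> nat" where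
  "glue j p = front j \<circ> shift2 p"

lemma glue_simps:
  "1 \<le> j \<Longrightarrow> glue j p 0 = 0" "1 \<le> j \<Longrightarrow> glue j p (Suc 0) = j"
  "1 \<le> j \<Longrightarrow> glue j p (Suc (Suc v)) = skip j (p v)"
  by (auto simp: glue_def front_def shift2_def skip_def)

lemma matching_perms_glue:
  assumes "p \<in> matching_perms k" "1 \<le> j" "j \<le> 2 * k + 1"
  shows "glue j p \<in> matching_perms (Suc k)" "sign (glue j p) = (-1) ^ (j - 1) * sign p"
proof -
  have p: "p permutes {0..<2 * k}" "\<And>i. i < k \<Longrightarrow> p (2 * i) < p (2 * i + 1)"
    "\<And>i j. i < j \<Longrightarrow> j < k \<Longrightarrow> p (2 * i) < p (2 * j)"
    using assms(1) by (auto simp: matching_perms_def)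
  have S: "shift2 p permutes {0..<2 * k + 2}" "sign (shift2 p) = sign p"
    using shift2_permutes_sign[OF p(1)] by auto
  have F: "front j permutes {0..<2 * k + 2}" "sign (front j) = (-1) ^ (j - 1)"
    using front_permutes_sign[OF assms(2), of "2 * k + 2"] assms(3) by auto
  show "sign (glue j p) = (-1) ^ (j - 1) * sign p"
    unfolding glue_def S(2)[symmetric] F(2)[symmetric]
    by (intro sign_compose permutes_imp_permutation[OF _ S(1)] permutes_imp_permutation[OF _ F(1)]) auto
  have "glue j p permutes {0..<2 * Suc k}"
    unfolding glue_def using permutes_compose[OF S(1) F(1)] by simp
  moreover have "glue j p (2 * i) < glue j p (2 * i + 1)" if "i < Suc k" for i
    using that p(2) assms(2) by (cases i) (auto simp: glue_simps skip_less_iff)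
  moreover have "glue j p (2 * a) < glue j p (2 * b)" if "a < b" "b < Suc k" for a b
    using that p(3) assms(2) by (cases a; cases b) (auto simp: glue_simps skip_less_iff skip_pos)
  ultimately show "glue j p \<in> matching_perms (Suc k)" by (simp add: matching_perms_def)
qed

lemma matching_perms_unglue:
  assumes "\<pi> \<in> matching_perms (Suc k)"
  defines "j \<equiv> \<pi> (Suc 0)" and "p \<equiv> (\<lambda>v. unskip (\<pi> (Suc 0)) (\<pi> (Suc (Suc v))))"
  shows "1 \<le> j" "j \<le> 2 * k + 1" "p \<in> matching_perms k" "glue j p = \<pi>"
proof -
  have perm: "\<pi> permutes {0..<2 * Suc k}" and lt: "\<And>i. i < Suc k \<Longrightarrow> \<pi> (2 * i) < \<pi> (2 * i + 1)"
    and ord: "\<And>a b. a < b \<Longrightarrow> b < Suc k \<Longrightarrow> \<pi> (2 * a) < \<pi> (2 * b)"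
    using assms(1) by (auto simp: matching_perms_def)
  have inj: "\<pi> a = \<pi> b \<longleftrightarrow> a = b" for a b using permutes_inj[OF perm] by (simp add: inj_eq)
  have mem: "\<pi> a < 2 * Suc k" if "a < 2 * Suc k" for a
    using permutes_in_image[OF perm, of a] that by simp
  show j1: "1 \<le> j" using lt[of 0] by (simp add: j_def)
  show jk: "j \<le> 2 * k + 1" using mem[of "Suc 0"] by (simp add: j_def)
  \<comment> \<open>The value 0 cannot be the larger element of a pair, nor the smaller element of a
    pair other than the first.\<close>
  have pi0: "\<pi> 0 = 0"
  proof -
    have "0 \<in> \<pi> ` {0..<2 * Suc k}" using permutes_image[OF perm] by simp
    then obtain x where x: "x < 2 * Suc k" "\<pi> x = 0" by auto
    show ?thesis
    proof (cases "even x")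
      case True
      then obtain i where "x = 2 * i" by blast
      then show ?thesis using ord[of 0 i] x by (cases "i = 0") auto
    next
      case False
      then obtain i where "x = 2 * i + 1" by (rule oddE)
      then show ?thesis using lt[of i] x by auto
    qed
  qed
  have ne: "\<pi> (Suc (Suc v)) \<noteq> 0" "\<pi> (Suc (Suc v)) \<noteq> j" for v
    using inj[of "Suc (Suc v)" 0] inj[of "Suc (Suc v)" "Suc 0"] pi0 by (auto simp: j_def)
  have sk: "skip j (p v) = \<pi> (Suc (Suc v))" for v
    unfolding p_def j_def[symmetric] by (rule skip_unskip[OF j1 ne])
  show g: "glue j p = \<pi>"
  proof
    fix x
    consider "x = 0" | "x = Suc 0" | v where "x = Suc (Suc v)" by (metis not0_implies_Suc)
    then show "glue j p x = \<pi> x" using j1 pi0 sk by cases (auto simp: glue_simps j_def)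
  qed
  have "p permutes {0..<2 * k}"
  proof (rule bij_imp_permutes)
    have "inj_on p {0..<2 * k}"
    proof (rule inj_onI)
      fix u v assume "p u = p v"
      then have "\<pi> (Suc (Suc u)) = \<pi> (Suc (Suc v))" using sk by metis
      then show "u = v" by (simp add: inj)
    qed
    moreover have "p ` {0..<2 * k} \<subseteq> {0..<2 * k}"
    proof clarify
      fix v assume "v \<in> {0..<2 * k}"
      then have "\<pi> (Suc (Suc v)) < 2 * Suc k" by (intro mem) simp
      then show "p v \<in> {0..<2 * k}" using ne[of v] j1 jk
        by (auto simp: p_def j_def[symmetric] unskip_def)
    qed
    ultimately show "bij_betw p {0..<2 * k} {0..<2 * k}"
      using endo_inj_surj[of "{0..<2 * k}" p] by (simp add: bij_betw_def)
    show "p v = v" if "v \<notin> {0..<2 * k}" for v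
    proof -
      have "\<pi> (Suc (Suc v)) = Suc (Suc v)" using that by (intro permutes_not_in[OF perm]) simp
      then show ?thesis using that jk by (auto simp: p_def j_def[symmetric] unskip_def)
    qed
  qed
  moreover have "p (2 * i) < p (2 * i + 1)" if "i < k" for i
    using lt[of "Suc i"] that sk[of "2 * i"] sk[of "Suc (2 * i)"] skip_less_iff[of j "p (2 * i)" "p (Suc (2 * i))"] by simp
  moreover have "p (2 * a) < p (2 * b)" if "a < b" "b < k" for a b
    using ord[of "Suc a" "Suc b"] that sk[of "2 * a"] sk[of "2 * b"] skip_less_iff[of j "p (2 * a)" "p (2 * b)"] by simp
  ultimately show "p \<in> matching_perms k" by (simp add: matching_perms_def)
qed

lemma pf_sum_Suc:
  "pf_sum (Suc k) B = (\<Sum>j = 1..2 * k + 1. (-1) ^ (j - 1) * B 0 j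
    * pf_sum k (\<lambda>u v. B (skip j u) (skip j v)))"
proof -
  let ?g = "\<lambda>\<pi>. of_int (sign \<pi>) * (\<Prod>i<Suc k. B (\<pi> (2 * i)) (\<pi> (2 * i + 1)))"
  have "pf_sum (Suc k) B = (\<Sum>(j, p)\<in>{1..2 * k + 1} \<times> matching_perms k. ?g (glue j p))"
    unfolding pf_sum_def
  proof (rule sum.reindex_bij_witness[where i = "\<lambda>(j, p). glue j p"
        and j = "\<lambda>\<pi>. (\<pi> (Suc 0), \<lambda>v. unskip (\<pi> (Suc 0)) (\<pi> (Suc (Suc v))))"])
    fix x assume "x \<in> {1..2 * k + 1} \<times> matching_perms k"
    then obtain j p where x: "x = (j, p)" "1 \<le> j" "j \<le> 2 * k + 1" "p \<in> matching_perms k" by auto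
    show "(case x of (j, p) \<Rightarrow> glue j p) \<in> matching_perms (Suc k)"
      using x matching_perms_glue(1) by simp
    show "((case x of (j, p) \<Rightarrow> glue j p) (Suc 0), \<lambda>v. unskip ((case x of (j, p) \<Rightarrow> glue j p) (Suc 0))
        ((case x of (j, p) \<Rightarrow> glue j p) (Suc (Suc v)))) = x"
      using x by (simp add: glue_simps unskip_skip)
  next
    fix \<pi> assume \<pi>: "\<pi> \<in> matching_perms (Suc k)"
    note U = matching_perms_unglue[OF \<pi>]
    show "(case (\<pi> (Suc 0), \<lambda>v. unskip (\<pi> (Suc 0)) (\<pi> (Suc (Suc v)))) of (j, p) \<Rightarrow> glue j p) = \<pi>"
      using U(4) by simp
    show "(\<pi> (Suc 0), \<lambda>v. unskip (\<pi> (Suc 0)) (\<pi> (Suc (Suc v)))) \<in> {1..2 * k + 1} \<times> matching_perms k"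
      using U(1-3) by simp
    show "(case (\<pi> (Suc 0), \<lambda>v. unskip (\<pi> (Suc 0)) (\<pi> (Suc (Suc v)))) of (j, p) \<Rightarrow> ?g (glue j p)) = ?g \<pi>"
      using U(4) by (simp only: prod.case)
  qed
  also have "\<dots> = (\<Sum>j = 1..2 * k + 1. \<Sum>p\<in>matching_perms k. ?g (glue j p))"
    by (simp only: sum.cartesian_product)
  also have "\<dots> = (\<Sum>j = 1..2 * k + 1. (-1) ^ (j - 1) * B 0 j
    * pf_sum k (\<lambda>u v. B (skip j u) (skip j v)))"
  proof (rule sum.cong[OF refl])
    fix j assume "j \<in> {1..2 * k + 1}"
    then have j: "1 \<le> j" "j \<le> 2 * k + 1" by auto
    have "?g (glue j p) = (-1) ^ (j - 1) * B 0 j * (of_int (sign p)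
        * (\<Prod>i<k. B (skip j (p (2 * i))) (skip j (p (2 * i + 1)))))" if "p \<in> matching_perms k" for p
      unfolding matching_perms_glue(2)[OF that j] prod.lessThan_Suc_shift
      using j(1) by (simp add: glue_simps mult_ac)
    then show "(\<Sum>p\<in>matching_perms k. ?g (glue j p)) = (-1) ^ (j - 1) * B 0 j
        * pf_sum k (\<lambda>u v. B (skip j u) (skip j v))"
      unfolding pf_sum_def sum_distrib_left by (rule sum.cong[OF refl])
  qed
  finally show ?thesis .
qed

text \<open>Pairs are listed in increasing order, so only entries above the diagonal are ever
  read.\<close>

lemma pf_sum_cong:
  assumes "\<And>u v. u < v \<Longrightarrow> v < 2 * k \<Longrightarrow> B u v = C u v"
  shows "pf_sum k B = pf_sum k C"
  unfolding pf_sum_def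
proof (rule sum.cong[OF refl])
  fix \<pi> assume \<pi>: "\<pi> \<in> matching_perms k"
  have "B (\<pi> (2 * i)) (\<pi> (2 * i + 1)) = C (\<pi> (2 * i)) (\<pi> (2 * i + 1))" if "i < k" for i
  proof (rule assms)
    show "\<pi> (2 * i) < \<pi> (2 * i + 1)" using \<pi> that by (simp add: matching_perms_def)
    have "\<pi> permutes {0..<2 * k}" using \<pi> by (simp add: matching_perms_def)
    then show "\<pi> (2 * i + 1) < 2 * k" using permutes_in_image[of \<pi> "{0..<2 * k}" "2 * i + 1"] that by simp
  qed
  then show "of_int (sign \<pi>) * (\<Prod>i<k. B (\<pi> (2 * i)) (\<pi> (2 * i + 1)))
    = of_int (sign \<pi>) * (\<Prod>i<k. C (\<pi> (2 * i)) (\<pi> (2 * i + 1)))" by simp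
qed

lemma matching_perms_0: "matching_perms 0 = {id}"
  by (auto simp: matching_perms_def)

lemma pf_sum_0: "pf_sum 0 B = 1"
  by (simp add: pf_sum_def matching_perms_0)

text \<open>Expansion along the first row determines the Pfaffian, so a function of lists obeying
  the same recursion computes it. This is how Schur's Pfaffian is applied to sums without expanding
  them into matrices.\<close>

lemma pf_sum_list:
  fixes W :: "'b list \<Rightarrow> 'a::comm_ring_1"
  assumes W0: "W [] = 1"
    and W: "\<And>x xs. distinct (x # xs) \<Longrightarrow> odd (length xs) \<Longrightarrow>
      W (x # xs) = (\<Sum>j<length xs. (-1) ^ j * A x (xs ! j) * W (take j xs @ drop (Suc j) xs))"
  shows "distinct ls \<Longrightarrow> length ls = 2 * k \<Longrightarrow> pf_sum k (\<lambda>u v. A (ls ! u) (ls ! v)) = W ls"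
proof (induction k arbitrary: ls)
  case 0
  then show ?case by (simp add: pf_sum_0 W0)
next
  case (Suc k)
  then obtain x xs where ls: "ls = x # xs" "length xs = 2 * k + 1" by (cases ls) auto
  have "pf_sum (Suc k) (\<lambda>u v. A (ls ! u) (ls ! v)) = (\<Sum>j = 1..2 * k + 1. (-1) ^ (j - 1) * A x (ls ! j)
      * pf_sum k (\<lambda>u v. A (ls ! skip j u) (ls ! skip j v)))"
    by (simp add: pf_sum_Suc ls)
  also have "\<dots> = (\<Sum>j<length xs. (-1) ^ j * A x (xs ! j)
      * pf_sum k (\<lambda>u v. A (ls ! skip (Suc j) u) (ls ! skip (Suc j) v)))"
    by (rule sum.reindex_bij_witness[where i = Suc and j = "\<lambda>j. j - 1"]) (auto simp: ls)
  also have "\<dots> = (\<Sum>j<length xs. (-1) ^ j * A x (xs ! j) * W (take j xs @ drop (Suc j) xs))"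
  proof (rule sum.cong[OF refl])
    fix j assume "j \<in> {..<length xs}"
    then have j: "j < length xs" by simp
    let ?ys = "take j xs @ drop (Suc j) xs"
    have l: "length ?ys = 2 * k" using j ls by simp
    have nth: "ls ! skip (Suc j) u = ?ys ! u" if "u < 2 * k" for u
      using that j ls by (auto simp: skip_def nth_append min_def)
    have "pf_sum k (\<lambda>u v. A (ls ! skip (Suc j) u) (ls ! skip (Suc j) v)) = pf_sum k (\<lambda>u v. A (?ys ! u) (?ys ! v))"
      by (rule pf_sum_cong) (simp add: nth)
    also have "\<dots> = W ?ys"
    proof (rule Suc.IH[OF _ l])
      have "distinct (take j xs @ xs ! j # drop (Suc j) xs)"
        using Suc.prems(1) j by (simp add: ls id_take_nth_drop[symmetric])
      then show "distinct ?ys" by auto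
    qed
    finally show "(-1) ^ j * A x (xs ! j) * pf_sum k (\<lambda>u v. A (ls ! skip (Suc j) u) (ls ! skip (Suc j) v))
      = (-1) ^ j * A x (xs ! j) * W ?ys" by simp
  qed
  also have "\<dots> = W ls" using W[of x xs] Suc.prems(1) ls by simp
  finally show ?case .
qed

section \<open>Schur's Pfaffian\<close>

text \<open>Lagrange interpolation in t: the leading terms cancel on the left, so both sides have
  degree below the size of J and are determined by the values at t = g j, where the second product
  vanishes.\<close>

lemma lagrange_difference:
  fixes g :: "'i \<Rightarrow> 'k::field"
  assumes fin: "finite J" and inj: "inj_on g J"
  shows "(\<Prod>l\<in>J. t + g l) - (\<Prod>l\<in>J. t - g l)
    = (\<Sum>j\<in>J. 2 * g j * (\<Prod>l\<in>J - {j}. (g j + g l) / (g j - g l)) * (\<Prod>l\<in>J - {j}. t - g l))"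
proof -
  let ?q = "\<lambda>j. \<Prod>l\<in>J - {j}. (g j + g l) / (g j - g l)"
  define P where "P = (\<Prod>l\<in>J. [:g l, 1:])"
  define R where "R = (\<Prod>l\<in>J. [:- g l, 1:])"
  define S where "S = (\<Sum>j\<in>J. Polynomial.smult (2 * g j * ?q j) (\<Prod>l\<in>J - {j}. [:- g l, 1:]))"
  have lin: "coeff (\<Prod>l\<in>A. [:h l, 1:]) (card A) = 1" "Polynomial.degree (\<Prod>l\<in>A. [:h l, 1:]) = card A"
    if "finite A" for A and h :: "'i \<Rightarrow> 'k"
  proof -
    show d: "Polynomial.degree (\<Prod>l\<in>A. [:h l, 1:]) = card A"
      using that by (simp add: degree_prod_eq_sum_degree)
    have "lead_coeff (\<Prod>l\<in>A. [:h l, 1:]) = (\<Prod>l\<in>A. lead_coeff [:h l, 1:])" by (rule lead_coeff_prod)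
    also have "\<dots> = 1" by simp
    finally show "coeff (\<Prod>l\<in>A. [:h l, 1:]) (card A) = 1" unfolding d .
  qed
  have "P = R + S"
  proof (rule poly_eqI_degree_lead_coeff[where n = "card J" and A = "g ` J"])
    show "card J \<le> card (g ` J)" by (simp add: card_image[OF inj])
    have dS: "Polynomial.degree S < card J" if "J \<noteq> {}"
      unfolding S_def
    proof (rule degree_sum_less)
      fix j assume j: "j \<in> J"
      have "Polynomial.degree (Polynomial.smult (2 * g j * ?q j) (\<Prod>l\<in>J - {j}. [:- g l, 1:]))
          \<le> Polynomial.degree (\<Prod>l\<in>J - {j}. [:- g l, 1:])" by (rule degree_smult_le)
      also have "\<dots> = card (J - {j})" using fin by (intro lin(2)) simp
      also have "\<dots> < card J" using fin j by (rule card_Diff1_less)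
      finally show "Polynomial.degree (Polynomial.smult (2 * g j * ?q j) (\<Prod>l\<in>J - {j}. [:- g l, 1:])) < card J" .
    qed (use that fin in \<open>simp add: card_gt_0_iff\<close>)
    have S0: "S = 0" if "J = {}" using that by (simp add: S_def)
    have cS: "coeff S (card J) = 0" using dS S0 by (cases "J = {}") (auto intro: coeff_eq_0)
    have cP: "coeff P (card J) = 1" "coeff R (card J) = 1"
      using lin(1)[OF fin, of g] lin(1)[OF fin, of "\<lambda>l. - g l"] by (simp_all add: P_def R_def)
    show "coeff P (card J) = coeff (R + S) (card J)" using cS cP by simp
    show "Polynomial.degree P \<le> card J" using lin(2)[OF fin, of g] by (simp add: P_def)
    have "Polynomial.degree R \<le> card J" using lin(2)[OF fin, of "\<lambda>l. - g l"] by (simp add: R_def)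
    moreover have "Polynomial.degree S \<le> card J" using dS S0 by (cases "J = {}") auto
    ultimately show "Polynomial.degree (R + S) \<le> card J" by (rule degree_add_le)
    fix z assume "z \<in> g ` J"
    then obtain m where m: "m \<in> J" "z = g m" by blast
    have R0: "poly R z = 0" using m fin by (auto simp: R_def poly_prod)
    have "poly S z = (\<Sum>j\<in>J. 2 * g j * ?q j * (\<Prod>l\<in>J - {j}. g m - g l))"
      by (simp add: S_def m(2) poly_sum poly_prod)
    also have "\<dots> = 2 * g m * ?q m * (\<Prod>l\<in>J - {m}. g m - g l)"
    proof (subst sum.remove[OF fin m(1)])
      have "(\<Prod>l\<in>J - {j}. g m - g l) = 0" if "j \<in> J - {m}" for j
        using that m(1) fin by (intro prod_zero) auto
      then show "2 * g m * ?q m * (\<Prod>l\<in>J - {m}. g m - g l)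
          + (\<Sum>j\<in>J - {m}. 2 * g j * ?q j * (\<Prod>l\<in>J - {j}. g m - g l))
        = 2 * g m * ?q m * (\<Prod>l\<in>J - {m}. g m - g l)" by simp
    qed
    also have "\<dots> = 2 * g m * (\<Prod>l\<in>J - {m}. (g m + g l) / (g m - g l) * (g m - g l))"
      by (simp only: prod.distrib mult.assoc)
    also have "(\<Prod>l\<in>J - {m}. (g m + g l) / (g m - g l) * (g m - g l)) = (\<Prod>l\<in>J - {m}. g m + g l)"
    proof (rule prod.cong[OF refl])
      fix l assume "l \<in> J - {m}"
      then have "g m - g l \<noteq> 0" using inj_onD[OF inj, of m l] m(1) by auto
      then show "(g m + g l) / (g m - g l) * (g m - g l) = g m + g l" by simp
    qed
    also have "2 * g m * \<dots> = (\<Prod>l\<in>J. g m + g l)"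
      unfolding prod.remove[OF fin m(1), of "\<lambda>l. g m + g l"] mult_2 ..
    finally have "poly S z = (\<Prod>l\<in>J. g m + g l)" .
    moreover have "poly P z = (\<Prod>l\<in>J. g m + g l)"
      unfolding P_def m(2) poly_prod by (rule prod.cong[OF refl]) (simp add: add.commute)
    ultimately show "poly P z = poly (R + S) z" by (simp only: poly_add R0 add_0_left)
  qed
  then have "poly P t = poly R t + poly S t" by simp
  then show ?thesis by (simp add: P_def R_def S_def poly_prod poly_sum add.commute)
qed

text \<open>\<open>lagrange_difference\<close> at t = g m shows that adding a node m turns the sum S
  into 1 - S, so it alternates between 0 and 1.\<close>

lemma sum_quotients:
  fixes g :: "'i \<Rightarrow> 'k::field"
  assumes "finite J" "inj_on g J"
  shows "(\<Sum>j\<in>J. \<Prod>l\<in>J - {j}. (g j + g l) / (g j - g l)) = (if odd (card J) then 1 else 0)"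
  using assms
proof (induction J rule: finite_induct)
  case (insert m J)
  let ?q = "\<lambda>J j. \<Prod>l\<in>J - {j}. (g j + g l) / (g j - g l)"
  have inj: "inj_on g J" using insert.prems by simp
  have ne: "g m - g l \<noteq> 0" if "l \<in> J" for l using that insert.prems insert.hyps by auto
  let ?R = "\<Prod>l\<in>J. g m - g l"
  have R: "?R \<noteq> 0" using ne insert.hyps(1) by simp
  have qm: "?q (insert m J) m = (\<Prod>l\<in>J. g m + g l) / ?R"
    using insert.hyps by (simp add: prod_dividef)
  have "(\<Prod>l\<in>J. g m + g l) - ?R = (\<Sum>j\<in>J. 2 * g j * ?q J j * (\<Prod>l\<in>J - {j}. g m - g l))"
    by (rule lagrange_difference[OF insert.hyps(1) inj])
  also have "\<dots> = (\<Sum>j\<in>J. 2 * g j * ?q J j / (g m - g j)) * ?R"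
    unfolding sum_distrib_right
  proof (intro sum.cong refl)
    fix j assume j: "j \<in> J"
    show "2 * g j * ?q J j * (\<Prod>l\<in>J - {j}. g m - g l) = 2 * g j * ?q J j / (g m - g j) * ?R"
      unfolding prod.remove[OF insert.hyps(1) j, of "\<lambda>l. g m - g l"] using ne[OF j] by simp
  qed
  finally have E: "?q (insert m J) m = 1 + (\<Sum>j\<in>J. 2 * g j * ?q J j / (g m - g j))"
    unfolding qm using R by (simp add: field_simps)
  have "?q (insert m J) j = - ?q J j - 2 * g j * ?q J j / (g m - g j)" if j: "j \<in> J" for j
  proof -
    have "insert m J - {j} = insert m (J - {j})" using j insert.hyps by auto
    then have "?q (insert m J) j = (g j + g m) / (g j - g m) * ?q J j"
      using insert.hyps by simp
    moreover have "(g j + g m) / (g j - g m) = - 1 - 2 * g j / (g m - g j)"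
    proof -
      have "g j - g m \<noteq> 0" using ne[OF j] by simp
      then show ?thesis using ne[OF j] by (simp add: divide_simps) (simp add: algebra_simps)
    qed
    ultimately show ?thesis by (simp add: algebra_simps)
  qed
  then have "(\<Sum>j\<in>J. ?q (insert m J) j) = - (\<Sum>j\<in>J. ?q J j) - (\<Sum>j\<in>J. 2 * g j * ?q J j / (g m - g j))"
    by (simp add: sum_subtractf sum_negf)
  then have "(\<Sum>j\<in>insert m J. ?q (insert m J) j) = 1 - (\<Sum>j\<in>J. ?q J j)"
    using insert.hyps E by simp
  then show ?case using insert.IH[OF inj] insert.hyps by simp
qed simp

text \<open>\<open>lagrange_difference\<close> at t = -z, where odd cardinality fixes the signs,
  gives the expansion with numerators 2 g j; subtracting it from 1, written as the sum in
  \<open>sum_quotients\<close>, produces the quotients (z - g j) / (z + g j).\<close>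

lemma partial_fractions:
  fixes g :: "'i \<Rightarrow> 'k::field"
  assumes fin: "finite J" and inj: "inj_on g J" and odd: "odd (card J)" and z: "\<And>l. l \<in> J \<Longrightarrow> z + g l \<noteq> 0"
  shows "(\<Prod>l\<in>J. (z - g l) / (z + g l))
    = (\<Sum>j\<in>J. (z - g j) / (z + g j) * (\<Prod>l\<in>J - {j}. (g j + g l) / (g j - g l)))"
proof -
  let ?q = "\<lambda>j. \<Prod>l\<in>J - {j}. (g j + g l) / (g j - g l)"
  let ?Q = "\<Prod>l\<in>J. z + g l" and ?L = "\<Prod>l\<in>J. z - g l"
  have Q: "?Q \<noteq> 0" using fin z by simp
  have neg: "(\<Prod>l\<in>A. - f l) = (-1) ^ card A * (\<Prod>l\<in>A. f l)" for A and f :: "'i \<Rightarrow> 'k"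
    using prod.distrib[of "\<lambda>_. -1" f A] by simp
  have "(\<Prod>l\<in>J. - z + g l) = - ?L" using neg[of "\<lambda>l. z - g l" J] odd by (simp add: minus_one_power_iff)
  moreover have "(\<Prod>l\<in>J. - z - g l) = - ?Q" using neg[of "\<lambda>l. z + g l" J] odd by (simp add: minus_one_power_iff)
  moreover have "(\<Prod>l\<in>J - {j}. - z - g l) = ?Q / (z + g j)" if j: "j \<in> J" for j
  proof -
    have "even (card (J - {j}))" using odd j fin by (simp add: card_Diff_singleton)
    then have "(\<Prod>l\<in>J - {j}. - z - g l) = (\<Prod>l\<in>J - {j}. z + g l)"
      using neg[of "\<lambda>l. z + g l" "J - {j}"] by (simp add: minus_one_power_iff)
    then show ?thesis unfolding prod.remove[OF fin j, of "\<lambda>l. z + g l"] using z[OF j] by simp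
  qed
  ultimately have "?Q - ?L = (\<Sum>j\<in>J. 2 * g j * ?q j * (?Q / (z + g j)))"
    using lagrange_difference[OF fin inj, of "- z"] by simp
  also have "\<dots> = ?Q * (\<Sum>j\<in>J. 2 * g j / (z + g j) * ?q j)"
    unfolding sum_distrib_left by (intro sum.cong refl) simp
  finally have "?L / ?Q = 1 - (\<Sum>j\<in>J. 2 * g j / (z + g j) * ?q j)"
    using Q by (simp add: field_simps)
  also have "1 = (\<Sum>j\<in>J. ?q j)" using sum_quotients[OF fin inj] odd by simp
  also have "(\<Sum>j\<in>J. ?q j) - (\<Sum>j\<in>J. 2 * g j / (z + g j) * ?q j) = (\<Sum>j\<in>J. (z - g j) / (z + g j) * ?q j)"
    unfolding sum_subtractf[symmetric]
  proof (intro sum.cong refl)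
    fix j assume "j \<in> J"
    then have "(z - g j) / (z + g j) = 1 - 2 * g j / (z + g j)" using z[of j] by (simp add: field_simps)
    then show "?q j - 2 * g j / (z + g j) * ?q j = (z - g j) / (z + g j) * ?q j" by (simp add: left_diff_distrib)
  qed
  finally show ?thesis by (simp add: prod_dividef)
qed

lemma sg_antisym: "sg p i j = - sg p j i"
proof -
  have "(p j - p i) / (p j + p i) = - ((p i - p j) / (p i + p j))"
    unfolding minus_divide_left by (simp add: add.commute)
  then show ?thesis by (simp add: sg_def)
qed

lemma prod_list_uminus:
  fixes f :: "'i \<Rightarrow> 'k::field"
  shows "prod_list (map (\<lambda>i. - f i) xs) = (-1) ^ length xs * prod_list (map f xs)"
  by (induction xs) simp_all

text \<open>Carrying b past \<open>as\<close> to the front flips one antisymmetric quotient per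
  element.\<close>

lemma Vl_insert:
  "Vl p (as @ b # bs) = (-1) ^ length as * Vl p (as @ bs) * prod_list (map (sg p b) (as @ bs))"
proof -
  have 1: "prod_list (map (\<lambda>i. sg p i b) as) = (-1) ^ length as * prod_list (map (sg p b) as)"
    using prod_list_uminus[of "sg p b" as] by (simp add: sg_antisym[of p _ b])
  have "prod_list (map (\<lambda>i. sg p i b * f i) as) = prod_list (map (\<lambda>i. sg p i b) as) * prod_list (map f as)"
    for f by (induction as) simp_all
  then have 2: "prod_list (map (\<lambda>i. sg p i b * f i) as)
      = (-1) ^ length as * prod_list (map (sg p b) as) * prod_list (map f as)" for f
    unfolding 1 .
  show ?thesis
    by (simp only: Vl_append list.map prod_list.Cons Vl.simps map_append prod_list.append 2 mult_ac)
qed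

lemma Vl_not_distinct:
  assumes "\<not> distinct is"
  shows "Vl p is = 0"
proof -
  obtain as y bs cs where "is = as @ y # bs @ y # cs" using not_distinct_decomp[OF assms] by auto
  then have "is = (as @ y # bs) @ y # cs" by simp
  then show ?thesis using Vl_repeat[of y "as @ y # bs" p cs] by simp
qed

text \<open>\<open>g i = 1 / p i\<close>, which makes the point at infinity an ordinary one.\<close>
lemma sg_eq_quotient:
  assumes "good_pt p" "i \<noteq> 0 \<or> j \<noteq> 0"
  defines "g \<equiv> \<lambda>i. if i = 0 then 0 else 1 / p i"
  shows "g i + g j \<noteq> 0" "sg p i j = (g i - g j) / (g i + g j)"
proof -
  have nz: "p k \<noteq> 0" for k using good_pt_add[OF assms(1), of k k] by auto
  have s: "p i + p j \<noteq> 0" "p j + p i \<noteq> 0" using good_pt_add[OF assms(1)] by auto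
  show "g i + g j \<noteq> 0"
    using assms(2) nz[of i] nz[of j] s by (auto simp: g_def field_simps)
  show "sg p i j = (g i - g j) / (g i + g j)"
  proof (cases "i = 0 \<or> j = 0")
    case True
    then show ?thesis using assms(2) nz[of i] nz[of j] by (auto simp: g_def sg_def)
  next
    case False
    have "(1 / p i - 1 / p j) = (p j - p i) / (p i * p j)" "(1 / p i + 1 / p j) = (p j + p i) / (p i * p j)"
      using nz[of i] nz[of j] by (simp_all add: field_simps)
    then show ?thesis using False nz[of i] nz[of j] by (simp add: g_def sg_def)
  qed
qed

text \<open>Schur's Pfaffian as a recursion. For distinct entries, dropping the entry j multiplies
  \<open>Vl p is\<close>, up to sign, by the product q of inverse quotients; what remains is
  \<open>partial_fractions\<close> with z = g i. Two indices at infinity have no such quotient, so i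
  = 0 must not recur in \<open>is\<close>.\<close>

lemma Vl_expand:
  assumes p: "good_pt p" and odd: "odd (length is)" and i: "i = 0 \<longrightarrow> 0 \<notin> set is"
  shows "Vl p (i # is) = (\<Sum>j<length is. (-1) ^ j * sg p i (is ! j) * Vl p (take j is @ drop (Suc j) is))"
proof (cases "distinct is")
  case True
  define g where "g i = (if i = 0 then 0 else 1 / p i)" for i
  define J where "J = set is"
  define q where "q b = (\<Prod>l\<in>J - {b}. (g b + g l) / (g b - g l))" for b
  have nz: "p k \<noteq> 0" for k using good_pt_add[OF p, of k k] by auto
  have inj: "inj_on g J"
  proof (rule inj_onI)
    fix a b assume "g a = g b"
    then show "a = b" using nz[of a] nz[of b] p
      by (auto simp: g_def good_pt_def inj_eq split: if_splits)
  qed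
  \<comment> \<open>The sign from moving the entry to the front is exactly the sign of the
    expansion.\<close>
  have trm: "(-1) ^ j * Vl p (take j is @ drop (Suc j) is) = Vl p is * q (is ! j)" if j: "j < length is" for j
  proof -
    define as bs b where "as = take j is" and "bs = drop (Suc j) is" and "b = is ! j"
    have s: "is = as @ b # bs" using j by (simp add: as_def bs_def b_def id_take_nth_drop)
    have la: "length as = j" using j by (simp add: as_def)
    have d: "distinct (as @ bs)" "J - {b} = set (as @ bs)" using True by (auto simp: s J_def)
    let ?P = "prod_list (map (sg p b) (as @ bs))"
    have P: "?P = (\<Prod>l\<in>J - {b}. sg p b l)"
      unfolding d(2) by (rule prod.distinct_set_conv_list[OF d(1), symmetric])
    have "?P * q b = (\<Prod>l\<in>J - {b}. sg p b l * ((g b + g l) / (g b - g l)))"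
      unfolding P q_def by (simp only: prod.distrib)
    also have "\<dots> = 1"
    proof (rule prod.neutral, rule ballI)
      fix l assume l: "l \<in> J - {b}"
      then have "b \<noteq> 0 \<or> l \<noteq> 0" by auto
      note S = sg_eq_quotient[OF p this, folded g_def]
      have "b \<in> J" by (simp add: J_def s)
      then have "g b - g l \<noteq> 0" using inj l by (auto simp: inj_on_def)
      then show "sg p b l * ((g b + g l) / (g b - g l)) = 1" using S by simp
    qed
    finally have 1: "?P * q b = 1" .
    have "Vl p is * q b = (-1) ^ j * Vl p (as @ bs) * (?P * q b)"
      by (subst s) (simp only: Vl_insert la mult.assoc)
    then show ?thesis unfolding 1 by (simp add: as_def bs_def b_def)
  qed
  have "(\<Sum>j<length is. (-1) ^ j * sg p i (is ! j) * Vl p (take j is @ drop (Suc j) is))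
      = (\<Sum>j<length is. Vl p is * (sg p i (is ! j) * q (is ! j)))"
  proof (rule sum.cong[OF refl])
    fix j assume "j \<in> {..<length is}"
    then have "(-1) ^ j * Vl p (take j is @ drop (Suc j) is) = Vl p is * q (is ! j)" by (intro trm) simp
    then show "(-1) ^ j * sg p i (is ! j) * Vl p (take j is @ drop (Suc j) is) = Vl p is * (sg p i (is ! j) * q (is ! j))"
      by (metis mult.assoc mult.commute)
  qed
  also have "\<dots> = Vl p is * (\<Sum>b\<in>J. sg p i b * q b)"
    unfolding sum_distrib_left[symmetric] J_def
    using sum.reindex_bij_betw[OF bij_betw_nth[OF True refl refl], of "\<lambda>b. sg p i b * q b"] by simp
  also have "(\<Sum>b\<in>J. sg p i b * q b) = (\<Prod>b\<in>J. sg p i b)"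
  proof -
    have S: "g i + g b \<noteq> 0" "sg p i b = (g i - g b) / (g i + g b)" if "b \<in> J" for b
    proof -
      have "i \<noteq> 0 \<or> b \<noteq> 0" using i that by (auto simp: J_def)
      then show "g i + g b \<noteq> 0" "sg p i b = (g i - g b) / (g i + g b)"
        using sg_eq_quotient[OF p, folded g_def] by auto
    qed
    have "(\<Prod>b\<in>J. (g i - g b) / (g i + g b)) = (\<Sum>b\<in>J. (g i - g b) / (g i + g b) * q b)"
      unfolding q_def using inj S(1) odd distinct_card[OF True]
      by (intro partial_fractions) (auto simp: J_def)
    then show ?thesis using S(2) by simp
  qed
  also have "Vl p is * (\<Prod>b\<in>J. sg p i b) = Vl p (i # is)"
    unfolding J_def prod.distinct_set_conv_list[OF True] by simp
  finally show ?thesis by simp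
next
  case False
  text \<open>If an index occurs twice, only the two terms omitting one copy of it survive, and they cancel.\<close>
  obtain as y bs cs where s: "is = as @ y # bs @ y # cs" using not_distinct_decomp[OF False] by auto
  let ?a = "length as" and ?b = "Suc (length as + length bs)"
  let ?t = "\<lambda>j. (-1) ^ j * sg p i (is ! j) * Vl p (take j is @ drop (Suc j) is)"
  have zero: "?t j = 0" if j: "j \<in> {..<length is} - {?a, ?b}" for j
  proof -
    have "\<not> distinct (take j is @ drop (Suc j) is)"
    proof -
      consider "j < ?a" | m where "j = Suc (?a + m)" "m < length bs" | m where "j = Suc (Suc (?a + length bs + m))"
      proof -
        have "j < ?a \<or> (?a < j \<and> j < ?b) \<or> ?b < j" using j by auto
        then show thesis
        proof (elim disjE conjE)
          assume "?a < j" "j < ?b"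
          then show thesis using that(2)[of "j - Suc ?a"] by simp
        next
          assume "?b < j"
          then show thesis using that(3)[of "j - Suc ?b"] by simp
        qed (use that in blast)
      qed
      then show ?thesis by cases (simp_all add: s)
    qed
    then have "Vl p (take j is @ drop (Suc j) is) = 0" by (rule Vl_not_distinct)
    then show ?thesis by (simp only: mult_zero_right)
  qed
  have "(\<Sum>j<length is. ?t j) = (\<Sum>j\<in>{?a, ?b}. ?t j)"
    using zero by (intro sum.mono_neutral_right) (auto simp: s)
  also have "\<dots> = ?t ?a + ?t ?b" by simp
  also have "?t ?a = (-1) ^ ?a * sg p i y * Vl p ((as @ bs) @ y # cs)" by (simp add: s)
  also have "\<dots> = (-1) ^ length bs * (sg p i y * Vl p (as @ bs @ cs) * prod_list (map (sg p y) (as @ bs @ cs)))"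
    unfolding Vl_insert by (simp add: power_add mult_ac flip: power_mult_distrib)
  also have "?t ?b = (-1) ^ ?b * sg p i y * Vl p (as @ y # (bs @ cs))" by (simp add: s nth_append)
  also have "\<dots> = - ((-1) ^ length bs * (sg p i y * Vl p (as @ bs @ cs) * prod_list (map (sg p y) (as @ bs @ cs))))"
    unfolding Vl_insert by (simp add: power_add mult_ac flip: power_mult_distrib)
  finally have "(\<Sum>j<length is. ?t j) = 0" by simp
  moreover have "Vl p (i # is) = 0" by (rule Vl_not_distinct) (simp add: s)
  ultimately show ?thesis by simp
qed

text \<open>Expanding under the sums, term j couples only the first index and index j. These two
  sums split off as the value for the two-element list, and the others form the value for the
  shorter list: this is the linearity of the Pfaffian in each index.\<close>

lemma sumL_expand:
  assumes p: "good_pt p" and d: "distinct (x # xs)" and odd: "odd (length xs)"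
  shows "sumL n p (x # xs) (Vl p) = (\<Sum>j<length xs. (-1) ^ j * sumL n p [x, xs ! j] (Vl p)
    * sumL n p (take j xs @ drop (Suc j) xs) (Vl p))"
proof -
  have "sumL n p (x # xs) (Vl p) = sumL n p (x # xs) (\<lambda>is. \<Sum>j<length xs. (-1) ^ j
      * (sg p (hd is) (tl is ! j) * Vl p (take j (tl is) @ drop (Suc j) (tl is))))"
  proof (rule sumL_cong)
    fix "is" assume "list_all2 (\<lambda>i a. i \<in> ix a) is (x # xs)"
    then obtain i js where s: "is = i # js" "i \<in> ix x" "list_all2 (\<lambda>i a. i \<in> ix a) js xs"
      by (auto simp: list_all2_Cons2)
    have len: "length js = length xs" using s(3) by (rule list_all2_lengthD)
    have ix0: "0 \<in> ix a \<Longrightarrow> a = 0" for a by (auto simp: ix_def split: if_splits)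
    \<comment> \<open>An index 0 comes only from an entry 0, and distinctness allows just one of
      these.\<close>
    have "0 \<notin> set js" if "i = 0"
    proof
      assume "0 \<in> set js"
      then obtain k where "k < length xs" "0 \<in> ix (xs ! k)"
        using s(3) len by (metis in_set_conv_nth list_all2_nthD)
      then have "0 \<in> set xs" using ix0 nth_mem by metis
      moreover have "x = 0" using s(2) that ix0 by simp
      ultimately show False using d by simp
    qed
    then show "Vl p is = (\<Sum>j<length xs. (-1) ^ j
      * (sg p (hd is) (tl is ! j) * Vl p (take j (tl is) @ drop (Suc j) (tl is))))"
      using Vl_expand[OF p, of js i] odd len s(1) by (simp add: mult.assoc)
  qed
  also have "\<dots> = (\<Sum>j<length xs. (-1) ^ j * sumL n p (x # xs)
      (\<lambda>is. sg p (hd is) (tl is ! j) * Vl p (take j (tl is) @ drop (Suc j) (tl is))))"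
    by (simp only: sumL_sum sumL_scale)
  also have "\<dots> = (\<Sum>j<length xs. (-1) ^ j * sumL n p [x, xs ! j] (Vl p)
    * sumL n p (take j xs @ drop (Suc j) xs) (Vl p))"
  proof (rule sum.cong[OF refl])
    fix j assume "j \<in> {..<length xs}"
    then have j: "j < length xs" by simp
    define as bs b where "as = take j xs" and "bs = drop (Suc j) xs" and "b = xs ! j"
    have s: "xs = as @ b # bs" using j by (simp add: as_def bs_def b_def id_take_nth_drop)
    have la: "length as = j" using j by (simp add: as_def)
    let ?h = "\<lambda>i ks. sg p i (ks ! j) * Vl p (take j ks @ drop (Suc j) ks)"
    have "sumL n p xs (?h i) = (\<Sum>i'\<in>ix b. cf n p b i' * (sg p i i' * sumL n p (as @ bs) (Vl p)))" for i
    proof -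
      have "sumL n p as (\<lambda>is. sumL n p bs (\<lambda>js. ?h i (is @ i' # js)))
          = sumL n p as (\<lambda>is. sumL n p bs (\<lambda>js. sg p i i' * Vl p (is @ js)))" for i'
      proof (rule sumL_cong)
        fix "is" assume "list_all2 (\<lambda>i a. i \<in> ix a) is as"
        then have "length is = j" using la by (simp add: list_all2_lengthD)
        then show "sumL n p bs (\<lambda>js. ?h i (is @ i' # js)) = sumL n p bs (\<lambda>js. sg p i i' * Vl p (is @ js))"
          by (simp add: nth_append)
      qed
      then show ?thesis unfolding s sumL_isolate by (simp add: sumL_scale sumL_append)
    qed
    then have "sumL n p (x # xs) (\<lambda>is. ?h (hd is) (tl is))
        = (\<Sum>i\<in>ix x. cf n p x i * (\<Sum>i'\<in>ix b. cf n p b i' * (sg p i i' * sumL n p (as @ bs) (Vl p))))"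
      by simp
    also have "\<dots> = sumL n p [x, b] (Vl p) * sumL n p (as @ bs) (Vl p)"
      by (simp add: sum_distrib_left sum_distrib_right mult_ac)
    finally show "(-1) ^ j * sumL n p (x # xs) (\<lambda>is. ?h (hd is) (tl is))
      = (-1) ^ j * sumL n p [x, xs ! j] (Vl p) * sumL n p (take j xs @ drop (Suc j) xs) (Vl p)"
      by (simp add: as_def bs_def b_def mult.assoc)
  qed
  finally show ?thesis .
qed

text \<open>The padding index has weight 1 and its quotient with every nonzero index is 1, so
  appending 0 changes nothing.\<close>

lemma sumL_snoc_0:
  assumes "0 \<notin> set as"
  shows "sumL n p (as @ [0]) (Vl p) = sumL n p as (Vl p)"
  unfolding sumL_append
proof (rule sumL_cong)
  fix "is" assume l: "list_all2 (\<lambda>i a. i \<in> ix a) is as"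
  have "i \<noteq> 0" if "i \<in> set is" for i
  proof -
    have "\<exists>k<length is. is ! k = i" using that by (simp only: in_set_conv_nth)
    then obtain k where k: "k < length is" "is ! k = i" by blast
    have "i \<in> ix (as ! k)" using list_all2_nthD[OF l k(1)] by (simp only: k(2))
    moreover have "as ! k \<in> set as" using list_all2_lengthD[OF l] k(1) by (intro nth_mem) simp
    then have "as ! k \<noteq> 0" using assms by metis
    ultimately show ?thesis by (simp add: ix_def)
  qed
  then have "prod_list (map (\<lambda>i. sg p i 0) is) = 1" by (induction "is") (auto simp: sg_def)
  then show "sumL n p [0] (\<lambda>js. Vl p (is @ js)) = Vl p is"
    by (simp add: ix_def cf_def Vl_append)
qed

lemma ev_pfaffian:
  "ev p (pfaffian (skew_mat (2 * k) a)) = pf_sum k (\<lambda>u v. ev p (a (u + 1) (v + 1)))"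
proof -
  have "pfaffian (skew_mat (2 * k) a)
    = (\<Sum>\<pi>\<in>matching_perms k. of_int (sign \<pi>) * (\<Prod>i<k. skew_mat (2 * k) a $$ (\<pi> (2 * i), \<pi> (2 * i + 1))))"
    by (simp add: pfaffian_def skew_mat_def Let_def)
  also have "\<dots> = pf_sum k (\<lambda>u v. skew_mat (2 * k) a $$ (u, v))" by (simp add: pf_sum_def)
  also have "\<dots> = pf_sum k (\<lambda>u v. a (u + 1) (v + 1))"
    by (rule pf_sum_cong) (simp add: skew_mat_def)
  finally show ?thesis by (simp add: pf_sum_def ev_sum ev_prod)
qed

theorem theorem4p78:
  fixes n r :: nat and \<phi> :: "nat \<Rightarrow> nat"
  assumes "0 < n" and "0 < r"
    and "strict_mono_on {1..r} \<phi>"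
    and "\<forall>i\<in>{1..r}. 0 < \<phi> i \<and> \<phi> i \<le> n"
    and "\<phi> (r + 1) = 0"
  shows "inv_schubert_grass (map \<phi> [1..<r + 1]) n =
    pfaffian (skew_mat (ell_plus r) (\<lambda>i j. inv_schubert_grass [\<phi> i, \<phi> j] n))"
proof (rule ev_gen_pt_eqD)
  have p: "good_pt gen_pt" using inj_gen_pt gen_pt_add_neq_0 by (simp add: good_pt_def)
  let ?ls = "map \<phi> [1..<r + 1]"
  \<comment> \<open>The sequence padded to even length; k is the number of pairs in a
    matching.\<close>
  define L where "L = (if even r then ?ls else ?ls @ [0])"
  define k where "k = (r + 1) div 2"
  have ell: "ell_plus r = 2 * k" unfolding ell_plus_def k_def by (cases "even r") presburger+
  have lenL: "length L = 2 * k" unfolding ell[symmetric] by (simp add: L_def ell_plus_def)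
  have less: "\<phi> i < \<phi> j" if "1 \<le> i" "i < j" "j \<le> r" for i j
    using assms(3) that by (auto simp: strict_mono_on_def)
  have sorted: "sorted_wrt (<) ?ls"
    unfolding sorted_wrt_map by (rule sorted_wrt_mono_rel[OF _ sorted_wrt_upt]) (use less in auto)
  have rng: "\<forall>x\<in>set ?ls. 1 \<le> x \<and> x \<le> n"
  proof
    fix x assume "x \<in> set ?ls"
    then obtain i where "i \<in> {1..r}" "x = \<phi> i" by fastforce
    then show "1 \<le> x \<and> x \<le> n" using bspec[OF assms(4), of i] by simp
  qed
  then have z: "0 \<notin> set ?ls" by (metis not_one_le_zero)
  have d: "distinct L"
    using z sorted by (simp add: L_def strict_sorted_iff del: upt_Suc set_map set_upt)
  have nthL: "L ! u = \<phi> (u + 1)" if "u < 2 * k" for u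
  proof (cases "u < r")
    case True
    then show ?thesis by (simp add: L_def nth_append del: upt_Suc)
  next
    case False
    then have u: "odd r" "u = r" using that unfolding ell[symmetric] by (auto simp: ell_plus_def split: if_splits)
    have "length ?ls = r" by simp
    then have "(?ls @ [0]) ! r = 0" by (metis nth_append_length)
    then show ?thesis using u assms(5) by (simp only: L_def if_False)
  qed
  have entry: "ev gen_pt (inv_schubert_grass [\<phi> (u + 1), \<phi> (v + 1)] n) = sumL n gen_pt [L ! u, L ! v] (Vl gen_pt)"
    if uv: "u < v" "v < 2 * k" for u v
  proof (cases "v < r")
    case True
    then have v: "0 < \<phi> (v + 1)" "\<phi> (v + 1) \<le> n" "0 < \<phi> (u + 1)" "\<phi> (u + 1) < \<phi> (v + 1)"
      using assms(4) uv less[of "u + 1" "v + 1"] by auto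
    then show ?thesis
      using ev_inv_schubert_grass[OF p, of "[\<phi> (u + 1), \<phi> (v + 1)]" n] nthL uv
      by (simp add: inv_schubert_grass_def)
  next
    case False
    \<comment> \<open>The last column for odd r: \<open>inv_schubert_grass\<close> drops the entry
      0, and \<open>sumL_snoc_0\<close> reinstates it as the padding index.\<close>
    then have v: "odd r" "v = r" using uv unfolding ell[symmetric] by (auto simp: ell_plus_def split: if_splits)
    then have u: "0 < \<phi> (u + 1)" "\<phi> (u + 1) \<le> n" using assms(4) uv by auto
    have "ev gen_pt (inv_schubert_grass [\<phi> (u + 1), \<phi> (v + 1)] n) = sumL n gen_pt [\<phi> (u + 1)] (Vl gen_pt)"
      using ev_inv_schubert_grass[OF p, of "[\<phi> (u + 1)]" n] v u assms(5)
      by (simp add: inv_schubert_grass_def)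
    also have "\<dots> = sumL n gen_pt ([\<phi> (u + 1)] @ [0]) (Vl gen_pt)" using u by (intro sumL_snoc_0[symmetric]) simp
    finally show ?thesis using nthL uv v assms(5) by simp
  qed
  \<comment> \<open>The genuine sequence does not end in 0, so on the left side nothing is
    dropped.\<close>
  have "last ?ls \<in> set ?ls" using assms(2) by (intro last_in_set) simp
  then have "last ?ls \<noteq> 0" using rng by fastforce
  then have "ev gen_pt (inv_schubert_grass ?ls n) = sumL n gen_pt ?ls (Vl gen_pt)"
    unfolding inv_schubert_grass_def using ev_inv_schubert_grass[OF p sorted rng] by simp
  also have "\<dots> = sumL n gen_pt L (Vl gen_pt)"
    by (cases "even r") (simp_all only: L_def if_True if_False sumL_snoc_0[OF z])
  also have "\<dots> = pf_sum k (\<lambda>u v. sumL n gen_pt [L ! u, L ! v] (Vl gen_pt))"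
  proof (rule pf_sum_list[symmetric, where A = "\<lambda>a b. sumL n gen_pt [a, b] (Vl gen_pt)"])
    show "sumL n gen_pt [] (Vl gen_pt) = 1" by simp
  qed (rule sumL_expand[OF p] d lenL | assumption)+
  also have "\<dots> = pf_sum k (\<lambda>u v. ev gen_pt (inv_schubert_grass [\<phi> (u + 1), \<phi> (v + 1)] n))"
    by (rule pf_sum_cong) (rule entry[symmetric])
  also have "\<dots> = ev gen_pt (pfaffian (skew_mat (ell_plus r) (\<lambda>i j. inv_schubert_grass [\<phi> i, \<phi> j] n)))"
    unfolding ell ev_pfaffian ..
  finally show "ev gen_pt (inv_schubert_grass ?ls n)
    = ev gen_pt (pfaffian (skew_mat (ell_plus r) (\<lambda>i j. inv_schubert_grass [\<phi> i, \<phi> j] n)))" .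
qed

end
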